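(* Let $S$ be a finite monoid, $\Bbbk$ a subfield of $\mathbb{C}$, and $\Bbbk[S]$ the semigroup algebra with standard positive basis $\mathbf{B}=\{s: s\in S\}$. Let $\mathcal{L}$ be a left cell and let $\mathcal{J}$ be the apex of the cell module $C_{\mathcal{L}}$. Let $e\in\mathcal{J}$ be an idempotent, $\mathcal{L}_e$ the left cell containing $e$, and $G$ the maximal subgroup of $S$ corresponding to $e$. Let $L_e$ be the simple top of the $\Bbbk[S]$-module $$\Delta(\mathcal{L}_e,\Bbbk_{\mathrm{triv}})=C_{\mathcal{L}_e}\otimes_{\Bbbk[G]}\Bbbk_{\mathrm{triv}}.$$ Then the simple $\Bbbk[S]$-module $L_e$ is (isomorphic to) the special subquotient $L_{\mathcal{L}}$ of $C_{\mathcal{L}}$.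
   Context: Modules are left modules. Basis elements are identified with their indices, so cells are subsets of $S$. For $x,y\in S$ write $x\le_L y$ if $y=sx$ for some $s\in S$, and $x\le_J y$ if $y=sxt$ for some $s,t\in S$. The equivalence classes of the associated equivalence relations are the left cells and two-sided cells (Green's $L$- and $J$-classes), partially ordered by $\le_L$ and $\le_J$ respectively. Cell module: for a left cell $\mathcal{L}$, let $\overline{\mathcal{L}}$ be the union of all left cells $\mathcal{L}'\ge_L\mathcal{L}$. The spans of $\overline{\mathcal{L}}$ and of $\overline{\mathcal{L}}\setminus\mathcal{L}$ are left ideals of $\Bbbk[S]$, and $C_{\mathcal{L}}$ is the quotient of the first by the second; its basis $\mathbf{B}_{\mathcal{L}}$ consists of the images of the elements of $\mathcal{L}$. Apex: the apex of $C_{\mathcal{L}}$ is the maximum element, with respect to $\le_J$ (it exists), of the set of two-sided cells containing some $s$ with $s\cdot C_{\mathcal{L}}\neq0$. The apex is a regular $J$-class, hence contains an idempotent. The maximal subgroup $G$ corresponding to $e$ is the group of invertible elements of the monoid $eSe$. Right multiplication by elements of $G$ makes $C_{\mathcal{L}_e}$ a $\Bbbk[S]$-$\Bbbk[G]$-bimodule. $\Bbbk_{\mathrm{triv}}$ is the trivial $G$-module. The module $\Delta(\mathcal{L}_e,\Bbbk_{\mathrm{triv}})$ has simple top. Special subquotient: let $a=\sum_{s\in S}c_ss$ with all $c_s\in\mathbb{R}_{>0}\cap\Bbbk$. The matrix of $a$ on $C_{\mathcal{L}}$ in the basis $\mathbf{B}_{\mathcal{L}}$ has positive real entries; let $\lambda$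 be its Perron-Frobenius eigenvalue. The special subquotient $L_{\mathcal{L}}$ of $C_{\mathcal{L}}$ is the simple subquotient (unique up to isomorphism, of composition multiplicity one, independent of the $c_s$) such that $\lambda$ is an eigenvalue of $a$ acting on it. *)

theory Defs
  imports
    "HOL-Algebra.Subrings"
    "HOL-Algebra.Free_Abelian_Groups"
    "Jordan_Normal_Form.Char_Poly"
    "Jordan_Normal_Form.VS_Connect"
begin

hide_const (open) Multiset.mult Polynomial.smult

section \<open>Left modules over a (noncommutative) ring\<close>

text \<open>
  The locale \<^locale>\<open>Module.module\<close> of the library requires a commutative ring of scalars; its record type
  and the notions \<^const>\<open>Module.submodule\<close> and \<^const>\<open>module_hom\<close> do not and are reused.
\<close>

locale left_module = R?: ring R + M?: abelian_group M
  for R :: "('r, 'm) ring_scheme" (structure) and M :: "('r, 'x, 'n) module_scheme" (structure) +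
  assumes smult_closed:
      "\<lbrakk>a \<in> carrier R; x \<in> carrier M\<rbrakk> \<Longrightarrow> a \<odot>\<^bsub>M\<^esub> x \<in> carrier M"
    and smult_l_distr:
      "\<lbrakk>a \<in> carrier R; b \<in> carrier R; x \<in> carrier M\<rbrakk> \<Longrightarrow>
        (a \<oplus>\<^bsub>R\<^esub> b) \<odot>\<^bsub>M\<^esub> x = a \<odot>\<^bsub>M\<^esub> x \<oplus>\<^bsub>M\<^esub> b \<odot>\<^bsub>M\<^esub> x"
    and smult_r_distr:
      "\<lbrakk>a \<in> carrier R; x \<in> carrier M; y \<in> carrier M\<rbrakk> \<Longrightarrow>
        a \<odot>\<^bsub>M\<^esub> (x \<oplus>\<^bsub>M\<^esub> y) = a \<odot>\<^bsub>M\<^esub> x \<oplus>\<^bsub>M\<^esub> a \<odot>\<^bsub>M\<^esub> y"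
    and smult_assoc:
      "\<lbrakk>a \<in> carrier R; b \<in> carrier R; x \<in> carrier M\<rbrakk> \<Longrightarrow>
        (a \<otimes>\<^bsub>R\<^esub> b) \<odot>\<^bsub>M\<^esub> x = a \<odot>\<^bsub>M\<^esub> (b \<odot>\<^bsub>M\<^esub> x)"
    and smult_one:
      "x \<in> carrier M \<Longrightarrow> \<one>\<^bsub>R\<^esub> \<odot>\<^bsub>M\<^esub> x = x"

definition regular_module :: "('r, 'm) ring_scheme \<Rightarrow> ('r, 'r) module" where
  "regular_module R = \<lparr>carrier = carrier R, mult = mult R, one = one R,
     ring.zero = ring.zero R, add = add R, smult = mult R\<rparr>"

definition simple_module :: "('r, 'm) ring_scheme \<Rightarrow> ('r, 'x, 'n) module_scheme \<Rightarrow> bool" where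
  "simple_module R M \<longleftrightarrow> left_module R M \<and> carrier M \<noteq> {\<zero>\<^bsub>M\<^esub>} \<and>
     (\<forall>H. Module.submodule H R M \<longrightarrow> H = {\<zero>\<^bsub>M\<^esub>} \<or> H = carrier M)"

definition module_isomorphic ::
  "('r, 'm) ring_scheme \<Rightarrow> ('r, 'x, 'n) module_scheme \<Rightarrow> ('r, 'y, 'p) module_scheme \<Rightarrow> bool" where
  "module_isomorphic R M N \<longleftrightarrow> (\<exists>f \<in> module_hom R M N. bij_betw f (carrier M) (carrier N))"

definition coset_map ::
  "('r, 'x, 'n) module_scheme \<Rightarrow> 'x set \<Rightarrow> ('x \<Rightarrow> 'x) \<Rightarrow> 'x set \<Rightarrow> 'x set" where
  \<comment> \<open>the map on \<open>M / N\<close> induced by an additive map \<open>f\<close> on \<open>M\<close> that preserves \<open>N\<close>\<close>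
  "coset_map M N f X = (\<Union>x\<in>X. N +>\<^bsub>M\<^esub> f x)"

definition quotient_module ::
  "('r, 'x, 'n) module_scheme \<Rightarrow> 'x set \<Rightarrow> ('r, 'x set) module" where
  \<comment> \<open>the ring multiplication and unit in a module record play no role\<close>
  "quotient_module M N = \<lparr>carrier = a_rcosets\<^bsub>M\<^esub> N, mult = undefined, one = undefined,
     ring.zero = N, add = set_add M, smult = (\<lambda>r. coset_map M N (smult M r))\<rparr>"

definition maximal_submodule ::
  "'x set \<Rightarrow> ('r, 'm) ring_scheme \<Rightarrow> ('r, 'x, 'n) module_scheme \<Rightarrow> bool" where
  "maximal_submodule H R M \<longleftrightarrow> Module.submodule H R M \<and> H \<noteq> carrier M \<and>
     (\<forall>H'. Module.submodule H' R M \<and> H \<subseteq> H' \<longrightarrow> H' = H \<or> H' = carrier M)"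

definition module_radical ::
  "('r, 'm) ring_scheme \<Rightarrow> ('r, 'x, 'n) module_scheme \<Rightarrow> 'x set" where
  "module_radical R M = carrier M \<inter> \<Inter> {H. maximal_submodule H R M}"

definition module_top ::
  "('r, 'm) ring_scheme \<Rightarrow> ('r, 'x, 'n) module_scheme \<Rightarrow> ('r, 'x set) module" where
  "module_top R M = quotient_module M (module_radical R M)"

definition subquotient ::
  "('r, 'm) ring_scheme \<Rightarrow> ('r, 'x) module \<Rightarrow> ('r, 'x set) module \<Rightarrow> bool" where
  "subquotient R M X \<longleftrightarrow> (\<exists>P Q. Module.submodule P R M \<and> Module.submodule Q R M \<and> Q \<subseteq> P \<and>
     X = quotient_module (M\<lparr>carrier := P\<rparr>) Q)"


section \<open>Tensor products\<close>

text \<open>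
  For an \<open>A\<close>-\<open>R\<close>-bimodule \<open>M\<close> (with right action \<open>ract m r\<close>) and a left \<open>R\<close>-module \<open>N\<close>, the
  left \<open>A\<close>-module \<open>M \<otimes>\<^sub>R N\<close> is the quotient of the free abelian group on
  \<open>carrier M \<times> carrier N\<close> by the usual relations. The operators \<open>(m, n) \<mapsto> (a m, n)\<close> do not make
  the free abelian group itself an \<open>A\<close>-module, but they induce the action on the quotient.
\<close>

definition tensor_relations ::
  "('a, 'x, 'n) module_scheme \<Rightarrow> ('r, 'm) ring_scheme \<Rightarrow> ('x \<Rightarrow> 'r \<Rightarrow> 'x) \<Rightarrow>
   ('r, 'y, 'p) module_scheme \<Rightarrow> ('x \<times> 'y \<Rightarrow>\<^sub>0 int) set" where
  "tensor_relations M R ract N =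
     {frag_of (m \<oplus>\<^bsub>M\<^esub> m', n) - frag_of (m, n) - frag_of (m', n) | m m' n.
        m \<in> carrier M \<and> m' \<in> carrier M \<and> n \<in> carrier N} \<union>
     {frag_of (m, n \<oplus>\<^bsub>N\<^esub> n') - frag_of (m, n) - frag_of (m, n') | m n n'.
        m \<in> carrier M \<and> n \<in> carrier N \<and> n' \<in> carrier N} \<union>
     {frag_of (ract m r, n) - frag_of (m, r \<odot>\<^bsub>N\<^esub> n) | m r n.
        m \<in> carrier M \<and> r \<in> carrier R \<and> n \<in> carrier N}"

definition free_module_pairs ::
  "('a, 'x, 'n) module_scheme \<Rightarrow> ('r, 'y, 'p) module_scheme \<Rightarrow> ('a, 'x \<times> 'y \<Rightarrow>\<^sub>0 int) module" where
  "free_module_pairs M N =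
     \<lparr>carrier = carrier (free_Abelian_group (carrier M \<times> carrier N)),
      mult = undefined, one = undefined, ring.zero = 0, add = (+),
      smult = (\<lambda>a. frag_extend (\<lambda>(m, n). frag_of (a \<odot>\<^bsub>M\<^esub> m, n)))\<rparr>"

definition tensor_product ::
  "('a, 'x, 'n) module_scheme \<Rightarrow> ('r, 'm) ring_scheme \<Rightarrow> ('x \<Rightarrow> 'r \<Rightarrow> 'x) \<Rightarrow>
   ('r, 'y, 'p) module_scheme \<Rightarrow> ('a, ('x \<times> 'y \<Rightarrow>\<^sub>0 int) set) module" where
  "tensor_product M R ract N =
     quotient_module (free_module_pairs M N)
       (generate (free_Abelian_group (carrier M \<times> carrier N)) (tensor_relations M R ract N))"


section \<open>Cells\<close>

definition left_le :: "('a, 'b) monoid_scheme \<Rightarrow> 'a \<Rightarrow> 'a \<Rightarrow> bool" where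
  "left_le S x y \<longleftrightarrow> (\<exists>s \<in> carrier S. y = s \<otimes>\<^bsub>S\<^esub> x)"

definition two_sided_le :: "('a, 'b) monoid_scheme \<Rightarrow> 'a \<Rightarrow> 'a \<Rightarrow> bool" where
  "two_sided_le S x y \<longleftrightarrow> (\<exists>s \<in> carrier S. \<exists>t \<in> carrier S. y = s \<otimes>\<^bsub>S\<^esub> x \<otimes>\<^bsub>S\<^esub> t)"

definition left_equiv :: "('a, 'b) monoid_scheme \<Rightarrow> 'a rel" where
  "left_equiv S = {(x, y) \<in> carrier S \<times> carrier S. left_le S x y \<and> left_le S y x}"

definition two_sided_equiv :: "('a, 'b) monoid_scheme \<Rightarrow> 'a rel" where
  "two_sided_equiv S = {(x, y) \<in> carrier S \<times> carrier S. two_sided_le S x y \<and> two_sided_le S y x}"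

definition left_cells :: "('a, 'b) monoid_scheme \<Rightarrow> 'a set set" where
  "left_cells S = carrier S // left_equiv S"

definition two_sided_cells :: "('a, 'b) monoid_scheme \<Rightarrow> 'a set set" where
  "two_sided_cells S = carrier S // two_sided_equiv S"

definition left_cell_of :: "('a, 'b) monoid_scheme \<Rightarrow> 'a \<Rightarrow> 'a set" where
  "left_cell_of S x = left_equiv S `` {x}"

definition left_cell_le :: "('a, 'b) monoid_scheme \<Rightarrow> 'a set \<Rightarrow> 'a set \<Rightarrow> bool" where
  "left_cell_le S L L' \<longleftrightarrow> (\<exists>x \<in> L. \<exists>y \<in> L'. left_le S x y)"

definition two_sided_cell_le :: "('a, 'b) monoid_scheme \<Rightarrow> 'a set \<Rightarrow> 'a set \<Rightarrow> bool" where
  "two_sided_cell_le S J J' \<longleftrightarrow> (\<exists>x \<in> J. \<exists>y \<in> J'. two_sided_le S x y)"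

definition left_cell_closure :: "('a, 'b) monoid_scheme \<Rightarrow> 'a set \<Rightarrow> 'a set" where
  "left_cell_closure S L = \<Union> {L' \<in> left_cells S. left_cell_le S L L'}"


section \<open>The semigroup algebra and its cell modules\<close>

definition delta :: "'a \<Rightarrow> 'a \<Rightarrow> complex" where
  "delta s t = (if t = s then 1 else 0)"

text \<open>
  Elements are coefficient functions vanishing outside \<open>carrier S\<close>. Hence, for a subsemigroup \<open>G\<close>
  of \<open>S\<close>, the algebra of \<open>G\<close> is literally contained in the algebra of \<open>S\<close>.
\<close>

definition semigroup_algebra ::
  "complex set \<Rightarrow> ('a, 'b) monoid_scheme \<Rightarrow> ('a \<Rightarrow> complex) ring" where
  "semigroup_algebra K S =
     \<lparr>carrier = {f. (\<forall>s \<in> carrier S. f s \<in> K) \<and> (\<forall>s. s \<notin> carrier S \<longrightarrow> f s = 0)},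
      mult = (\<lambda>f g u. \<Sum>(s, t) \<in> {(s, t) \<in> carrier S \<times> carrier S. s \<otimes>\<^bsub>S\<^esub> t = u}. f s * g t),
      one = delta \<one>\<^bsub>S\<^esub>,
      ring.zero = (\<lambda>s. 0),
      add = (\<lambda>f g s. f s + g s)\<rparr>"

definition basis_span ::
  "complex set \<Rightarrow> ('a, 'b) monoid_scheme \<Rightarrow> 'a set \<Rightarrow> ('a \<Rightarrow> complex) set" where
  "basis_span K S X = {f \<in> carrier (semigroup_algebra K S). \<forall>s. s \<notin> X \<longrightarrow> f s = 0}"

definition upper_ideal ::
  "complex set \<Rightarrow> ('a, 'b) monoid_scheme \<Rightarrow> 'a set \<Rightarrow> ('a \<Rightarrow> complex, 'a \<Rightarrow> complex) module" where
  "upper_ideal K S L =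
     (regular_module (semigroup_algebra K S))\<lparr>carrier := basis_span K S (left_cell_closure S L)\<rparr>"

definition lower_ideal ::
  "complex set \<Rightarrow> ('a, 'b) monoid_scheme \<Rightarrow> 'a set \<Rightarrow> ('a \<Rightarrow> complex) set" where
  "lower_ideal K S L = basis_span K S (left_cell_closure S L - L)"

definition cell_module ::
  "complex set \<Rightarrow> ('a, 'b) monoid_scheme \<Rightarrow> 'a set \<Rightarrow>
   ('a \<Rightarrow> complex, ('a \<Rightarrow> complex) set) module" where
  "cell_module K S L = quotient_module (upper_ideal K S L) (lower_ideal K S L)"

definition cell_basis ::
  "complex set \<Rightarrow> ('a, 'b) monoid_scheme \<Rightarrow> 'a set \<Rightarrow> 'a \<Rightarrow> ('a \<Rightarrow> complex) set" where
  "cell_basis K S L s = lower_ideal K S L +>\<^bsub>upper_ideal K S L\<^esub> delta s"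

definition is_apex ::
  "complex set \<Rightarrow> ('a, 'b) monoid_scheme \<Rightarrow> 'a set \<Rightarrow> 'a set \<Rightarrow> bool" where
  "is_apex K S L J \<longleftrightarrow>
     (let \<J> = {J \<in> two_sided_cells S. \<exists>s \<in> J. \<exists>x \<in> carrier (cell_module K S L).
                 delta s \<odot>\<^bsub>cell_module K S L\<^esub> x \<noteq> \<zero>\<^bsub>cell_module K S L\<^esub>}
      in J \<in> \<J> \<and> (\<forall>J' \<in> \<J>. two_sided_cell_le S J' J))"


section \<open>Standard modules\<close>

definition local_monoid :: "('a, 'b) monoid_scheme \<Rightarrow> 'a \<Rightarrow> 'a monoid" where
  "local_monoid S e = \<lparr>carrier = {e \<otimes>\<^bsub>S\<^esub> s \<otimes>\<^bsub>S\<^esub> e | s. s \<in> carrier S}, mult = mult S, one = e\<rparr>"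

definition maximal_subgroup :: "('a, 'b) monoid_scheme \<Rightarrow> 'a \<Rightarrow> 'a monoid" where
  "maximal_subgroup S e = units_of (local_monoid S e)"

definition trivial_module ::
  "complex set \<Rightarrow> ('a, 'b) monoid_scheme \<Rightarrow> ('a \<Rightarrow> complex, complex) module" where
  "trivial_module K G = \<lparr>carrier = K, mult = (*), one = 1, ring.zero = 0, add = (+),
     smult = (\<lambda>f k. (\<Sum>g \<in> carrier G. f g) * k)\<rparr>"

definition cell_right_action ::
  "complex set \<Rightarrow> ('a, 'b) monoid_scheme \<Rightarrow> 'a set \<Rightarrow>
   ('a \<Rightarrow> complex) set \<Rightarrow> ('a \<Rightarrow> complex) \<Rightarrow> ('a \<Rightarrow> complex) set" where
  "cell_right_action K S L X g =
     coset_map (upper_ideal K S L) (lower_ideal K S L) (\<lambda>x. x \<otimes>\<^bsub>semigroup_algebra K S\<^esub> g) X"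

definition standard_module ::
  "complex set \<Rightarrow> ('a, 'b) monoid_scheme \<Rightarrow> 'a \<Rightarrow> ('a \<Rightarrow> complex, 'v) module \<Rightarrow>
   ('a \<Rightarrow> complex, (('a \<Rightarrow> complex) set \<times> 'v \<Rightarrow>\<^sub>0 int) set) module" where
  "standard_module K S e V =
     tensor_product (cell_module K S (left_cell_of S e))
       (semigroup_algebra K (maximal_subgroup S e))
       (cell_right_action K S (left_cell_of S e)) V"


section \<open>Eigenvalues and the special subquotient\<close>

definition underlying_space ::
  "('a, 'b) monoid_scheme \<Rightarrow> ('a \<Rightarrow> complex, 'x) module \<Rightarrow> (complex, 'x) module" where
  "underlying_space S M = \<lparr>carrier = carrier M, mult = mult M, one = one M,
     ring.zero = ring.zero M, add = add M, smult = (\<lambda>k. smult M (\<lambda>t. k * delta \<one>\<^bsub>S\<^esub> t))\<rparr>"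

definition matrix_in_basis ::
  "complex set \<Rightarrow> ('a, 'b) monoid_scheme \<Rightarrow> ('a \<Rightarrow> complex, 'x) module \<Rightarrow>
   ('a \<Rightarrow> complex) \<Rightarrow> 'x list \<Rightarrow> complex mat \<Rightarrow> bool" where
  "matrix_in_basis K S M a bs A \<longleftrightarrow>
     distinct bs \<and> vectorspace.basis (class_ring\<lparr>carrier := K\<rparr>) (underlying_space S M) (set bs) \<and>
     A \<in> carrier_mat (length bs) (length bs) \<and> elements_mat A \<subseteq> K \<and>
     (\<forall>j < length bs. a \<odot>\<^bsub>M\<^esub> bs ! j =
        (\<Oplus>\<^bsub>M\<^esub>i \<in> {..<length bs}. A $$ (i, j) \<odot>\<^bsub>underlying_space S M\<^esub> bs ! i))"

text \<open>
  The matrix is taken over \<open>\<complex>\<close>, since the eigenvalue need not belong to \<open>K\<close>; whether it is an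
  eigenvalue does not depend on the \<open>K\<close>-basis.
\<close>

definition acts_with_eigenvalue ::
  "complex set \<Rightarrow> ('a, 'b) monoid_scheme \<Rightarrow> ('a \<Rightarrow> complex, 'x) module \<Rightarrow>
   ('a \<Rightarrow> complex) \<Rightarrow> complex \<Rightarrow> bool" where
  "acts_with_eigenvalue K S M a \<mu> \<longleftrightarrow> (\<exists>bs A. matrix_in_basis K S M a bs A \<and> eigenvalue A \<mu>)"

definition perron_frobenius_eigenvalue :: "complex mat \<Rightarrow> real \<Rightarrow> bool" where
  "perron_frobenius_eigenvalue A r \<longleftrightarrow> r > 0 \<and> eigenvalue A (complex_of_real r) \<and>
     (\<forall>\<mu>. eigenvalue A \<mu> \<and> \<mu> \<noteq> complex_of_real r \<longrightarrow> cmod \<mu> < r)"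

definition cell_perron_frobenius ::
  "complex set \<Rightarrow> ('a, 'b) monoid_scheme \<Rightarrow> 'a set \<Rightarrow> ('a \<Rightarrow> complex) \<Rightarrow> real \<Rightarrow> bool" where
  "cell_perron_frobenius K S L a r \<longleftrightarrow>
     (\<exists>xs A. distinct xs \<and> set xs = L \<and>
        matrix_in_basis K S (cell_module K S L) a (map (cell_basis K S L) xs) A \<and>
        perron_frobenius_eigenvalue A r)"

definition special_subquotient ::
  "complex set \<Rightarrow> ('a, 'b) monoid_scheme \<Rightarrow> 'a set \<Rightarrow> ('a \<Rightarrow> complex) \<Rightarrow>
   ('a \<Rightarrow> complex, ('a \<Rightarrow> complex) set set) module \<Rightarrow> bool" where
  "special_subquotient K S L a X \<longleftrightarrow>
     subquotient (semigroup_algebra K S) (cell_module K S L) X \<and>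
     simple_module (semigroup_algebra K S) X \<and>
     (\<exists>r. cell_perron_frobenius K S L a r \<and> acts_with_eigenvalue K S X a (complex_of_real r))"

end

theory Submission
  imports Defs "Jordan_Normal_Form.Spectral_Radius"
begin

text \<open>
  Write \<open>A = K[S]\<close>, \<open>M = C\<^sub>L\<close>, and let \<open>G\<close> be the maximal subgroup at \<open>e\<close>. The proof rests on the element
  \<open>\<epsilon> = \<Sum>\<^bsub>g\<in>G\<^esub> g\<close> of \<open>A\<close> (the function \<open>gsum\<close> in the formal text), which has rank one on \<open>M\<close>.
  Indeed, by maximality of the apex every element of \<open>eSe\<close> that does not annihilate \<open>M\<close> lies in \<open>G\<close> (lemma \<open>local_acts_imp_G\<close>). Therefore \<open>G\<close> permutes the
  set \<open>X0 = {x \<in> L. ex = x}\<close> transitively, \<open>\<epsilon>M\<close> is the line spanned by \<open>v0 = \<Sum>\<^bsub>x\<in>X0\<^esub> x\<close>, and \<open>\<epsilon>v0\<close> is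
  a positive multiple of \<open>v0\<close> (lemmas \<open>act_gsum\<close> and \<open>act_gsum_v0\<close>; the image of \<open>v0\<close> in \<open>M\<close> is \<open>m0\<close>).

  If \<open>a\<close> has its Perron-Frobenius eigenvalue \<open>r\<close> on a simple subquotient \<open>P/Q\<close> of \<open>M\<close>, then \<open>\<epsilon>\<close> acts
  on \<open>P/Q\<close> as a nonzero operator. To see this, express the eigenvalue by a nonzero \<open>K\<close>-linear functional
  \<open>\<psi>\<close> to the complex numbers with \<open>\<psi>(av) = r\<psi>(v)\<close>. If \<open>\<psi>\<close> killed the image of \<open>\<epsilon>\<close>, then \<open>a\<close> could be
  replaced by \<open>b = a - (1/n)\<epsilon>a\<close> in this equation. For large \<open>n\<close> the matrix of \<open>b\<close> is still nonnegative,
  but \<open>b\<close> multiplies the norm weighted by the positive left eigenvector of \<open>a\<close> by at most some \<open>\<rho> < r\<close>;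
  iteration of \<open>b\<close> shows \<open>\<psi> = 0\<close>, a contradiction (theorem \<open>perron_eigenfunctional_vanishes\<close>). The
  functional keeps the argument over \<open>K\<close>, although \<open>r\<close> need not lie in \<open>K\<close>. Hence a special
  subquotient satisfies \<open>v0 \<in> P - Q\<close> (lemma \<open>special_contains_m0\<close>). Conversely, for \<open>P = Av0\<close> and
  \<open>Q = {x \<in> P. \<epsilon>Ax = 0}\<close> the quotient is simple, and the functional given by the positive left
  eigenvector vanishes on \<open>Q\<close> but not at \<open>v0\<close>, so that \<open>P/Q\<close> is special.

  It remains to identify such a \<open>P/Q\<close> with the top of the standard module \<open>\<Delta>\<close>. The rule
  \<open>s \<otimes> 1 \<mapsto> s v0\<close> is well defined, because \<open>G\<close> fixes \<open>v0\<close> and because the elements of \<open>Se\<close> outside the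
  left cell of \<open>e\<close> annihilate \<open>M\<close>. It induces a nonzero, hence surjective, homomorphism from \<open>\<Delta>\<close> onto
  \<open>P/Q\<close>. Since \<open>\<epsilon>\<Delta>\<close> is contained in the line of the generator \<open>e \<otimes> 1\<close> while \<open>\<epsilon>\<close> acts as a nonzero
  operator on \<open>P/Q\<close>, the kernel contains every proper submodule of \<open>\<Delta>\<close> (theorem \<open>module_top_isomorphic\<close>).
\<close>

section \<open>Perron-Frobenius theory of positive matrices\<close>

text \<open>
  On the positive vector \<open>z\<close> the powers of the matrix grow at least like \<open>t ^ k\<close>, whereas the Jordan
  normal form bounds all powers of a matrix of spectral radius less than \<open>1\<close>.
\<close>

lemma positive_supersolution_imp_spectral_radius_ge_one:
  fixes A :: "complex mat" and b :: "nat \<Rightarrow> nat \<Rightarrow> real" and z :: "nat \<Rightarrow> real"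
  assumes A: "A = mat n n (\<lambda>(i, j). complex_of_real (b i j))"
    and b: "\<And>i j. i < n \<Longrightarrow> j < n \<Longrightarrow> 0 \<le> b i j"
    and z: "\<And>i. i < n \<Longrightarrow> 0 < z i" and n: "0 < n" and t: "1 < t"
    and le: "\<And>i. i < n \<Longrightarrow> t * z i \<le> (\<Sum>j<n. b i j * z j)"
  shows "1 \<le> spectral_radius A"
proof (rule ccontr)
  assume "\<not> 1 \<le> spectral_radius A"
  then have "spectral_radius A < 1" by simp
  have Ac: "A \<in> carrier_mat n n" unfolding A by simp
  obtain es where "char_poly A = (\<Prod>a\<leftarrow>es. [:- a, 1:])" using char_poly_factorized[OF Ac] by blast
  from spectral_radius_jnf_norm_bound_less_1[OF Ac \<open>spectral_radius A < 1\<close> jordan_nf_exists[OF Ac this]]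
  obtain c where c: "\<And>k. norm_bound (A ^\<^sub>m k) c" by blast
  have pow: "\<exists>g. A ^\<^sub>m k *\<^sub>v vec n (\<lambda>i. complex_of_real (f i)) = vec n (\<lambda>i. complex_of_real (g i)) \<and>
      (\<forall>i<n. s * t ^ k * z i \<le> g i)" if "0 \<le> s" "\<forall>i<n. s * z i \<le> f i" for k f s
    using that
  proof (induction k arbitrary: f s)
    case 0
    then show ?case using Ac by (auto intro!: exI[of _ f])
  next
    case (Suc k)
    define f' where "f' i = (\<Sum>j<n. b i j * f j)" for i
    have step: "A *\<^sub>v vec n (\<lambda>i. complex_of_real (f i)) = vec n (\<lambda>i. complex_of_real (f' i))"
      by (rule eq_vecI) (simp_all add: A f'_def scalar_prod_def atLeast0LessThan)
    have "s * t * z i \<le> f' i" if "i < n" for i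
    proof -
      have "s * t * z i \<le> s * (\<Sum>j<n. b i j * z j)"
        using le[OF that] Suc.prems(1) by (simp add: mult.assoc mult_left_mono)
      also have "\<dots> = (\<Sum>j<n. b i j * (s * z j))"
        by (simp add: sum_distrib_left mult_ac)
      also have "\<dots> \<le> f' i"
        unfolding f'_def using Suc.prems b that by (intro sum_mono mult_left_mono) auto
      finally show ?thesis .
    qed
    with Suc.IH[of "s * t" f'] Suc.prems(1) t obtain g where
      g: "A ^\<^sub>m k *\<^sub>v vec n (\<lambda>i. complex_of_real (f' i)) = vec n (\<lambda>i. complex_of_real (g i))"
         "\<forall>i<n. s * t * t ^ k * z i \<le> g i" by auto
    have "A ^\<^sub>m Suc k *\<^sub>v vec n (\<lambda>i. complex_of_real (f i)) =
          A ^\<^sub>m k *\<^sub>v (A *\<^sub>v vec n (\<lambda>i. complex_of_real (f i)))"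
      using Ac by (simp add: assoc_mult_mat_vec[of _ n n _ n])
    then show ?case using g step by (auto simp: mult_ac intro!: exI[of _ g])
  qed
  define C where "C = (\<Sum>j<n. c * z j)"
  have bound: "t ^ k * z 0 \<le> C" for k
  proof -
    obtain g where g: "A ^\<^sub>m k *\<^sub>v vec n (\<lambda>i. complex_of_real (z i)) = vec n (\<lambda>i. complex_of_real (g i))"
      "\<forall>i<n. 1 * t ^ k * z i \<le> g i" using pow[of 1 z k] by auto
    have Ak: "A ^\<^sub>m k \<in> carrier_mat n n" using Ac by simp
    have "t ^ k * z 0 \<le> g 0" using g(2) n by auto
    also have "\<dots> \<le> cmod (vec n (\<lambda>i. complex_of_real (g i)) $ 0)" using n by simp
    also have "vec n (\<lambda>i. complex_of_real (g i)) $ 0 = (\<Sum>j<n. (A ^\<^sub>m k) $$ (0, j) * z j)"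
      unfolding g(1)[symmetric] using carrier_matD[OF Ak] n
      by (simp add: scalar_prod_def atLeast0LessThan del: pow_mat_dim)
    also have "cmod \<dots> \<le> (\<Sum>j<n. cmod ((A ^\<^sub>m k) $$ (0, j) * z j))" by (rule norm_sum)
    also have "\<dots> \<le> C" unfolding C_def
    proof (rule sum_mono)
      fix j assume "j \<in> {..<n}"
      then show "cmod ((A ^\<^sub>m k) $$ (0, j) * complex_of_real (z j)) \<le> c * z j"
        using c[of k, unfolded norm_bound_def carrier_matD[OF Ak]] n z[of j]
        by (auto simp: norm_mult intro!: mult_right_mono)
    qed
    finally show ?thesis .
  qed
  obtain k where "C / z 0 < t ^ k" using real_arch_pow[OF t] by blast
  then have "C < t ^ k * z 0" using z[OF n] by (simp add: divide_less_eq)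
  with bound[of k] show False by simp
qed

text \<open>
  Let \<open>v\<close> be an eigenvector for an eigenvalue of maximal modulus \<open>r\<close>. Its vector of moduli \<open>y\<close> satisfies
  \<open>b y \<ge> r y\<close>. If this inequality were strict in one coordinate, then positivity would make it
  strict in every coordinate for \<open>y' = b y\<close>, and \<open>b / s\<close> for some \<open>s > r\<close> would have a strict positive
  supersolution although its spectral radius is \<open>r / s < 1\<close>.
\<close>

theorem perron_eigenvector_exists:
  fixes b :: "nat \<Rightarrow> nat \<Rightarrow> real"
  assumes b: "\<And>i j. i < n \<Longrightarrow> j < n \<Longrightarrow> 0 < b i j" and n: "0 < n"
  shows "\<exists>r y. 0 < r \<and> (\<forall>i<n. 0 < y i) \<and> (\<forall>i<n. (\<Sum>j<n. b i j * y j) = r * y i)"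
proof -
  define A where "A = mat n n (\<lambda>(i, j). complex_of_real (b i j))"
  have Ac: "A \<in> carrier_mat n n" unfolding A_def by simp
  define r where "r = spectral_radius A"
  obtain \<mu> where mu: "eigenvalue A \<mu>" "cmod \<mu> = r"
    using spectral_radius_mem_max(1)[OF Ac n] unfolding r_def spectrum_def by auto
  then obtain v where v: "v \<in> carrier_vec n" "v \<noteq> 0\<^sub>v n" "A *\<^sub>v v = \<mu> \<cdot>\<^sub>v v"
    using Ac unfolding eigenvalue_def eigenvector_def by auto
  define y where "y i = cmod (v $ i)" for i
  define y' where "y' i = (\<Sum>j<n. b i j * y j)" for i
  have r0: "0 \<le> r" using mu(2) by (metis norm_ge_zero)
  have y0: "0 \<le> y i" for i unfolding y_def by simp
  obtain k where k: "k < n" "0 < y k"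
    using v(1,2) unfolding y_def by (metis carrier_vecD eq_vecI index_zero_vec zero_less_norm_iff)
  have sub: "r * y i \<le> y' i" if i: "i < n" for i
  proof -
    have "(\<mu> \<cdot>\<^sub>v v) $ i = (\<Sum>j<n. b i j * v $ j)"
      unfolding v(3)[symmetric] using v(1) i by (simp add: A_def scalar_prod_def atLeast0LessThan)
    then have "\<mu> * v $ i = (\<Sum>j<n. b i j * v $ j)" using v(1) i by simp
    then have "r * y i = cmod (\<Sum>j<n. b i j * v $ j)" unfolding y_def mu(2)[symmetric]
      by (metis norm_mult)
    also have "\<dots> \<le> (\<Sum>j<n. cmod (b i j * v $ j))" by (rule norm_sum)
    also have "\<dots> = y' i" unfolding y'_def y_def
      using b[OF i] by (intro sum.cong) (auto simp: norm_mult abs_of_pos)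
    finally show ?thesis .
  qed
  have pos: "0 < (\<Sum>j<n. b i j * w j)" if "i < n" "\<And>j. j < n \<Longrightarrow> 0 \<le> w j" "l < n" "0 < w l" for i l and w :: "nat \<Rightarrow> real"
    using that by (intro sum_pos2[of _ l]) (auto intro!: mult_nonneg_nonneg mult_pos_pos less_imp_le[OF b] b)
  have y'pos: "0 < y' i" if "i < n" for i
    unfolding y'_def using pos[OF that, of y k] k y0 by auto
  have eq: "y' i = r * y i" if i: "i < n" for i
  proof (rule ccontr)
    assume "y' i \<noteq> r * y i"
    then have l: "0 < y' i - r * y i" using sub[OF i] by simp
    define d where "d j = (\<Sum>l<n. b j l * (y' l - r * y l))" for j
    have d: "0 < d j" if "j < n" for j
      unfolding d_def using pos[OF that, of "\<lambda>l. y' l - r * y l" i] sub i l by auto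
    have deq: "(\<Sum>l<n. b j l * y' l) = r * y' j + d j" for j
      unfolding d_def y'_def[of j] by (simp add: algebra_simps sum_subtractf sum_distrib_left)
    define e where "e = Min ((\<lambda>j. d j / y' j) ` {..<n})"
    have e_pos: "0 < e" unfolding e_def using n d y'pos by (subst Min_gr_iff) auto
    have e_le: "e * y' j \<le> d j" if "j < n" for j
    proof -
      have "e \<le> d j / y' j" unfolding e_def using that by (intro Min_le) auto
      then show ?thesis using y'pos[OF that] by (simp add: le_divide_eq)
    qed
    \<comment> \<open>every number strictly between \<open>r\<close> and \<open>r + e\<close> serves\<close>
    define s where "s = r + e / 2"
    have s: "0 < s" "r < s" "s < r + e" unfolding s_def using r0 e_pos by auto
    define B where "B = mat n n (\<lambda>(i, j). complex_of_real (b i j / s))"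
    have Bc: "B \<in> carrier_mat n n" unfolding B_def by simp
    have "1 \<le> spectral_radius B"
    proof (rule positive_supersolution_imp_spectral_radius_ge_one[OF B_def _ y'pos n])
      show "1 < (r + e) / s" using s by simp
      show "0 \<le> b i j / s" if "i < n" "j < n" for i j using b[OF that] s by simp
      show "(r + e) / s * y' j \<le> (\<Sum>l<n. b j l / s * y' l)" if "j < n" for j
      proof -
        have "(\<Sum>l<n. b j l / s * y' l) = (r * y' j + d j) / s"
          unfolding deq[symmetric] by (simp add: sum_divide_distrib)
        then show ?thesis using e_le[OF that] s by (simp add: field_simps)
      qed
    qed
    moreover have "spectral_radius B \<le> r / s"
    proof -
      obtain \<nu> where nu: "eigenvalue B \<nu>" "cmod \<nu> = spectral_radius B"
        using spectral_radius_mem_max(1)[OF Bc n] unfolding spectrum_def by auto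
      then obtain w where w: "w \<in> carrier_vec n" "w \<noteq> 0\<^sub>v n" "B *\<^sub>v w = \<nu> \<cdot>\<^sub>v w"
        using Bc unfolding eigenvalue_def eigenvector_def by auto
      have "A = complex_of_real s \<cdot>\<^sub>m B"
        by (rule eq_matI) (use s in \<open>auto simp: A_def B_def\<close>)
      then have "A *\<^sub>v w = complex_of_real s \<cdot>\<^sub>v (B *\<^sub>v w)"
        using w(1) Bc by (intro eq_vecI) (auto simp: scalar_prod_def sum_distrib_left mult.assoc)
      then have "A *\<^sub>v w = (s * \<nu>) \<cdot>\<^sub>v w" by (simp add: w(3) smult_smult_assoc)
      then have "eigenvalue A (s * \<nu>)"
        using w Ac unfolding eigenvalue_def eigenvector_def by auto
      then have "cmod (s * \<nu>) \<le> r"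
        unfolding r_def by (intro spectral_radius_mem_max(2)[OF Ac n]) (auto simp: spectrum_def)
      then show ?thesis using s nu(2) by (simp add: norm_mult field_simps)
    qed
    ultimately have "1 \<le> r / s" by simp
    then show False using s by simp
  qed
  have "0 < r * y k" using eq[OF k(1)] y'pos[OF k(1)] by simp
  then have r: "0 < r" using k(2) by (simp add: zero_less_mult_iff)
  have "0 < y i" if "i < n" for i
    using eq[OF that] y'pos[OF that] r by (metis zero_less_mult_pos)
  then show ?thesis using r eq unfolding y'_def by blast
qed

text \<open>
  The triangle inequality and an exchange of sums move \<open>b\<close> from the vector \<open>v\<close> to the row vector \<open>y\<close> of
  weights, where \<open>y b \<le> \<rho> y\<close> bounds it. All spectral estimates below come from this inequality.
\<close>

lemma weighted_norm_contraction:
  fixes b :: "'i \<Rightarrow> 'i \<Rightarrow> real" and v :: "'i \<Rightarrow> complex"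
  assumes I: "finite I" and b: "\<And>i j. i \<in> I \<Longrightarrow> j \<in> I \<Longrightarrow> 0 \<le> b i j"
    and y: "\<And>i. i \<in> I \<Longrightarrow> 0 \<le> y i"
    and le: "\<And>j. j \<in> I \<Longrightarrow> (\<Sum>i\<in>I. y i * b i j) \<le> \<rho> * y j"
  shows "(\<Sum>i\<in>I. y i * cmod (\<Sum>j\<in>I. b i j * v j)) \<le> \<rho> * (\<Sum>j\<in>I. y j * cmod (v j))"
proof -
  have "(\<Sum>i\<in>I. y i * cmod (\<Sum>j\<in>I. b i j * v j)) \<le> (\<Sum>i\<in>I. y i * (\<Sum>j\<in>I. b i j * cmod (v j)))"
  proof (intro sum_mono mult_left_mono)
    fix i assume i: "i \<in> I"
    have "cmod (\<Sum>j\<in>I. b i j * v j) \<le> (\<Sum>j\<in>I. cmod (b i j * v j))" by (rule norm_sum)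
    also have "\<dots> = (\<Sum>j\<in>I. b i j * cmod (v j))"
      using b[OF i] by (intro sum.cong) (auto simp: norm_mult)
    finally show "cmod (\<Sum>j\<in>I. b i j * v j) \<le> (\<Sum>j\<in>I. b i j * cmod (v j))" .
  qed (use y in auto)
  also have "\<dots> = (\<Sum>j\<in>I. (\<Sum>i\<in>I. y i * b i j) * cmod (v j))"
    unfolding sum_distrib_left sum_distrib_right by (subst sum.swap) (simp add: mult_ac)
  also have "\<dots> \<le> (\<Sum>j\<in>I. \<rho> * y j * cmod (v j))"
    using le by (intro sum_mono mult_right_mono) auto
  finally show ?thesis by (simp add: sum_distrib_left mult_ac)
qed

lemma eigenvalue_transpose:
  fixes A :: "'a :: field mat"
  assumes "A \<in> carrier_mat n n"
  shows "eigenvalue (transpose_mat A) \<mu> \<longleftrightarrow> eigenvalue A \<mu>"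
  using assms eigenvalue_root_char_poly[of A n \<mu>] eigenvalue_root_char_poly[of "transpose_mat A" n \<mu>]
  by simp

lemma eigenvalue_iff_left_eigenvector:
  fixes A :: "'a :: field mat"
  assumes A: "A \<in> carrier_mat n n"
  shows "eigenvalue A \<mu> \<longleftrightarrow>
    (\<exists>z. (\<exists>i<n. z i \<noteq> 0) \<and> (\<forall>j<n. (\<Sum>i<n. z i * A $$ (i, j)) = \<mu> * z j))"
proof -
  have "eigenvalue A \<mu> \<longleftrightarrow> (\<exists>v. v \<in> carrier_vec n \<and> v \<noteq> 0\<^sub>v n \<and> transpose_mat A *\<^sub>v v = \<mu> \<cdot>\<^sub>v v)"
    unfolding eigenvalue_transpose[OF A, symmetric] using A
    by (simp add: eigenvalue_def eigenvector_def)
  also have "\<dots> \<longleftrightarrow> (\<exists>z. (\<exists>i<n. z i \<noteq> 0) \<and> (\<forall>j<n. (\<Sum>i<n. z i * A $$ (i, j)) = \<mu> * z j))"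
  proof safe
    fix v assume v: "v \<in> carrier_vec n" "v \<noteq> 0\<^sub>v n" "transpose_mat A *\<^sub>v v = \<mu> \<cdot>\<^sub>v v"
    have "\<exists>i<n. v $ i \<noteq> 0" using v by (metis carrier_vecD eq_vecI index_zero_vec)
    moreover have "(\<Sum>i<n. v $ i * A $$ (i, j)) = \<mu> * v $ j" if "j < n" for j
    proof -
      have "(transpose_mat A *\<^sub>v v) $ j = (\<Sum>i<n. A $$ (i, j) * v $ i)"
        using A v(1) that by (simp add: scalar_prod_def atLeast0LessThan)
      then show ?thesis unfolding v(3) using v(1) that by (simp add: mult.commute)
    qed
    ultimately show "\<exists>z. (\<exists>i<n. z i \<noteq> 0) \<and> (\<forall>j<n. (\<Sum>i<n. z i * A $$ (i, j)) = \<mu> * z j)"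
      by (intro exI[of _ "\<lambda>i. v $ i"]) auto
  next
    fix z i assume z: "\<forall>j<n. (\<Sum>i<n. z i * A $$ (i, j)) = \<mu> * z j" "i < n" "z i \<noteq> 0"
    have "transpose_mat A *\<^sub>v vec n z = \<mu> \<cdot>\<^sub>v vec n z"
      using A z(1) by (intro eq_vecI) (auto simp: scalar_prod_def atLeast0LessThan mult.commute)
    moreover have "vec n z \<noteq> 0\<^sub>v n" using z(2,3) by (metis index_vec index_zero_vec(1))
    ultimately show "\<exists>v. v \<in> carrier_vec n \<and> v \<noteq> 0\<^sub>v n \<and> transpose_mat A *\<^sub>v v = \<mu> \<cdot>\<^sub>v v"
      by (intro exI[of _ "vec n z"]) auto
  qed
  finally show ?thesis .
qed

text \<open>
  The disc of radius \<open>r - t\<close> around \<open>t\<close> touches the circle of radius \<open>r\<close> around \<open>0\<close> only at \<open>r\<close>.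
\<close>

lemma in_disc_imp_norm_less:
  fixes \<mu> :: complex
  assumes "cmod (\<mu> - complex_of_real t) \<le> r - t" "0 < t" "\<mu> \<noteq> complex_of_real r"
  shows "cmod \<mu> < r"
proof (rule ccontr)
  assume "\<not> cmod \<mu> < r"
  moreover have "0 \<le> r - t" using assms(1) norm_ge_zero order_trans by blast
  ultimately have "r\<^sup>2 \<le> (cmod \<mu>)\<^sup>2" using assms(2) by (intro power_mono) auto
  then have 1: "r\<^sup>2 \<le> (Re \<mu>)\<^sup>2 + (Im \<mu>)\<^sup>2" by (simp add: cmod_power2)
  have "(cmod (\<mu> - complex_of_real t))\<^sup>2 \<le> (r - t)\<^sup>2" using assms(1) by (intro power_mono) auto
  then have 2: "(Re \<mu> - t)\<^sup>2 + (Im \<mu>)\<^sup>2 \<le> (r - t)\<^sup>2" by (simp add: cmod_power2)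
  have "t * r \<le> t * Re \<mu>" using 1 2 by (simp add: power2_eq_square algebra_simps)
  then have re: "r \<le> Re \<mu>" using assms(2) by simp
  then have "(r - t)\<^sup>2 \<le> (Re \<mu> - t)\<^sup>2" using \<open>0 \<le> r - t\<close> by (intro power_mono) auto
  with 2 have im: "(Im \<mu>)\<^sup>2 \<le> 0" by linarith
  have "(Re \<mu> - t)\<^sup>2 \<le> (r - t)\<^sup>2" using 2 zero_le_power2[of "Im \<mu>"] by linarith
  then have "Re \<mu> - t \<le> r - t" using \<open>0 \<le> r - t\<close> by (rule power2_le_imp_le)
  with re im assms(3) show False by (simp add: complex_eq_iff)
qed

text \<open>
  The eigenvalue of a positive left eigenvector dominates: the matrix stays nonnegative when the
  smallest diagonal entry \<open>t\<close> is subtracted from its diagonal, so the weighted norm confines every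
  eigenvalue to the disc of radius \<open>r - t\<close> around \<open>t\<close>.
\<close>

theorem perron_frobenius_left:
  fixes A :: "complex mat" and b :: "nat \<Rightarrow> nat \<Rightarrow> real"
  assumes A: "A \<in> carrier_mat n n" and Ab: "\<And>i j. i < n \<Longrightarrow> j < n \<Longrightarrow> A $$ (i, j) = b i j"
    and b: "\<And>i j. i < n \<Longrightarrow> j < n \<Longrightarrow> 0 < b i j" and n: "0 < n"
  obtains r y where "perron_frobenius_eigenvalue A r" "\<And>i. i < n \<Longrightarrow> 0 < y i"
    "\<And>j. j < n \<Longrightarrow> (\<Sum>i<n. y i * b i j) = r * y j"
proof -
  obtain r y where r: "0 < r" and y: "\<And>i. i < n \<Longrightarrow> 0 < y i"
    and eq: "\<And>j. j < n \<Longrightarrow> (\<Sum>i<n. y i * b i j) = r * y j"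
    using perron_eigenvector_exists[of n "\<lambda>i j. b j i"] b n by (auto simp: mult.commute)
  have "eigenvalue A r"
    unfolding eigenvalue_iff_left_eigenvector[OF A]
  proof (intro exI[of _ "\<lambda>i. complex_of_real (y i)"] conjI allI impI)
    show "\<exists>i<n. complex_of_real (y i) \<noteq> 0" using y[OF n] n by auto
    fix j assume j: "j < n"
    have "(\<Sum>i<n. y i * A $$ (i, j)) = of_real (\<Sum>i<n. y i * b i j)"
      using Ab j by (simp add: of_real_sum)
    then show "(\<Sum>i<n. y i * A $$ (i, j)) = of_real r * of_real (y j)" using eq[OF j] by simp
  qed
  moreover have "cmod \<mu> < r" if mu: "eigenvalue A \<mu>" "\<mu> \<noteq> r" for \<mu>
  proof -
    obtain v where v: "v \<in> carrier_vec n" "v \<noteq> 0\<^sub>v n" "A *\<^sub>v v = \<mu> \<cdot>\<^sub>v v"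
      using mu(1) A unfolding eigenvalue_def eigenvector_def by auto
    define t where "t = Min ((\<lambda>i. b i i) ` {..<n})"
    have t: "0 < t" unfolding t_def using n b by (subst Min_gr_iff) auto
    have t_le: "t \<le> b i i" if "i < n" for i unfolding t_def using that by (intro Min_le) auto
    define b' where "b' i j = b i j - (if i = j then t else 0)" for i j
    have "(\<Sum>i<n. y i * cmod (\<Sum>j<n. b' i j * v $ j)) \<le> (r - t) * (\<Sum>j<n. y j * cmod (v $ j))"
    proof (rule weighted_norm_contraction)
      show "0 \<le> b' i j" if "i \<in> {..<n}" "j \<in> {..<n}" for i j
        using that b[of i j] t_le unfolding b'_def by auto
      show "(\<Sum>i<n. y i * b' i j) \<le> (r - t) * y j" if "j \<in> {..<n}" for j
      proof -
        have "(\<Sum>i<n. y i * b' i j) = (\<Sum>i<n. y i * b i j) - (\<Sum>i<n. if i = j then t * y j else 0)"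
          unfolding b'_def sum_subtractf[symmetric] by (intro sum.cong) (auto simp: algebra_simps)
        also have "\<dots> = (r - t) * y j" using eq[of j] that by (simp add: algebra_simps)
        finally show ?thesis by simp
      qed
    qed (use y in \<open>auto intro: less_imp_le\<close>)
    moreover have "(\<Sum>j<n. b' i j * v $ j) = (\<mu> - t) * v $ i" if "i < n" for i
    proof -
      have "(A *\<^sub>v v) $ i = (\<Sum>j<n. b i j * v $ j)"
        using A v(1) that Ab by (simp add: scalar_prod_def atLeast0LessThan)
      then have "(\<Sum>j<n. b i j * v $ j) = \<mu> * v $ i" unfolding v(3) using v(1) that by simp
      moreover have "(\<Sum>j<n. b' i j * v $ j) = (\<Sum>j<n. b i j * v $ j) - (\<Sum>j<n. if i = j then t * v $ i else 0)"
        unfolding b'_def sum_subtractf[symmetric] by (intro sum.cong) (auto simp: algebra_simps)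
      ultimately show ?thesis using that by (simp add: algebra_simps)
    qed
    ultimately have le: "cmod (\<mu> - t) * (\<Sum>j<n. y j * cmod (v $ j)) \<le> (r - t) * (\<Sum>j<n. y j * cmod (v $ j))"
      by (simp add: norm_mult sum_distrib_left mult_ac)
    obtain k where k: "k < n" "v $ k \<noteq> 0" using v by (metis carrier_vecD eq_vecI index_zero_vec)
    have "0 < (\<Sum>j<n. y j * cmod (v $ j))"
      using k y by (intro sum_pos2[of _ k]) (auto intro!: mult_nonneg_nonneg intro: less_imp_le)
    with le have "cmod (\<mu> - t) \<le> r - t" by simp
    then show ?thesis using in_disc_imp_norm_less t mu(2) by blast
  qed
  ultimately have "perron_frobenius_eigenvalue A r"
    unfolding perron_frobenius_eigenvalue_def using r by auto
  then show thesis using y eq that by blast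
qed

lemma perron_frobenius_eigenvalue_unique:
  assumes "perron_frobenius_eigenvalue A r" "perron_frobenius_eigenvalue A r'"
  shows "r = r'"
proof (rule ccontr)
  assume "r \<noteq> r'"
  then have "complex_of_real r \<noteq> complex_of_real r'" by simp
  then have "cmod (complex_of_real r) < r'" "cmod (complex_of_real r') < r" "0 < r" "0 < r'"
    using assms unfolding perron_frobenius_eigenvalue_def by auto
  then show False by simp
qed

section \<open>Functionals for the dominant eigenvalue\<close>

lemma subfield_complexD:
  fixes K :: "complex set"
  assumes K: "subfield K (class_ring :: complex ring)"
  shows "0 \<in> K" "1 \<in> K" "\<And>x y. x \<in> K \<Longrightarrow> y \<in> K \<Longrightarrow> x + y \<in> K"
    "\<And>x y. x \<in> K \<Longrightarrow> y \<in> K \<Longrightarrow> x * y \<in> K" "\<And>x. x \<in> K \<Longrightarrow> - x \<in> K"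
    "\<And>x. x \<in> K \<Longrightarrow> inverse x \<in> K" "\<And>n. of_nat n \<in> K"
proof -
  note E = subringE[OF subfieldE(1)[OF K]]
  show z: "0 \<in> K" and o: "1 \<in> K" using E(2,3) by auto
  show add: "x + y \<in> K" if "x \<in> K" "y \<in> K" for x y using E(7)[OF that] by simp
  show "x * y \<in> K" if "x \<in> K" "y \<in> K" for x y using E(6)[OF that] by simp
  show "- x \<in> K" if "x \<in> K" for x using E(5)[OF that] by (simp add: class_ring_simps)
  show "inverse x \<in> K" if x: "x \<in> K" for x
  proof (cases "x = 0")
    case False
    have C: "ring (class_ring :: complex ring)" by (rule class_ring.ring_axioms)
    have "inv\<^bsub>class_ring\<^esub> x \<in> K - {0}" and "inv\<^bsub>class_ring\<^esub> x * x = 1"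
      using ring.subfield_m_inv(1,3)[OF C K, of x] x False by simp_all
    then show ?thesis by (metis DiffD1 inverse_inverse_eq inverse_unique)
  qed (use z in simp)
  show "of_nat n \<in> K" for n by (induction n) (auto intro: z o add)
qed

lemma subfield_complex_sum:
  assumes "subfield K (class_ring :: complex ring)" and "\<And>i. i \<in> A \<Longrightarrow> f i \<in> K"
  shows "sum f A \<in> K"
  using assms(2)
  by (induction A rule: infinite_finite_induct) (auto intro: subfield_complexD[OF assms(1)])

text \<open>
  A \<open>K\<close>-linear functional on a \<open>K\<close>-space need not be continuous. On a subspace of \<open>K\<^sup>I\<close>, however, it is
  given by finitely many complex coefficients, and therefore bounded by any weighted norm. The
  induction splits off one coordinate \<open>x\<close> with the help of a vector \<open>p\<close> for which \<open>p x = 1\<close>.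
\<close>

lemma linear_functional_coordinates:
  fixes V :: "('i \<Rightarrow> complex) set"
  assumes K: "subfield K (class_ring :: complex ring)" and "finite I"
    and "\<And>v i. v \<in> V \<Longrightarrow> v i \<in> K" "\<And>v i. v \<in> V \<Longrightarrow> i \<notin> I \<Longrightarrow> v i = 0"
    and "\<And>v w. v \<in> V \<Longrightarrow> w \<in> V \<Longrightarrow> (\<lambda>i. v i + w i) \<in> V"
    and "\<And>k v. k \<in> K \<Longrightarrow> v \<in> V \<Longrightarrow> (\<lambda>i. k * v i) \<in> V"
    and "\<And>v w. v \<in> V \<Longrightarrow> w \<in> V \<Longrightarrow> \<psi> (\<lambda>i. v i + w i) = \<psi> v + \<psi> w"
    and "\<And>k v. k \<in> K \<Longrightarrow> v \<in> V \<Longrightarrow> \<psi> (\<lambda>i. k * v i) = k * \<psi> v"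
  shows "\<exists>c. \<forall>v\<in>V. \<psi> v = (\<Sum>i\<in>I. c i * v i)"
  using assms(2-)
proof (induction I arbitrary: V)
  case empty
  have "\<psi> v = 0" if v: "v \<in> V" for v
  proof -
    have "v = (\<lambda>i. 0 * v i)" using empty.prems(2)[OF v] by auto
    then show ?thesis using empty.prems(6)[OF subfield_complexD(1)[OF K] v] by simp
  qed
  then show ?case by simp
next
  case (insert x I)
  note V = insert.prems
  define V' where "V' = {v \<in> V. v x = 0}"
  have "\<exists>c. \<forall>v\<in>V'. \<psi> v = (\<Sum>i\<in>I. c i * v i)"
  proof (rule insert.IH)
    show "v i = 0" if "v \<in> V'" "i \<notin> I" for v i
      using V(2)[of v i] that by (cases "i = x") (auto simp: V'_def)
  qed (use V in \<open>auto simp: V'_def\<close>)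
  then obtain c where c: "\<And>v. v \<in> V \<Longrightarrow> v x = 0 \<Longrightarrow> \<psi> v = (\<Sum>i\<in>I. c i * v i)"
    unfolding V'_def by auto
  have sum: "(\<Sum>i\<in>insert x I. (c(x := d)) i * v i) = d * v x + (\<Sum>i\<in>I. c i * v i)" for d and v :: "'i \<Rightarrow> complex"
    using insert.hyps by (simp, intro sum.cong) auto
  show ?case
  proof (cases "\<exists>p\<in>V. p x \<noteq> 0")
    case False
    then show ?thesis using c sum[of 0] by (intro exI[of _ "c(x := 0)"]) auto
  next
    case True
    then obtain q where q: "q \<in> V" "q x \<noteq> 0" by blast
    define p where "p i = inverse (q x) * q i" for i
    have p: "p \<in> V" "p x = 1"
      unfolding p_def using V(4)[OF subfield_complexD(6)[OF K V(1)] q(1)] q by auto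
    \<comment> \<open>the value of the coefficient at \<open>x\<close> that makes the formula correct on \<open>p\<close>\<close>
    define d where "d = \<psi> p - (\<Sum>i\<in>I. c i * p i)"
    have "\<psi> v = d * v x + (\<Sum>i\<in>I. c i * v i)" if v: "v \<in> V" for v
    proof -
      have k: "- v x \<in> K" using V(1)[OF v] subfield_complexD(5)[OF K] by blast
      define w where "w i = v i + (- v x) * p i" for i
      have w: "w \<in> V" unfolding w_def using V(3)[OF v V(4)[OF k p(1)]] by auto
      have "\<psi> w = \<psi> v + (- v x) * \<psi> p"
        using V(5)[OF v V(4)[OF k p(1)]] V(6)[OF k p(1)] unfolding w_def by simp
      moreover have "\<psi> w = (\<Sum>i\<in>I. c i * w i)" using c[OF w] p(2) by (simp add: w_def)
      moreover have "(\<Sum>i\<in>I. c i * w i) = (\<Sum>i\<in>I. c i * v i) - v x * (\<Sum>i\<in>I. c i * p i)"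
        unfolding w_def sum_distrib_left sum_subtractf[symmetric]
        by (intro sum.cong) (auto simp: algebra_simps)
      ultimately show ?thesis unfolding d_def by (simp add: algebra_simps)
    qed
    then show ?thesis using sum[of d] by (intro exI[of _ "c(x := d)"]) auto
  qed
qed

definition mat_act :: "'i set \<Rightarrow> ('i \<Rightarrow> 'i \<Rightarrow> real) \<Rightarrow> ('i \<Rightarrow> complex) \<Rightarrow> 'i \<Rightarrow> complex" where
  "mat_act I a v i = (if i \<in> I then \<Sum>j\<in>I. a i j * v j else 0)"

text \<open>
  The functional \<open>\<psi>\<close> satisfies \<open>\<psi> (b v) = r \<psi> v\<close> for \<open>b = a - e a / n\<close> as well, since it kills the image
  of \<open>e\<close>. For large \<open>n\<close> the matrix \<open>b\<close> is nonnegative. Every entry of row \<open>k\<close> of \<open>e a\<close> is positive, so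
  \<open>y b\<close> is smaller than \<open>r y\<close> in every coordinate, and \<open>b\<close> contracts the norm weighted by \<open>y\<close> by a factor
  \<open>\<rho> < r\<close>. Hence \<open>r ^ p |\<psi> v|\<close> is bounded by a constant times \<open>\<rho> ^ p\<close>. The factor \<open>1 / n\<close> is rational,
  which keeps the \<open>K\<close>-space \<open>V\<close> stable under \<open>b\<close>.
\<close>

theorem perron_eigenfunctional_vanishes:
  fixes V :: "('i \<Rightarrow> complex) set" and a e :: "'i \<Rightarrow> 'i \<Rightarrow> real" and y :: "'i \<Rightarrow> real"
  assumes K: "subfield K (class_ring :: complex ring)" and I: "finite I"
    and a: "\<And>i j. i \<in> I \<Longrightarrow> j \<in> I \<Longrightarrow> 0 < a i j"
    and e: "\<And>i j. i \<in> I \<Longrightarrow> j \<in> I \<Longrightarrow> 0 \<le> e i j"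
    and e_pos: "k \<in> I" "l \<in> I" "0 < e k l"
    and y: "\<And>i. i \<in> I \<Longrightarrow> 0 < y i"
    and ya: "\<And>j. j \<in> I \<Longrightarrow> (\<Sum>i\<in>I. y i * a i j) = r * y j"
    and V_K: "\<And>v i. v \<in> V \<Longrightarrow> v i \<in> K" and V_I: "\<And>v i. v \<in> V \<Longrightarrow> i \<notin> I \<Longrightarrow> v i = 0"
    and V_add: "\<And>v w. v \<in> V \<Longrightarrow> w \<in> V \<Longrightarrow> (\<lambda>i. v i + w i) \<in> V"
    and V_smult: "\<And>c v. c \<in> K \<Longrightarrow> v \<in> V \<Longrightarrow> (\<lambda>i. c * v i) \<in> V"
    and V_a: "\<And>v. v \<in> V \<Longrightarrow> mat_act I a v \<in> V" and V_e: "\<And>v. v \<in> V \<Longrightarrow> mat_act I e v \<in> V"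
    and psi_add: "\<And>v w. v \<in> V \<Longrightarrow> w \<in> V \<Longrightarrow> \<psi> (\<lambda>i. v i + w i) = \<psi> v + \<psi> w"
    and psi_smult: "\<And>c v. c \<in> K \<Longrightarrow> v \<in> V \<Longrightarrow> \<psi> (\<lambda>i. c * v i) = c * \<psi> v"
    and psi_a: "\<And>v. v \<in> V \<Longrightarrow> \<psi> (mat_act I a v) = complex_of_real r * \<psi> v"
    and psi_e: "\<And>v. v \<in> V \<Longrightarrow> \<psi> (mat_act I e v) = 0"
    and v: "v \<in> V"
  shows "\<psi> v = 0"
proof -
  define m where "m i j = (\<Sum>k\<in>I. e i k * a k j)" for i j
  have m0: "0 \<le> m i j" if "i \<in> I" "j \<in> I" for i j
    unfolding m_def using that e a by (intro sum_nonneg mult_nonneg_nonneg) (auto intro: less_imp_le)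
  have mk: "0 < m k j" if "j \<in> I" for j
    unfolding m_def using that e a e_pos I
    by (intro sum_pos2[of _ l]) (auto intro!: mult_nonneg_nonneg intro: less_imp_le)
  obtain n :: nat where n: "0 < n" "\<And>i j. i \<in> I \<Longrightarrow> j \<in> I \<Longrightarrow> m i j \<le> n * a i j"
  proof -
    have "\<exists>f. \<forall>p\<in>I \<times> I. m (fst p) (snd p) \<le> of_nat (f p) * a (fst p) (snd p)"
      using ex_less_of_nat_mult[OF a] by (intro bchoice) (force intro: less_imp_le)
    then obtain f :: "'i \<times> 'i \<Rightarrow> nat" where
      f: "\<And>i j. i \<in> I \<Longrightarrow> j \<in> I \<Longrightarrow> m i j \<le> f (i, j) * a i j" by auto
    \<comment> \<open>a common bound for the finitely many factors; the successor makes it positive\<close>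
    show thesis
    proof (rule that[of "Suc (sum f (I \<times> I))"])
      fix i j assume ij: "i \<in> I" "j \<in> I"
      have "f (i, j) \<le> sum f (I \<times> I)" using ij I by (intro member_le_sum) auto
      then have "real (f (i, j)) \<le> real (Suc (sum f (I \<times> I)))" by linarith
      then have "real (f (i, j)) * a i j \<le> real (Suc (sum f (I \<times> I))) * a i j"
        using a[OF ij] by (intro mult_right_mono) auto
      with f[OF ij] show "m i j \<le> real (Suc (sum f (I \<times> I))) * a i j" by simp
    qed simp
  qed
  define b where "b i j = a i j - m i j / n" for i j
  have b0: "0 \<le> b i j" if "i \<in> I" "j \<in> I" for i j
    unfolding b_def using n(2)[OF that] n(1) by (simp add: field_simps)
  define d where "d j = (\<Sum>i\<in>I. y i * m i j) / n" for j
  have d: "0 < d j" if "j \<in> I" for j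
  proof -
    have "0 < (\<Sum>i\<in>I. y i * m i j)"
      using that I y m0 mk e_pos by (intro sum_pos2[of _ k]) (auto intro!: mult_nonneg_nonneg mult_pos_pos intro: less_imp_le)
    then show ?thesis unfolding d_def using n by simp
  qed
  have yb: "(\<Sum>i\<in>I. y i * b i j) = r * y j - d j" if "j \<in> I" for j
    unfolding b_def d_def ya[OF that, symmetric] by (simp add: algebra_simps sum_subtractf sum_divide_distrib)
  \<comment> \<open>the least \<open>\<rho>\<close> with \<open>r y - d \<le> \<rho> y\<close>, the left-hand side being \<open>y b\<close>\<close>
  define \<rho> where "\<rho> = r - Min ((\<lambda>j. d j / y j) ` I)"
  have "I \<noteq> {}" using e_pos by auto
  then have rho_r: "\<rho> < r" unfolding \<rho>_def using I d y by (simp add: Min_gr_iff)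
  have rho: "(\<Sum>i\<in>I. y i * b i j) \<le> \<rho> * y j" if j: "j \<in> I" for j
  proof -
    have "Min ((\<lambda>j. d j / y j) ` I) \<le> d j / y j" using I j by (intro Min_le) auto
    then have "(r - \<rho>) * y j \<le> d j" unfolding \<rho>_def using y[OF j] by (simp add: le_divide_eq)
    then show ?thesis unfolding yb[OF j] by (simp add: algebra_simps)
  qed
  have rho0: "0 \<le> \<rho>"
  proof -
    have "0 \<le> (\<Sum>i\<in>I. y i * b i k)"
      using y b0 e_pos by (intro sum_nonneg mult_nonneg_nonneg) (auto intro: less_imp_le)
    with rho[OF e_pos(1)] have "0 \<le> \<rho> * y k" by linarith
    then show ?thesis using y[OF e_pos(1)] by (simp add: zero_le_mult_iff)
  qed
  define F where "F = mat_act I b"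
  have nK: "- inverse (of_nat n) \<in> K" by (intro subfield_complexD(5-7)[OF K])
  have F_eq: "F w = (\<lambda>i. mat_act I a w i + (- inverse (of_nat n)) * mat_act I e (mat_act I a w) i)" for w
  proof
    fix i
    have "(\<Sum>j\<in>I. of_real (m i j) * w j) = (\<Sum>k\<in>I. of_real (e i k) * (\<Sum>j\<in>I. of_real (a k j) * w j))"
      unfolding m_def of_real_sum sum_distrib_right sum_distrib_left by (subst sum.swap) (simp add: mult_ac)
    moreover have "(\<Sum>j\<in>I. of_real (b i j) * w j) =
        (\<Sum>j\<in>I. of_real (a i j) * w j) - inverse (of_nat n) * (\<Sum>j\<in>I. of_real (m i j) * w j)"
      unfolding b_def sum_distrib_left sum_subtractf[symmetric]
      by (intro sum.cong) (auto simp: field_simps)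
    ultimately show "F w i = mat_act I a w i + (- inverse (of_nat n)) * mat_act I e (mat_act I a w) i"
      unfolding F_def mat_act_def by simp
  qed
  have F_V: "F w \<in> V" if "w \<in> V" for w
    unfolding F_eq by (intro V_add V_smult V_a V_e nK that)
  have F_psi: "\<psi> (F w) = r * \<psi> w" if "w \<in> V" for w
    unfolding F_eq using that
    by (simp only: psi_add[OF V_a V_smult[OF nK V_e[OF V_a]]] psi_smult[OF nK V_e[OF V_a]] psi_a psi_e[OF V_a]) simp
  define N where "N w = (\<Sum>i\<in>I. y i * cmod (w i))" for w :: "'i \<Rightarrow> complex"
  have F_N: "N (F w) \<le> \<rho> * N w" for w
    using weighted_norm_contraction[OF I b0 less_imp_le[OF y] rho, of w]
    unfolding N_def F_def mat_act_def by simp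
  have iter: "(F ^^ p) v \<in> V \<and> \<psi> ((F ^^ p) v) = r ^ p * \<psi> v \<and> N ((F ^^ p) v) \<le> \<rho> ^ p * N v" for p
  proof (induction p)
    case (Suc p)
    have "N (F ((F ^^ p) v)) \<le> \<rho> * (\<rho> ^ p * N v)"
      using F_N[of "(F ^^ p) v"] Suc rho0 by (meson mult_left_mono order_trans)
    then show ?case using Suc F_V F_psi by (auto simp: mult_ac)
  qed (use v in simp)
  obtain c where c: "\<And>w. w \<in> V \<Longrightarrow> \<psi> w = (\<Sum>i\<in>I. c i * w i)"
  proof -
    have "\<exists>c. \<forall>w\<in>V. \<psi> w = (\<Sum>i\<in>I. c i * w i)"
      by (rule linear_functional_coordinates[OF K I, where V = V and \<psi> = \<psi>])
        (fact V_K V_I V_add V_smult psi_add psi_smult)+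
    then show thesis using that by blast
  qed
  define C where "C = (\<Sum>i\<in>I. cmod (c i) / y i)"
  have C0: "0 \<le> C" unfolding C_def using y by (intro sum_nonneg divide_nonneg_nonneg) (auto intro: less_imp_le)
  have N0: "0 \<le> N w" for w
    unfolding N_def using y by (intro sum_nonneg mult_nonneg_nonneg) (auto intro: less_imp_le)
  have bound: "cmod (\<psi> w) \<le> C * N w" if "w \<in> V" for w
  proof -
    have "cmod (\<psi> w) \<le> (\<Sum>i\<in>I. cmod (c i * w i))" unfolding c[OF that] by (rule norm_sum)
    also have "\<dots> \<le> (\<Sum>i\<in>I. cmod (c i) / y i * N w)"
    proof (rule sum_mono)
      fix i assume i: "i \<in> I"
      have "y i * cmod (w i) \<le> N w" unfolding N_def using i I y
        by (intro member_le_sum[of i I "\<lambda>i. y i * cmod (w i)"]) (auto intro!: mult_nonneg_nonneg intro: less_imp_le)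
      then have "cmod (w i) \<le> N w / y i" using y[OF i] by (simp add: field_simps)
      then have "cmod (c i) * cmod (w i) \<le> cmod (c i) * (N w / y i)" by (intro mult_left_mono) auto
      then show "cmod (c i * w i) \<le> cmod (c i) / y i * N w" by (simp add: norm_mult)
    qed
    finally show ?thesis unfolding C_def by (simp add: sum_distrib_right)
  qed
  have r: "0 < r" using rho0 rho_r by simp
  have decay: "cmod (\<psi> v) \<le> (\<rho> / r) ^ p * (C * N v)" for p
  proof -
    have "r ^ p * cmod (\<psi> v) = cmod (\<psi> ((F ^^ p) v))"
      using iter[of p] r by (simp add: norm_mult norm_power)
    also have "\<dots> \<le> C * N ((F ^^ p) v)" using bound iter by blast
    also have "\<dots> \<le> C * (\<rho> ^ p * N v)" using iter C0 by (intro mult_left_mono) auto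
    finally show ?thesis using r by (simp add: power_divide field_simps)
  qed
  have "(\<lambda>p. (\<rho> / r) ^ p * (C * N v)) \<longlonglongrightarrow> 0 * (C * N v)"
    using rho0 rho_r r by (intro tendsto_mult_right LIMSEQ_power_zero) auto
  then have "cmod (\<psi> v) \<le> 0 * (C * N v)"
    using decay by (intro LIMSEQ_le_const) auto
  then show ?thesis by simp
qed

section \<open>Modules, subquotients and tops\<close>

context left_module
begin

lemma smult_zero: "a \<in> carrier R \<Longrightarrow> a \<odot>\<^bsub>M\<^esub> \<zero>\<^bsub>M\<^esub> = \<zero>\<^bsub>M\<^esub>"
  by (metis M.add.l_cancel_one M.zero_closed smult_closed smult_r_distr M.l_zero)

lemma zero_smult: "x \<in> carrier M \<Longrightarrow> \<zero>\<^bsub>R\<^esub> \<odot>\<^bsub>M\<^esub> x = \<zero>\<^bsub>M\<^esub>"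
  by (metis M.add.l_cancel_one M.zero_closed R.zero_closed smult_closed smult_l_distr R.l_zero)

lemma smult_minus_one: "x \<in> carrier M \<Longrightarrow> (\<ominus>\<^bsub>R\<^esub> \<one>\<^bsub>R\<^esub>) \<odot>\<^bsub>M\<^esub> x = \<ominus>\<^bsub>M\<^esub> x"
proof -
  assume x: "x \<in> carrier M"
  have "(\<ominus>\<^bsub>R\<^esub> \<one>\<^bsub>R\<^esub>) \<odot>\<^bsub>M\<^esub> x \<oplus>\<^bsub>M\<^esub> \<one>\<^bsub>R\<^esub> \<odot>\<^bsub>M\<^esub> x = \<zero>\<^bsub>M\<^esub>"
    using x by (simp add: smult_l_distr[symmetric] R.l_neg zero_smult)
  then show ?thesis using x by (simp add: smult_one M.minus_equality[symmetric] smult_closed)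
qed

lemma submoduleI:
  assumes "H \<subseteq> carrier M" "\<zero>\<^bsub>M\<^esub> \<in> H" "\<And>x y. x \<in> H \<Longrightarrow> y \<in> H \<Longrightarrow> x \<oplus>\<^bsub>M\<^esub> y \<in> H"
    "\<And>a x. a \<in> carrier R \<Longrightarrow> x \<in> H \<Longrightarrow> a \<odot>\<^bsub>M\<^esub> x \<in> H"
  shows "Module.submodule H R M"
proof -
  have "\<ominus>\<^bsub>M\<^esub> x \<in> H" if "x \<in> H" for x
    using assms(4)[of "\<ominus>\<^bsub>R\<^esub> \<one>\<^bsub>R\<^esub>" x] smult_minus_one[of x] assms(1) that by auto
  then show ?thesis
    using assms
    by (intro Module.submodule.intro subgroup.intro Module.submodule_axioms.intro)
      (auto simp: a_inv_def)
qed

lemma carrier_submodule: "Module.submodule (carrier M) R M"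
  by (rule submoduleI) (auto simp: smult_closed)

lemma regular_module_orbit_hom:
  "x \<in> carrier M \<Longrightarrow> (\<lambda>a. a \<odot>\<^bsub>M\<^esub> x) \<in> module_hom R (regular_module R) M"
  unfolding module_hom_def regular_module_def
  by (auto simp: smult_closed smult_l_distr smult_assoc)

lemma submoduleD:
  assumes "Module.submodule H R M"
  shows "H \<subseteq> carrier M" "\<zero>\<^bsub>M\<^esub> \<in> H" "\<And>x y. x \<in> H \<Longrightarrow> y \<in> H \<Longrightarrow> x \<oplus>\<^bsub>M\<^esub> y \<in> H"
    "\<And>a x. a \<in> carrier R \<Longrightarrow> x \<in> H \<Longrightarrow> a \<odot>\<^bsub>M\<^esub> x \<in> H" "\<And>x. x \<in> H \<Longrightarrow> \<ominus>\<^bsub>M\<^esub> x \<in> H"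
    "additive_subgroup H M"
proof -
  interpret H: Module.submodule H R M by fact
  show "H \<subseteq> carrier M" "\<zero>\<^bsub>M\<^esub> \<in> H" "\<And>x y. x \<in> H \<Longrightarrow> y \<in> H \<Longrightarrow> x \<oplus>\<^bsub>M\<^esub> y \<in> H"
    "\<And>a x. a \<in> carrier R \<Longrightarrow> x \<in> H \<Longrightarrow> a \<odot>\<^bsub>M\<^esub> x \<in> H"
    using H.subset H.one_closed H.m_closed H.smult_closed by auto
  show "\<And>x. x \<in> H \<Longrightarrow> \<ominus>\<^bsub>M\<^esub> x \<in> H" using H.m_inv_closed by (simp add: a_inv_def)
  show "additive_subgroup H M" by (intro additive_subgroup.intro H.subgroup_axioms)
qed

lemma left_module_submodule:
  assumes "Module.submodule H R M"
  shows "left_module R (M\<lparr>carrier := H\<rparr>)"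
proof -
  note H = submoduleD[OF assms]
  have "abelian_group (M\<lparr>carrier := H\<rparr>)"
  proof (rule abelian_groupI)
    fix x assume "x \<in> carrier (M\<lparr>carrier := H\<rparr>)"
    then show "\<exists>y\<in>carrier (M\<lparr>carrier := H\<rparr>). y \<oplus>\<^bsub>M\<lparr>carrier := H\<rparr>\<^esub> x = \<zero>\<^bsub>M\<lparr>carrier := H\<rparr>\<^esub>"
      using H(1,5) by (auto intro!: bexI[of _ "\<ominus>\<^bsub>M\<^esub> x"] M.l_neg)
  qed (use H in \<open>auto simp: M.a_ac subset_iff\<close>)
  then show ?thesis
    using H by (intro left_module.intro left_module_axioms.intro R.ring_axioms)
      (auto simp: smult_l_distr smult_r_distr smult_assoc smult_one subset_iff)
qed

end

text \<open>
  All axioms are equations and transport along a surjection that respects the operations. The target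
  is only a structure here: the lemma is what makes quotients and the standard module into modules.
\<close>

lemma left_module_image:
  assumes "left_module R U" and hom: "T \<in> module_hom R U N"
    and surj: "T ` carrier U = carrier N" and zero: "T \<zero>\<^bsub>U\<^esub> = \<zero>\<^bsub>N\<^esub>"
  shows "left_module R N"
proof -
  interpret U: left_module R U by fact
  have T: "T u \<in> carrier N" if "u \<in> carrier U" for u using surj that by auto
  have ex: "\<exists>u\<in>carrier U. x = T u" if "x \<in> carrier N" for x using surj that by auto
  have add: "T x \<oplus>\<^bsub>N\<^esub> T y = T (x \<oplus>\<^bsub>U\<^esub> y)" if "x \<in> carrier U" "y \<in> carrier U" for x y
    using module_hom_add[OF hom that] by simp
  have sm: "a \<odot>\<^bsub>N\<^esub> T x = T (a \<odot>\<^bsub>U\<^esub> x)" if "a \<in> carrier R" "x \<in> carrier U" for a x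
    using module_hom_smult[OF hom that] by simp
  have "abelian_group N"
  proof (rule abelian_groupI)
    show "\<zero>\<^bsub>N\<^esub> \<in> carrier N" using zero T[OF U.M.zero_closed] by simp
  next
    fix x y assume "x \<in> carrier N" "y \<in> carrier N"
    then obtain u v where "u \<in> carrier U" "v \<in> carrier U" "x = T u" "y = T v" using ex by metis
    then show "x \<oplus>\<^bsub>N\<^esub> y \<in> carrier N" "x \<oplus>\<^bsub>N\<^esub> y = y \<oplus>\<^bsub>N\<^esub> x" by (simp_all add: add T U.M.a_comm)
  next
    fix x y z assume "x \<in> carrier N" "y \<in> carrier N" "z \<in> carrier N"
    then obtain u v w where "u \<in> carrier U" "v \<in> carrier U" "w \<in> carrier U" "x = T u" "y = T v" "z = T w"
      using ex by metis
    then show "x \<oplus>\<^bsub>N\<^esub> y \<oplus>\<^bsub>N\<^esub> z = x \<oplus>\<^bsub>N\<^esub> (y \<oplus>\<^bsub>N\<^esub> z)" by (simp add: add U.M.a_assoc)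
  next
    fix x assume "x \<in> carrier N"
    then obtain u where u: "u \<in> carrier U" "x = T u" using ex by metis
    then show "\<zero>\<^bsub>N\<^esub> \<oplus>\<^bsub>N\<^esub> x = x" by (simp add: zero[symmetric] add)
    show "\<exists>y\<in>carrier N. y \<oplus>\<^bsub>N\<^esub> x = \<zero>\<^bsub>N\<^esub>"
      using u by (intro bexI[of _ "T (\<ominus>\<^bsub>U\<^esub> u)"]) (simp_all add: add T U.M.l_neg zero)
  qed
  moreover have "left_module_axioms R N"
  proof (rule left_module_axioms.intro)
    fix x assume "x \<in> carrier N"
    then obtain u where u: "u \<in> carrier U" "x = T u" using ex by metis
    then show "\<one>\<^bsub>R\<^esub> \<odot>\<^bsub>N\<^esub> x = x" by (simp add: sm U.smult_one)
  next
    fix a x assume a: "a \<in> carrier R" and "x \<in> carrier N"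
    then obtain u where u: "u \<in> carrier U" "x = T u" using ex by metis
    then show "a \<odot>\<^bsub>N\<^esub> x \<in> carrier N" using a by (simp add: sm T U.smult_closed)
  next
    fix a b x assume a: "a \<in> carrier R" "b \<in> carrier R" and "x \<in> carrier N"
    then obtain u where u: "u \<in> carrier U" "x = T u" using ex by metis
    show "(a \<oplus>\<^bsub>R\<^esub> b) \<odot>\<^bsub>N\<^esub> x = a \<odot>\<^bsub>N\<^esub> x \<oplus>\<^bsub>N\<^esub> b \<odot>\<^bsub>N\<^esub> x"
      using a u by (simp add: sm add U.smult_l_distr U.smult_closed)
    show "(a \<otimes>\<^bsub>R\<^esub> b) \<odot>\<^bsub>N\<^esub> x = a \<odot>\<^bsub>N\<^esub> (b \<odot>\<^bsub>N\<^esub> x)"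
      using a u by (simp add: sm U.smult_assoc U.smult_closed)
  next
    fix a x y assume a: "a \<in> carrier R" and "x \<in> carrier N" "y \<in> carrier N"
    then obtain u v where u: "u \<in> carrier U" "x = T u" "v \<in> carrier U" "y = T v" using ex by metis
    show "a \<odot>\<^bsub>N\<^esub> (x \<oplus>\<^bsub>N\<^esub> y) = a \<odot>\<^bsub>N\<^esub> x \<oplus>\<^bsub>N\<^esub> a \<odot>\<^bsub>N\<^esub> y"
      using a u by (simp add: sm add U.smult_r_distr U.smult_closed)
  qed
  ultimately show ?thesis by (intro left_module.intro U.R.ring_axioms)
qed

lemma module_hom_zero:
  assumes "left_module R M" "left_module R N" "f \<in> module_hom R M N"
  shows "f \<zero>\<^bsub>M\<^esub> = \<zero>\<^bsub>N\<^esub>"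
proof -
  interpret M: left_module R M by fact
  interpret N: left_module R N by fact
  have "f \<zero>\<^bsub>M\<^esub> \<oplus>\<^bsub>N\<^esub> f \<zero>\<^bsub>M\<^esub> = f \<zero>\<^bsub>M\<^esub>"
    using module_hom_add[OF assms(3), of "\<zero>\<^bsub>M\<^esub>" "\<zero>\<^bsub>M\<^esub>"] by simp
  moreover have "f \<zero>\<^bsub>M\<^esub> \<in> carrier N" using module_hom_closed[OF assms(3)] by auto
  ultimately show ?thesis by (simp add: N.M.add.l_cancel_one)
qed

lemma module_hom_image_submodule:
  assumes D: "left_module R D" and X: "left_module R X" and f: "f \<in> module_hom R D X"
    and N: "Module.submodule N R D"
  shows "Module.submodule (f ` N) R X"
proof -
  interpret D: left_module R D by fact
  interpret X: left_module R X by fact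
  note N' = D.submoduleD[OF N]
  show ?thesis
  proof (rule X.submoduleI)
    show "f ` N \<subseteq> carrier X" using N' module_hom_closed[OF f] by auto
    show "\<zero>\<^bsub>X\<^esub> \<in> f ` N" using N' module_hom_zero[OF D X f] by (metis imageI)
    show "u \<oplus>\<^bsub>X\<^esub> v \<in> f ` N" if uv: "u \<in> f ` N" "v \<in> f ` N" for u v
    proof -
      obtain u' v' where "u' \<in> N" "v' \<in> N" "u = f u'" "v = f v'" using uv by auto
      then show ?thesis using N' module_hom_add[OF f, of u' v'] by (metis imageI subsetD)
    qed
    show "c \<odot>\<^bsub>X\<^esub> u \<in> f ` N" if uv: "c \<in> carrier R" "u \<in> f ` N" for c u
    proof -
      obtain u' where "u' \<in> N" "u = f u'" using uv by auto
      then show ?thesis using N' uv module_hom_smult[OF f, of c u'] by (metis imageI subsetD)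
    qed
  qed
qed

lemma module_hom_diff:
  assumes "left_module R M" "left_module R N" "f \<in> module_hom R M N" "x \<in> carrier M" "y \<in> carrier M"
  shows "f (x \<ominus>\<^bsub>M\<^esub> y) = f x \<ominus>\<^bsub>N\<^esub> f y"
proof -
  interpret M: left_module R M by fact
  interpret N: left_module R N by fact
  have f: "f z \<in> carrier N" if "z \<in> carrier M" for z using module_hom_closed[OF assms(3)] that by auto
  have "f (\<ominus>\<^bsub>M\<^esub> y) \<oplus>\<^bsub>N\<^esub> f y = \<zero>\<^bsub>N\<^esub>"
    using module_hom_add[OF assms(3), of "\<ominus>\<^bsub>M\<^esub> y" y] module_hom_zero[OF assms(1-3)] assms(5)
    by (simp add: M.M.l_neg)
  then have "f (\<ominus>\<^bsub>M\<^esub> y) = \<ominus>\<^bsub>N\<^esub> f y" using assms(5) f by (simp add: N.M.minus_equality[symmetric])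
  then show ?thesis using module_hom_add[OF assms(3), of x "\<ominus>\<^bsub>M\<^esub> y"] assms(4,5)
    by (simp add: a_minus_def)
qed

text \<open>
  The union over a coset that defines \<^const>\<open>coset_map\<close> collapses to a single coset, because the cosets
  of all images of its elements coincide.
\<close>

lemma coset_map_rcos:
  assumes "abelian_group M" "additive_subgroup N M" "f \<in> carrier M \<rightarrow> carrier M"
    and add: "\<And>x y. x \<in> carrier M \<Longrightarrow> y \<in> carrier M \<Longrightarrow> f (x \<oplus>\<^bsub>M\<^esub> y) = f x \<oplus>\<^bsub>M\<^esub> f y"
    and N: "\<And>x. x \<in> N \<Longrightarrow> f x \<in> N" and x: "x \<in> carrier M"
  shows "coset_map M N f (N +>\<^bsub>M\<^esub> x) = N +>\<^bsub>M\<^esub> f x"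
proof -
  interpret M: abelian_group M by fact
  interpret N: additive_subgroup N M by fact
  interpret AS: abelian_subgroup N M by (rule abelian_subgroupI3) fact+
  have fx: "f x \<in> carrier M" using assms(3) x by auto
  have "N +>\<^bsub>M\<^esub> f y = N +>\<^bsub>M\<^esub> f x" if y: "y \<in> N +>\<^bsub>M\<^esub> x" for y
  proof -
    obtain h where h: "h \<in> N" "y = h \<oplus>\<^bsub>M\<^esub> x" using y unfolding a_r_coset_def' by auto
    then have "f y = f h \<oplus>\<^bsub>M\<^esub> f x" using add N.a_subset x by auto
    then have "f y \<in> N +>\<^bsub>M\<^esub> f x" using N h unfolding a_r_coset_def' by auto
    then show ?thesis using AS.a_repr_independence' fx by metis
  qed
  moreover have "x \<in> N +>\<^bsub>M\<^esub> x" using x N.zero_closed unfolding a_r_coset_def' by (force simp: M.l_zero)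
  ultimately have "(\<Union>y\<in>N +>\<^bsub>M\<^esub> x. N +>\<^bsub>M\<^esub> f y) = N +>\<^bsub>M\<^esub> f x" by blast
  then show ?thesis unfolding coset_map_def .
qed

lemma quotient_module_simps [simp]:
  "\<zero>\<^bsub>quotient_module M N\<^esub> = N" "carrier (quotient_module M N) = a_rcosets\<^bsub>M\<^esub> N"
  "add (quotient_module M N) = set_add M"
  "module.smult (quotient_module M N) r = coset_map M N (module.smult M r)"
  by (simp_all add: quotient_module_def)

context left_module
begin

lemma quotient_projection_hom:
  assumes "Module.submodule N R M"
  shows "(\<lambda>x. N +>\<^bsub>M\<^esub> x) \<in> module_hom R M (quotient_module M N)"
    "(\<lambda>x. N +>\<^bsub>M\<^esub> x) ` carrier M = carrier (quotient_module M N)"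
    "N +>\<^bsub>M\<^esub> \<zero>\<^bsub>M\<^esub> = \<zero>\<^bsub>quotient_module M N\<^esub>"
proof -
  note N = submoduleD[OF assms]
  interpret AS: abelian_subgroup N M
    by (rule abelian_subgroupI3) (fact N(6), rule M.abelian_group_axioms)
  show surj: "(\<lambda>x. N +>\<^bsub>M\<^esub> x) ` carrier M = carrier (quotient_module M N)"
    by (auto simp: A_RCOSETS_def' )
  show "N +>\<^bsub>M\<^esub> \<zero>\<^bsub>M\<^esub> = \<zero>\<^bsub>quotient_module M N\<^esub>"
    using AS.a_subset by (auto simp: a_r_coset_def' subset_iff)
  show "(\<lambda>x. N +>\<^bsub>M\<^esub> x) \<in> module_hom R M (quotient_module M N)"
    unfolding module_hom_def
  proof (intro CollectI conjI allI impI)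
    show "(\<lambda>x. N +>\<^bsub>M\<^esub> x) \<in> carrier M \<rightarrow> carrier (quotient_module M N)" using surj by auto
    show "N +>\<^bsub>M\<^esub> (x \<oplus>\<^bsub>M\<^esub> y) = (N +>\<^bsub>M\<^esub> x) \<oplus>\<^bsub>quotient_module M N\<^esub> (N +>\<^bsub>M\<^esub> y)"
      if "x \<in> carrier M \<and> y \<in> carrier M" for x y
      using that by (simp add: AS.a_rcos_sum)
    show "N +>\<^bsub>M\<^esub> (a \<odot>\<^bsub>M\<^esub> x) = a \<odot>\<^bsub>quotient_module M N\<^esub> (N +>\<^bsub>M\<^esub> x)"
      if "a \<in> carrier R \<and> x \<in> carrier M" for a x
      using that N by (subst quotient_module_simps, subst coset_map_rcos)
        (auto simp: smult_r_distr smult_closed M.abelian_group_axioms)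
  qed
qed

lemma left_module_quotient:
  assumes "Module.submodule N R M"
  shows "left_module R (quotient_module M N)"
  using left_module_image[OF left_module_axioms quotient_projection_hom[OF assms]] .

lemma rcos_eq_iff:
  assumes "Module.submodule N R M" "x \<in> carrier M" "y \<in> carrier M"
  shows "N +>\<^bsub>M\<^esub> x = N +>\<^bsub>M\<^esub> y \<longleftrightarrow> x \<ominus>\<^bsub>M\<^esub> y \<in> N"
proof -
  note N = submoduleD[OF assms(1)]
  interpret AS: abelian_subgroup N M
    by (rule abelian_subgroupI3) (fact N(6), rule M.abelian_group_axioms)
  show ?thesis
    using AS.a_rcos_module[OF assms(3,2), folded a_minus_def] AS.a_repr_independence'[OF _ assms(3)]
      AS.a_rcos_self[OF assms(2)] by metis
qed

lemma rcos_eq_zero_iff: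
  assumes "Module.submodule N R M" "x \<in> carrier M"
  shows "N +>\<^bsub>M\<^esub> x = N \<longleftrightarrow> x \<in> N"
  using rcos_eq_iff[OF assms M.zero_closed] quotient_projection_hom(3)[OF assms(1)] assms(2)
  by (simp add: a_minus_def M.minus_equality[of "\<zero>\<^bsub>M\<^esub>" "\<zero>\<^bsub>M\<^esub>"])

lemma submodule_of_submodule:
  assumes "Module.submodule P R M" "Module.submodule Q R M" "Q \<subseteq> P"
  shows "Module.submodule Q R (M\<lparr>carrier := P\<rparr>)"
proof -
  interpret P: left_module R "M\<lparr>carrier := P\<rparr>" by (rule left_module_submodule[OF assms(1)])
  show ?thesis
    by (rule P.submoduleI) (use submoduleD[OF assms(2)] assms(3) in auto)
qed

text \<open>
  Subquotients are handled only through these properties of the projection \<open>\<pi>\<close>, stated with the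
  operations of \<open>M\<close> instead of those of the submodule \<open>P\<close>.
\<close>

lemma subquotient_projection:
  assumes P: "Module.submodule P R M" and Q: "Module.submodule Q R M" and QP: "Q \<subseteq> P"
  defines "X \<equiv> quotient_module (M\<lparr>carrier := P\<rparr>) Q"
  defines "\<pi> \<equiv> \<lambda>x. Q +>\<^bsub>M\<lparr>carrier := P\<rparr>\<^esub> x"
  shows "left_module R X" "\<And>x. x \<in> P \<Longrightarrow> \<pi> x \<in> carrier X" "\<And>Y. Y \<in> carrier X \<Longrightarrow> \<exists>x\<in>P. Y = \<pi> x"
    "\<And>x y. x \<in> P \<Longrightarrow> y \<in> P \<Longrightarrow> \<pi> (x \<oplus>\<^bsub>M\<^esub> y) = \<pi> x \<oplus>\<^bsub>X\<^esub> \<pi> y"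
    "\<And>r x. r \<in> carrier R \<Longrightarrow> x \<in> P \<Longrightarrow> \<pi> (r \<odot>\<^bsub>M\<^esub> x) = r \<odot>\<^bsub>X\<^esub> \<pi> x"
    "\<And>x. x \<in> P \<Longrightarrow> \<pi> x = \<zero>\<^bsub>X\<^esub> \<longleftrightarrow> x \<in> Q"
    "\<And>x y. x \<in> P \<Longrightarrow> y \<in> P \<Longrightarrow> \<pi> x = \<pi> y \<Longrightarrow> \<exists>q\<in>Q. x = q \<oplus>\<^bsub>M\<^esub> y"
proof -
  interpret P: left_module R "M\<lparr>carrier := P\<rparr>" by (rule left_module_submodule[OF P])
  have Q': "Module.submodule Q R (M\<lparr>carrier := P\<rparr>)" by (rule submodule_of_submodule[OF P Q QP])
  note p = P.quotient_projection_hom[OF Q', folded X_def \<pi>_def]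
  show "left_module R X" unfolding X_def by (rule P.left_module_quotient[OF Q'])
  show "\<pi> x \<in> carrier X" if "x \<in> P" for x using module_hom_closed[OF p(1)] that by auto
  show "\<exists>x\<in>P. Y = \<pi> x" if "Y \<in> carrier X" for Y using that unfolding p(2)[symmetric] by auto
  show "\<pi> (x \<oplus>\<^bsub>M\<^esub> y) = \<pi> x \<oplus>\<^bsub>X\<^esub> \<pi> y" if "x \<in> P" "y \<in> P" for x y
    using module_hom_add[OF p(1), of x y] that by simp
  show "\<pi> (r \<odot>\<^bsub>M\<^esub> x) = r \<odot>\<^bsub>X\<^esub> \<pi> x" if "r \<in> carrier R" "x \<in> P" for r x
    using module_hom_smult[OF p(1), of r x] that by simp
  show "\<pi> x = \<zero>\<^bsub>X\<^esub> \<longleftrightarrow> x \<in> Q" if "x \<in> P" for x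
    using P.rcos_eq_zero_iff[OF Q', of x] that by (simp add: X_def \<pi>_def)
  show "\<exists>q\<in>Q. x = q \<oplus>\<^bsub>M\<^esub> y" if xy: "x \<in> P" "y \<in> P" "\<pi> x = \<pi> y" for x y
  proof
    let ?q = "x \<ominus>\<^bsub>M\<lparr>carrier := P\<rparr>\<^esub> y"
    show "?q \<in> Q" using P.rcos_eq_iff[OF Q', of x y] xy by (simp add: \<pi>_def)
    have "?q \<oplus>\<^bsub>M\<lparr>carrier := P\<rparr>\<^esub> y = x"
      using P.M.a_assoc[of x "\<ominus>\<^bsub>M\<lparr>carrier := P\<rparr>\<^esub> y" y] P.M.l_neg[of y] P.M.r_zero[of x]
        P.M.a_inv_closed[of y] xy(1,2)
      by (simp add: a_minus_def)
    then show "x = ?q \<oplus>\<^bsub>M\<^esub> y" by simp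
  qed
qed

end

lemma module_hom_factor:
  assumes U: "left_module R U" and D: "left_module R D" and X: "left_module R X"
    and T: "T \<in> module_hom R U D" "T ` carrier U = carrier D"
    and F: "F \<in> module_hom R U X"
    and ker: "\<And>u. u \<in> carrier U \<Longrightarrow> T u = \<zero>\<^bsub>D\<^esub> \<Longrightarrow> F u = \<zero>\<^bsub>X\<^esub>"
  shows "\<exists>f \<in> module_hom R D X. \<forall>u\<in>carrier U. f (T u) = F u"
proof -
  interpret U: left_module R U by fact
  interpret D: left_module R D by fact
  interpret X: left_module R X by fact
  have Tc: "T u \<in> carrier D" and Fc: "F u \<in> carrier X" if "u \<in> carrier U" for u
    using module_hom_closed[OF T(1)] module_hom_closed[OF F] that by auto
  have same: "F u = F v" if "u \<in> carrier U" "v \<in> carrier U" "T u = T v" for u v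
  proof -
    have "T (u \<ominus>\<^bsub>U\<^esub> v) = \<zero>\<^bsub>D\<^esub>"
      using module_hom_diff[OF U D T(1) that(1,2)] that Tc by (simp add: a_minus_def D.M.r_neg)
    then have "F u \<ominus>\<^bsub>X\<^esub> F v = \<zero>\<^bsub>X\<^esub>"
      using ker module_hom_diff[OF U X F that(1,2)] that by simp
    then show ?thesis using Fc that by simp
  qed
  define f where "f y = F (SOME u. u \<in> carrier U \<and> T u = y)" for y
  have f: "f (T u) = F u" if "u \<in> carrier U" for u
    unfolding f_def
    using someI[of "\<lambda>v. v \<in> carrier U \<and> T v = T u" u] that by (intro same) auto
  have ex: "\<exists>u\<in>carrier U. y = T u" if "y \<in> carrier D" for y using T(2) that by auto
  have "f \<in> module_hom R D X"
    unfolding module_hom_def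
  proof (intro CollectI conjI allI impI)
    show "f \<in> carrier D \<rightarrow> carrier X" using ex f Fc by fastforce
    fix x y assume "x \<in> carrier D \<and> y \<in> carrier D"
    then obtain u v where "u \<in> carrier U" "v \<in> carrier U" "x = T u" "y = T v" using ex by metis
    then show "f (x \<oplus>\<^bsub>D\<^esub> y) = f x \<oplus>\<^bsub>X\<^esub> f y"
      by (simp add: f module_hom_add[OF T(1), symmetric] module_hom_add[OF F, symmetric])
  next
    fix a x assume a: "a \<in> carrier R \<and> x \<in> carrier D"
    then obtain u where "u \<in> carrier U" "x = T u" using ex by metis
    then show "f (a \<odot>\<^bsub>D\<^esub> x) = a \<odot>\<^bsub>X\<^esub> f x"
      using a by (simp add: f U.smult_closed module_hom_smult[OF T(1), symmetric] module_hom_smult[OF F, symmetric])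
  qed
  then show ?thesis using f by blast
qed

lemma quotient_by_kernel_isomorphic:
  assumes D: "left_module R D" and X: "left_module R X"
    and f: "f \<in> module_hom R D X" "f ` carrier D = carrier X"
    and H: "H = {x \<in> carrier D. f x = \<zero>\<^bsub>X\<^esub>}"
  shows "Module.submodule H R D" "module_isomorphic R (quotient_module D H) X"
proof -
  interpret D: left_module R D by fact
  interpret X: left_module R X by fact
  have fc: "f x \<in> carrier X" if "x \<in> carrier D" for x using module_hom_closed[OF f(1)] that by auto
  show sub: "Module.submodule H R D"
    using module_hom_zero[OF D X f(1)]
    by (intro D.submoduleI)
      (auto simp: H module_hom_add[OF f(1)] module_hom_smult[OF f(1)] D.smult_closed X.smult_zero)
  let ?p = "\<lambda>x. H +>\<^bsub>D\<^esub> x"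
  note p = D.quotient_projection_hom[OF sub]
  note Q = D.left_module_quotient[OF sub]
  obtain g where g: "g \<in> module_hom R (quotient_module D H) X" "\<And>u. u \<in> carrier D \<Longrightarrow> g (?p u) = f u"
    using module_hom_factor[OF D Q X p(1,2) f(1)] D.rcos_eq_zero_iff[OF sub] H by auto
  have "bij_betw g (carrier (quotient_module D H)) (carrier X)"
    unfolding bij_betw_def
  proof
    show "g ` carrier (quotient_module D H) = carrier X"
      unfolding p(2)[symmetric] f(2)[symmetric] using g(2) by (auto simp: image_image)
    show "inj_on g (carrier (quotient_module D H))"
    proof (rule inj_onI)
      fix Y Z assume YZ: "Y \<in> carrier (quotient_module D H)" "Z \<in> carrier (quotient_module D H)" "g Y = g Z"
      then obtain y z where yz: "y \<in> carrier D" "Y = ?p y" "z \<in> carrier D" "Z = ?p z"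
        unfolding p(2)[symmetric] by auto
      then have "f y = f z" using YZ g by simp
      then have "f (y \<ominus>\<^bsub>D\<^esub> z) = \<zero>\<^bsub>X\<^esub>" using module_hom_diff[OF D X f(1) yz(1,3)] fc yz by simp
      then have "y \<ominus>\<^bsub>D\<^esub> z \<in> H" unfolding H using yz by simp
      then show "Y = Z" using D.rcos_eq_iff[OF sub yz(1,3)] yz by simp
    qed
  qed
  then show "module_isomorphic R (quotient_module D H) X"
    unfolding module_isomorphic_def using g(1) by blast
qed

text \<open>
  The kernel of \<open>f\<close> is the only maximal submodule. If a submodule \<open>N\<close> is not contained in the kernel,
  then \<open>f\<close> maps it onto the simple module \<open>X\<close>, so it contains an element \<open>n\<close> with \<open>\<epsilon> f(n) \<noteq> 0\<close>. Then
  \<open>\<epsilon> n\<close> is nonzero, a multiple of it is the generator \<open>d\<close>, and \<open>N\<close> is everything.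
\<close>

theorem module_top_isomorphic:
  assumes D: "left_module R D" and X: "simple_module R X"
    and f: "f \<in> module_hom R D X" "f ` carrier D = carrier X"
    and d: "\<And>N. Module.submodule N R D \<Longrightarrow> d \<in> N \<Longrightarrow> N = carrier D"
    and \<epsilon>: "\<epsilon> \<in> carrier R" and \<epsilon>_X: "\<exists>x\<in>carrier X. \<epsilon> \<odot>\<^bsub>X\<^esub> x \<noteq> \<zero>\<^bsub>X\<^esub>"
    and \<epsilon>_D: "\<And>y. y \<in> carrier D \<Longrightarrow> \<epsilon> \<odot>\<^bsub>D\<^esub> y = \<zero>\<^bsub>D\<^esub> \<or> (\<exists>b\<in>carrier R. b \<odot>\<^bsub>D\<^esub> (\<epsilon> \<odot>\<^bsub>D\<^esub> y) = d)"
  shows "module_isomorphic R (module_top R D) X"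
proof -
  have X': "left_module R X" "carrier X \<noteq> {\<zero>\<^bsub>X\<^esub>}"
    and simple: "\<And>H. Module.submodule H R X \<Longrightarrow> H = {\<zero>\<^bsub>X\<^esub>} \<or> H = carrier X"
    using X unfolding simple_module_def by auto
  interpret D: left_module R D by fact
  interpret X: left_module R X by (fact X')
  have fc: "f x \<in> carrier X" if "x \<in> carrier D" for x using module_hom_closed[OF f(1)] that by auto
  define H where "H = {x \<in> carrier D. f x = \<zero>\<^bsub>X\<^esub>}"
  note H = quotient_by_kernel_isomorphic[OF D X'(1) f H_def]
  have proper: "H \<noteq> carrier D"
  proof
    assume "H = carrier D"
    then have "carrier X \<subseteq> {\<zero>\<^bsub>X\<^esub>}" unfolding f(2)[symmetric] H_def by auto
    then show False using X'(2) X.M.zero_closed by auto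
  qed
  have below: "N \<subseteq> H" if N: "Module.submodule N R D" "N \<noteq> carrier D" for N
  proof (rule ccontr)
    assume "\<not> N \<subseteq> H"
    note N' = D.submoduleD[OF N(1)]
    obtain x where x: "x \<in> N" "f x \<noteq> \<zero>\<^bsub>X\<^esub>" using \<open>\<not> N \<subseteq> H\<close> N' unfolding H_def by auto
    have "Module.submodule (f ` N) R X" by (rule module_hom_image_submodule[OF D X'(1) f(1) N(1)])
    with simple x have fN: "f ` N = carrier X" by blast
    obtain z where z: "z \<in> carrier X" "\<epsilon> \<odot>\<^bsub>X\<^esub> z \<noteq> \<zero>\<^bsub>X\<^esub>" using \<epsilon>_X by blast
    then obtain n where n: "n \<in> N" "z = f n" using fN by auto
    have nc: "n \<in> carrier D" using n N' by auto
    have "f (\<epsilon> \<odot>\<^bsub>D\<^esub> n) \<noteq> \<zero>\<^bsub>X\<^esub>" using z n nc \<epsilon> by (simp add: module_hom_smult[OF f(1)])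
    then have "\<epsilon> \<odot>\<^bsub>D\<^esub> n \<noteq> \<zero>\<^bsub>D\<^esub>" using module_hom_zero[OF D X'(1) f(1)] by auto
    then obtain b where "b \<in> carrier R" "b \<odot>\<^bsub>D\<^esub> (\<epsilon> \<odot>\<^bsub>D\<^esub> n) = d" using \<epsilon>_D[OF nc] by blast
    then have "d \<in> N" using N'(4) n \<epsilon> by metis
    then show False using d N by blast
  qed
  have maxH: "maximal_submodule H R D"
    unfolding maximal_submodule_def using H(1) proper below by blast
  have "maximal_submodule H' R D \<longleftrightarrow> H' = H" for H'
    using maxH below proper unfolding maximal_submodule_def by blast
  then have "module_radical R D = H"
    unfolding module_radical_def using D.submoduleD(1)[OF H(1)] by auto
  then show ?thesis unfolding module_top_def using H(2) by simp
qed

section \<open>The semigroup algebra and its cell modules\<close>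

locale finite_monoid_algebra = monoid S for S :: "('a, 'b) monoid_scheme" (structure) +
  fixes K :: "complex set"
  assumes finite_S: "finite (carrier S)" and subfield_K: "subfield K (class_ring :: complex ring)"
begin

abbreviation A :: "('a \<Rightarrow> complex) ring" where "A \<equiv> semigroup_algebra K S"

lemmas K_closed = subfield_complexD[OF subfield_K]

lemma A_simps:
  "carrier A = {f. (\<forall>s \<in> carrier S. f s \<in> K) \<and> (\<forall>s. s \<notin> carrier S \<longrightarrow> f s = 0)}"
  "\<one>\<^bsub>A\<^esub> = delta \<one>" "\<zero>\<^bsub>A\<^esub> = (\<lambda>s. 0)" "f \<oplus>\<^bsub>A\<^esub> g = (\<lambda>s. f s + g s)"
  by (simp_all add: semigroup_algebra_def)

lemma A_K: "f \<in> carrier A \<Longrightarrow> f s \<in> K"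
  using K_closed(1) by (cases "s \<in> carrier S") (auto simp: A_simps)

lemma A_mult:
  "(f \<otimes>\<^bsub>A\<^esub> g) u = (\<Sum>s\<in>carrier S. \<Sum>t\<in>carrier S. if s \<otimes> t = u then f s * g t else 0)"
proof -
  let ?S = "carrier S \<times> carrier S" and ?h = "\<lambda>p. f (fst p) * g (snd p)"
  have set: "{(s, t) \<in> ?S. s \<otimes> t = u} = {p \<in> ?S. fst p \<otimes> snd p = u}" by auto
  have "(f \<otimes>\<^bsub>A\<^esub> g) u = sum ?h {p \<in> ?S. fst p \<otimes> snd p = u}"
    unfolding set[symmetric] by (simp add: semigroup_algebra_def case_prod_unfold)
  moreover have "\<dots> = (\<Sum>p \<in> ?S. if fst p \<otimes> snd p = u then ?h p else 0)"
    by (rule sum.inter_filter) (simp add: finite_S)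
  moreover have "\<dots> = (\<Sum>s\<in>carrier S. \<Sum>t\<in>carrier S. if s \<otimes> t = u then f s * g t else 0)"
    by (simp add: sum.cartesian_product case_prod_unfold)
  ultimately show ?thesis by (simp only:)
qed

lemma A_mult_closed: "f \<in> carrier A \<Longrightarrow> g \<in> carrier A \<Longrightarrow> f \<otimes>\<^bsub>A\<^esub> g \<in> carrier A"
  by (auto simp: A_simps(1) A_mult intro!: subfield_complex_sum[OF subfield_K] K_closed sum.neutral)

text \<open>
  Pairing a product with an arbitrary weight \<open>w\<close> removes the convolution; both bracketings of a triple
  product reduce to the same triple sum in this way.
\<close>

lemma sum_A_mult:
  "(\<Sum>u\<in>carrier S. (f \<otimes>\<^bsub>A\<^esub> g) u * w u) = (\<Sum>s\<in>carrier S. \<Sum>t\<in>carrier S. f s * g t * w (s \<otimes> t))"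
proof -
  have "(\<Sum>u\<in>carrier S. (f \<otimes>\<^bsub>A\<^esub> g) u * w u) =
    (\<Sum>u\<in>carrier S. \<Sum>s\<in>carrier S. \<Sum>t\<in>carrier S. if s \<otimes> t = u then f s * g t * w u else 0)"
    unfolding A_mult sum_distrib_right by (intro sum.cong) auto
  also have "\<dots> = (\<Sum>s\<in>carrier S. \<Sum>t\<in>carrier S. \<Sum>u\<in>carrier S. if s \<otimes> t = u then f s * g t * w u else 0)"
    by (subst sum.swap) (intro sum.cong refl sum.swap)
  also have "\<dots> = (\<Sum>s\<in>carrier S. \<Sum>t\<in>carrier S. f s * g t * w (s \<otimes> t))"
    using finite_S by (intro sum.cong) simp_all
  finally show ?thesis .
qed

lemma A_mult_assoc: "(f \<otimes>\<^bsub>A\<^esub> g) \<otimes>\<^bsub>A\<^esub> h = f \<otimes>\<^bsub>A\<^esub> (g \<otimes>\<^bsub>A\<^esub> h)"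
proof
  fix u
  have "((f \<otimes>\<^bsub>A\<^esub> g) \<otimes>\<^bsub>A\<^esub> h) u =
      (\<Sum>r\<in>carrier S. \<Sum>p\<in>carrier S. (f \<otimes>\<^bsub>A\<^esub> g) p * (if p \<otimes> r = u then h r else 0))"
    by (subst A_mult, subst sum.swap) (intro sum.cong; simp)
  also have "\<dots> = (\<Sum>r\<in>carrier S. \<Sum>s\<in>carrier S. \<Sum>t\<in>carrier S.
      f s * g t * (if s \<otimes> t \<otimes> r = u then h r else 0))"
    by (simp only: sum_A_mult)
  also have "\<dots> = (\<Sum>s\<in>carrier S. \<Sum>t\<in>carrier S. \<Sum>r\<in>carrier S.
      f s * g t * (if s \<otimes> t \<otimes> r = u then h r else 0))"
    by (subst sum.swap) (intro sum.cong refl sum.swap)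
  also have "\<dots> = (\<Sum>s\<in>carrier S. \<Sum>t\<in>carrier S. \<Sum>r\<in>carrier S.
      g t * h r * (if s \<otimes> (t \<otimes> r) = u then f s else 0))"
    by (intro sum.cong refl) (simp add: m_assoc)
  also have "\<dots> = (\<Sum>s\<in>carrier S. \<Sum>p\<in>carrier S. (g \<otimes>\<^bsub>A\<^esub> h) p * (if s \<otimes> p = u then f s else 0))"
    by (simp only: sum_A_mult)
  also have "\<dots> = (f \<otimes>\<^bsub>A\<^esub> (g \<otimes>\<^bsub>A\<^esub> h)) u"
    by (subst (2) A_mult) (intro sum.cong; simp)
  finally show "((f \<otimes>\<^bsub>A\<^esub> g) \<otimes>\<^bsub>A\<^esub> h) u = (f \<otimes>\<^bsub>A\<^esub> (g \<otimes>\<^bsub>A\<^esub> h)) u" .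
qed

lemma scaled_delta_mult:
  assumes "s \<in> carrier S"
  shows "((\<lambda>t. k * delta s t) \<otimes>\<^bsub>A\<^esub> g) u = k * (\<Sum>t\<in>carrier S. if s \<otimes> t = u then g t else 0)"
proof -
  have "((\<lambda>t. k * delta s t) \<otimes>\<^bsub>A\<^esub> g) u =
    (\<Sum>s'\<in>carrier S. if s' = s then (\<Sum>t\<in>carrier S. if s \<otimes> t = u then k * g t else 0) else 0)"
    unfolding A_mult by (intro sum.cong) (auto simp: delta_def intro!: sum.neutral sum.cong)
  also have "\<dots> = (\<Sum>t\<in>carrier S. if s \<otimes> t = u then k * g t else 0)"
    using finite_S assms by simp
  finally show ?thesis unfolding sum_distrib_left by (simp add: if_distrib cong: if_cong)
qed

lemma mult_scaled_delta:
  assumes "s \<in> carrier S"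
  shows "(g \<otimes>\<^bsub>A\<^esub> (\<lambda>t. k * delta s t)) u = k * (\<Sum>t\<in>carrier S. if t \<otimes> s = u then g t else 0)"
proof -
  have "(g \<otimes>\<^bsub>A\<^esub> (\<lambda>t. k * delta s t)) u =
    (\<Sum>t\<in>carrier S. \<Sum>s'\<in>carrier S. if s' = s then (if t \<otimes> s = u then g t * k else 0) else 0)"
    unfolding A_mult by (intro sum.cong) (auto simp: delta_def)
  also have "\<dots> = (\<Sum>t\<in>carrier S. if t \<otimes> s = u then g t * k else 0)"
    using finite_S assms by simp
  finally show ?thesis unfolding sum_distrib_left by (simp add: if_distrib mult.commute cong: if_cong)
qed

lemma scalar_mult:
  assumes "g \<in> carrier A"
  shows "(\<lambda>t. k * delta \<one> t) \<otimes>\<^bsub>A\<^esub> g = (\<lambda>t. k * g t)"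
proof
  fix u
  have "(\<Sum>t\<in>carrier S. if \<one> \<otimes> t = u then g t else 0) = (\<Sum>t\<in>carrier S. if t = u then g t else 0)"
    by (intro sum.cong) auto
  also have "\<dots> = g u" using assms finite_S by (auto simp: A_simps)
  finally show "((\<lambda>t. k * delta \<one> t) \<otimes>\<^bsub>A\<^esub> g) u = k * g u" by (simp add: scaled_delta_mult)
qed

lemma delta_in_A: "s \<in> carrier S \<Longrightarrow> delta s \<in> carrier A"
  "s \<in> carrier S \<Longrightarrow> k \<in> K \<Longrightarrow> (\<lambda>t. k * delta s t) \<in> carrier A"
  using K_closed(1,2) by (auto simp: A_simps delta_def)

lemma ring_A: "ring A"
proof (rule ringI)
  show "abelian_group A"
  proof (rule abelian_groupI)
    fix x assume x: "x \<in> carrier A"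
    show "\<exists>y\<in>carrier A. y \<oplus>\<^bsub>A\<^esub> x = \<zero>\<^bsub>A\<^esub>"
      using x K_closed(5) by (intro bexI[of _ "\<lambda>s. - x s"]) (auto simp: A_simps)
  qed (use K_closed(1,3) in \<open>auto simp: A_simps add_ac\<close>)
  show "Group.monoid A"
  proof (rule monoidI)
    fix f assume f: "f \<in> carrier A"
    show "\<one>\<^bsub>A\<^esub> \<otimes>\<^bsub>A\<^esub> f = f" using scalar_mult[OF f, of 1] by (simp add: A_simps)
    show "f \<otimes>\<^bsub>A\<^esub> \<one>\<^bsub>A\<^esub> = f"
    proof
      fix u
      have "(f \<otimes>\<^bsub>A\<^esub> (\<lambda>t. 1 * delta \<one> t)) u = (\<Sum>t\<in>carrier S. if t = u then f t else 0)"
        by (subst mult_scaled_delta) (auto intro!: sum.cong)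
      also have "\<dots> = f u" using f finite_S by (auto simp: A_simps)
      finally show "(f \<otimes>\<^bsub>A\<^esub> \<one>\<^bsub>A\<^esub>) u = f u" by (simp add: A_simps)
    qed
  qed (simp_all add: A_mult_closed A_mult_assoc A_simps(2) delta_in_A)
  show "(f \<oplus>\<^bsub>A\<^esub> g) \<otimes>\<^bsub>A\<^esub> h = f \<otimes>\<^bsub>A\<^esub> h \<oplus>\<^bsub>A\<^esub> g \<otimes>\<^bsub>A\<^esub> h" for f g h
    unfolding A_simps(4) A_mult sum.distrib[symmetric]
    by (intro ext sum.cong refl) (simp add: algebra_simps)
  show "h \<otimes>\<^bsub>A\<^esub> (f \<oplus>\<^bsub>A\<^esub> g) = h \<otimes>\<^bsub>A\<^esub> f \<oplus>\<^bsub>A\<^esub> h \<otimes>\<^bsub>A\<^esub> g" for f g h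
    unfolding A_simps(4) A_mult sum.distrib[symmetric]
    by (intro ext sum.cong refl) (simp add: algebra_simps)
qed

sublocale A: ring A by (rule ring_A)

lemma left_module_regular: "left_module A (regular_module A)"
proof -
  have "abelian_group (regular_module A)"
  proof (rule abelian_groupI)
    fix x assume x: "x \<in> carrier (regular_module A)"
    then show "\<exists>y\<in>carrier (regular_module A). y \<oplus>\<^bsub>regular_module A\<^esub> x = \<zero>\<^bsub>regular_module A\<^esub>"
      by (intro bexI[of _ "\<ominus>\<^bsub>A\<^esub> x"]) (simp_all add: regular_module_def A.l_neg)
  qed (simp_all add: regular_module_def A.a_ac)
  then show ?thesis
    by (intro left_module.intro left_module_axioms.intro ring_A)
      (simp_all add: regular_module_def A.l_distr A.r_distr A.m_assoc)
qed

lemma basis_span_iff: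
  "X \<subseteq> carrier S \<Longrightarrow> f \<in> basis_span K S X \<longleftrightarrow> (\<forall>s\<in>X. f s \<in> K) \<and> (\<forall>s. s \<notin> X \<longrightarrow> f s = 0)"
  using K_closed(1) by (auto simp: basis_span_def A_simps)

lemma basis_span_mult:
  assumes X: "\<And>s x. s \<in> carrier S \<Longrightarrow> x \<in> X \<Longrightarrow> s \<otimes> x \<in> X"
    and f: "f \<in> carrier A" and g: "g \<in> basis_span K S X"
  shows "f \<otimes>\<^bsub>A\<^esub> g \<in> basis_span K S X"
  unfolding basis_span_def
proof (intro CollectI conjI allI impI)
  show "f \<otimes>\<^bsub>A\<^esub> g \<in> carrier A" using A_mult_closed f g by (auto simp: basis_span_def)
  fix u assume u: "u \<notin> X"
  show "(f \<otimes>\<^bsub>A\<^esub> g) u = 0" unfolding A_mult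
    using X g u by (intro sum.neutral ballI) (auto simp: basis_span_def)
qed

text \<open>
  The coefficient of \<open>y\<close> in \<open>f x\<close>, that is, the matrix of left multiplication by \<open>f\<close>. The coefficients have
  an arbitrary type because the matrix is used over the reals, where it can be positive, and over the
  complex numbers, where the module lives.
\<close>

definition entry :: "('a \<Rightarrow> 'c) \<Rightarrow> 'a \<Rightarrow> 'a \<Rightarrow> 'c::comm_monoid_add" where
  "entry f y x = (\<Sum>s\<in>carrier S. if s \<otimes> x = y then f s else 0)"

lemma left_le_refl: "x \<in> carrier S \<Longrightarrow> left_le S x x"
  unfolding left_le_def by (intro bexI[of _ \<one>]) auto

lemma left_le_trans: "x \<in> carrier S \<Longrightarrow> left_le S x y \<Longrightarrow> left_le S y z \<Longrightarrow> left_le S x z"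
  unfolding left_le_def by (metis m_assoc m_closed)

lemma equiv_left_equiv: "equiv (carrier S) (left_equiv S)"
  by (rule equivI) (auto simp: left_equiv_def refl_on_def sym_def trans_def left_le_refl intro: left_le_trans)

lemma two_sided_le_refl: "x \<in> carrier S \<Longrightarrow> two_sided_le S x x"
  unfolding two_sided_le_def by (intro bexI[of _ \<one>]) auto

lemma two_sided_le_trans:
  assumes "x \<in> carrier S" "two_sided_le S x y" "two_sided_le S y z"
  shows "two_sided_le S x z"
proof -
  obtain s t s' t' where "s \<in> carrier S" "t \<in> carrier S" "s' \<in> carrier S" "t' \<in> carrier S"
    "y = s \<otimes> x \<otimes> t" "z = s' \<otimes> y \<otimes> t'" using assms unfolding two_sided_le_def by blast
  then show ?thesis using assms(1) unfolding two_sided_le_def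
    by (intro bexI[of _ "s' \<otimes> s"] bexI[of _ "t \<otimes> t'"]) (auto simp: m_assoc)
qed

lemma equiv_two_sided_equiv: "equiv (carrier S) (two_sided_equiv S)"
  by (rule equivI) (auto simp: two_sided_equiv_def refl_on_def sym_def trans_def two_sided_le_refl intro: two_sided_le_trans)

end

locale left_cell = finite_monoid_algebra +
  fixes L assumes L: "L \<in> left_cells S"
begin

lemma cell_nonempty: "\<exists>x. x \<in> L"
  using L equiv_left_equiv by (metis left_cells_def in_quotient_imp_non_empty ex_in_conv)

lemma cell_carrier: "x \<in> L \<Longrightarrow> x \<in> carrier S"
  using L equiv_left_equiv by (metis left_cells_def in_quotient_imp_subset subsetD)

lemma cell_le: "x \<in> L \<Longrightarrow> y \<in> L \<Longrightarrow> left_le S x y"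
  using L equiv_left_equiv in_quotient_imp_in_rel[of "carrier S" "left_equiv S" L x y]
  by (auto simp: left_cells_def left_equiv_def)

lemma cellI: "x \<in> L \<Longrightarrow> y \<in> carrier S \<Longrightarrow> left_le S x y \<Longrightarrow> left_le S y x \<Longrightarrow> y \<in> L"
  using L equiv_left_equiv in_quotient_imp_closed[of "carrier S" "left_equiv S" L x y] cell_carrier
  by (auto simp: left_cells_def left_equiv_def)

lemma finite_cell: "finite L"
  using cell_carrier finite_S by (meson finite_subset subsetI)

definition "C = left_cell_closure S L"

lemma closure_iff: "x \<in> L \<Longrightarrow> y \<in> C \<longleftrightarrow> y \<in> carrier S \<and> left_le S x y"
proof
  assume x: "x \<in> L" and y: "y \<in> C"
  then obtain L' where L': "L' \<in> left_cells S" "left_cell_le S L L'" "y \<in> L'"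
    unfolding C_def left_cell_closure_def by auto
  interpret L': left_cell S K L' by unfold_locales (fact L')
  obtain u v where "u \<in> L" "v \<in> L'" "left_le S u v" using L'(2) unfolding left_cell_le_def by auto
  then show "y \<in> carrier S \<and> left_le S x y"
    using cell_le[OF x] L'.cell_le[of v y] L' L'.cell_carrier cell_carrier x by (meson left_le_trans)
next
  assume x: "x \<in> L" and y: "y \<in> carrier S \<and> left_le S x y"
  have "left_equiv S `` {y} \<in> left_cells S" using y by (simp add: left_cells_def quotientI)
  moreover have "y \<in> left_equiv S `` {y}" using y by (simp add: left_equiv_def left_le_refl)
  ultimately show "y \<in> C" unfolding C_def left_cell_closure_def left_cell_le_def using x y by blast
qed

lemma cell_C: "x \<in> L \<Longrightarrow> x \<in> C"
  using closure_iff[of x x] cell_carrier left_le_refl by blast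

lemma C_mult: "s \<in> carrier S \<Longrightarrow> y \<in> C \<Longrightarrow> s \<otimes> y \<in> C"
proof -
  assume s: "s \<in> carrier S" and y: "y \<in> C"
  obtain x where x: "x \<in> L" using cell_nonempty by blast
  have "left_le S y (s \<otimes> y)" using s unfolding left_le_def by blast
  then show ?thesis using closure_iff[OF x] s y cell_carrier[OF x] by (meson left_le_trans m_closed)
qed

text \<open>
  The part of the closure outside the cell is stable under left multiplication; this is why its span
  is a left ideal.
\<close>

lemma cell_backward: "s \<in> carrier S \<Longrightarrow> y \<in> C \<Longrightarrow> s \<otimes> y \<in> L \<Longrightarrow> y \<in> L"
proof -
  assume s: "s \<in> carrier S" and y: "y \<in> C" and sy: "s \<otimes> y \<in> L"
  have "left_le S y (s \<otimes> y)" using s unfolding left_le_def by blast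
  then show ?thesis using closure_iff[OF sy] cellI[OF sy] y by blast
qed

abbreviation "U \<equiv> upper_ideal K S L"
abbreviation "W \<equiv> lower_ideal K S L"
abbreviation "M \<equiv> cell_module K S L"

lemma U_simps: "carrier U = basis_span K S C" "x \<oplus>\<^bsub>U\<^esub> y = x \<oplus>\<^bsub>A\<^esub> y"
  "\<zero>\<^bsub>U\<^esub> = \<zero>\<^bsub>A\<^esub>" "f \<odot>\<^bsub>U\<^esub> x = f \<otimes>\<^bsub>A\<^esub> x"
  by (simp_all add: upper_ideal_def regular_module_def C_def)

lemma W_eq: "W = basis_span K S (C - L)" by (simp add: lower_ideal_def C_def)

lemma basis_span_submodule:
  assumes "\<And>s x. s \<in> carrier S \<Longrightarrow> x \<in> X \<Longrightarrow> s \<otimes> x \<in> X"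
  shows "Module.submodule (basis_span K S X) A (regular_module A)"
proof -
  interpret reg: left_module A "regular_module A" by (rule left_module_regular)
  show ?thesis
  proof (rule reg.submoduleI)
    show "a \<odot>\<^bsub>regular_module A\<^esub> x \<in> basis_span K S X" if "a \<in> carrier A" "x \<in> basis_span K S X" for a x
      using basis_span_mult[OF assms that] by (simp add: regular_module_def)
  qed (use K_closed(1,3) in \<open>auto simp: basis_span_def regular_module_def A_simps\<close>)
qed

lemma left_module_U: "left_module A U"
proof -
  interpret reg: left_module A "regular_module A" by (rule left_module_regular)
  show ?thesis unfolding upper_ideal_def C_def[symmetric]
    by (intro reg.left_module_submodule basis_span_submodule C_mult)
qed

sublocale U: left_module A U by (rule left_module_U)

lemma W_submodule: "Module.submodule W A U"
proof (rule U.submoduleI)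
  have *: "s \<otimes> x \<in> C - L" if "s \<in> carrier S" "x \<in> C - L" for s x
    using that C_mult cell_backward by blast
  show "W \<subseteq> carrier U" by (auto simp: W_eq U_simps basis_span_def)
  show "a \<odot>\<^bsub>U\<^esub> x \<in> W" if "a \<in> carrier A" "x \<in> W" for a x
    using basis_span_mult[OF *] that by (simp add: U_simps W_eq)
qed (use K_closed(1,3) in \<open>auto simp: W_eq U_simps basis_span_def A_simps\<close>)

lemma left_module_M: "left_module A M"
  unfolding cell_module_def by (rule U.left_module_quotient[OF W_submodule])

sublocale M: left_module A M by (rule left_module_M)

text \<open>
  On functions supported on \<open>L\<close> this is the coordinate isomorphism onto the cell module, with respect to
  the basis \<open>B\<^sub>L\<close>. In these coordinates an algebra element acts by \<open>act\<close> below, which drops all products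
  that leave the cell.
\<close>

definition \<iota> :: "('a \<Rightarrow> complex) \<Rightarrow> ('a \<Rightarrow> complex) set" where "\<iota> v = W +>\<^bsub>U\<^esub> v"

lemma cell_basis_eq: "cell_basis K S L s = \<iota> (delta s)"
  by (simp add: cell_basis_def \<iota>_def)

lemmas iota_hom = U.quotient_projection_hom(1)[OF W_submodule, folded cell_module_def \<iota>_def]
lemmas iota_surj = U.quotient_projection_hom(2)[OF W_submodule, folded cell_module_def \<iota>_def]
lemmas iota_zero_iff = U.rcos_eq_zero_iff[OF W_submodule, folded \<iota>_def]
lemmas iota_eq_iff = U.rcos_eq_iff[OF W_submodule, folded \<iota>_def]

lemma M_zero: "\<zero>\<^bsub>M\<^esub> = W" by (simp add: cell_module_def)

lemma span_cell_U: "v \<in> basis_span K S L \<Longrightarrow> v \<in> carrier U"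
  using cell_C by (auto simp: U_simps basis_span_def)

definition restr :: "('a \<Rightarrow> complex) \<Rightarrow> 'a \<Rightarrow> complex" where
  "restr f x = (if x \<in> L then f x else 0)"

lemma restr_span: "f \<in> carrier A \<Longrightarrow> restr f \<in> basis_span K S L"
  using cell_carrier K_closed(1) by (auto simp: basis_span_def A_simps restr_def)

lemma iota_restr: "f \<in> carrier U \<Longrightarrow> \<iota> (restr f) = \<iota> f"
proof -
  assume f: "f \<in> carrier U"
  then have fA: "f \<in> carrier A" by (simp add: U_simps basis_span_def)
  have r: "restr f \<in> carrier U" using restr_span[OF fA] span_cell_U by blast
  define d where "d x = (if x \<in> L then 0 else - f x)" for x
  have d: "d \<in> W" using f K_closed(1,5) unfolding W_eq d_def by (auto simp: basis_span_def A_simps U_simps)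
  have "restr f = d \<oplus>\<^bsub>U\<^esub> f" by (auto simp: restr_def d_def U_simps A_simps)
  moreover have "d \<in> carrier U" using d U.submoduleD(1)[OF W_submodule] by blast
  ultimately have "restr f \<ominus>\<^bsub>U\<^esub> f = d" using f by (simp add: a_minus_def U.M.a_assoc U.M.r_neg)
  then show ?thesis using iota_eq_iff[OF r f] d by simp
qed

lemma iota_inj:
  assumes "v \<in> basis_span K S L" "w \<in> basis_span K S L" "\<iota> v = \<iota> w"
  shows "v = w"
proof -
  have c: "v \<in> carrier U" "w \<in> carrier U" using assms span_cell_U by auto
  have "v \<ominus>\<^bsub>U\<^esub> w \<in> W" using iota_eq_iff c assms(3) by blast
  then obtain d where d: "d \<in> W" "d = v \<ominus>\<^bsub>U\<^esub> w" by blast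
  then have "v = d \<oplus>\<^bsub>U\<^esub> w" using c by (simp add: a_minus_def U.M.a_assoc U.M.l_neg)
  then have "v x = d x + w x" for x by (simp add: U_simps A_simps)
  then show ?thesis using assms(1,2) d(1) unfolding basis_span_def W_eq by fastforce
qed

lemma M_iota_ex: "m \<in> carrier M \<Longrightarrow> \<exists>v\<in>basis_span K S L. m = \<iota> v"
proof -
  assume "m \<in> carrier M"
  then obtain f where f: "f \<in> carrier U" "m = \<iota> f" using iota_surj by auto
  then have "f \<in> carrier A" by (simp add: U_simps basis_span_def)
  then show ?thesis using iota_restr[OF f(1)] restr_span f(2) by metis
qed

definition act :: "('a \<Rightarrow> complex) \<Rightarrow> ('a \<Rightarrow> complex) \<Rightarrow> 'a \<Rightarrow> complex" where
  "act f v y = (if y \<in> L then \<Sum>x\<in>L. entry f y x * v x else 0)"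

lemma act_eq: "v \<in> basis_span K S L \<Longrightarrow> act f v = restr (f \<otimes>\<^bsub>A\<^esub> v)"
proof
  fix y assume v: "v \<in> basis_span K S L"
  have "(f \<otimes>\<^bsub>A\<^esub> v) y = (\<Sum>x\<in>carrier S. entry f y x * v x)"
    unfolding A_mult entry_def by (subst sum.swap) (auto simp: sum_distrib_right intro!: sum.cong)
  also have "\<dots> = (\<Sum>x\<in>L. entry f y x * v x)"
    using v cell_carrier finite_S by (intro sum.mono_neutral_right) (auto simp: basis_span_def)
  finally show "act f v y = restr (f \<otimes>\<^bsub>A\<^esub> v) y" by (simp add: act_def restr_def)
qed

lemma act_span: "f \<in> carrier A \<Longrightarrow> v \<in> basis_span K S L \<Longrightarrow> act f v \<in> basis_span K S L"
  by (subst act_eq, assumption, intro restr_span A_mult_closed) (simp_all add: basis_span_def)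

lemma iota_act:
  assumes "f \<in> carrier A" "v \<in> basis_span K S L"
  shows "f \<odot>\<^bsub>M\<^esub> \<iota> v = \<iota> (act f v)"
proof -
  have v: "v \<in> carrier U" using assms span_cell_U by blast
  have "f \<odot>\<^bsub>M\<^esub> \<iota> v = \<iota> (f \<odot>\<^bsub>U\<^esub> v)" using module_hom_smult[OF iota_hom assms(1) v] by simp
  also have "\<dots> = \<iota> (restr (f \<odot>\<^bsub>U\<^esub> v))" using iota_restr U.smult_closed[OF assms(1) v] by simp
  finally show ?thesis using assms by (simp add: act_eq U_simps)
qed

lemma iota_add:
  "v \<in> basis_span K S L \<Longrightarrow> w \<in> basis_span K S L \<Longrightarrow> \<iota> v \<oplus>\<^bsub>M\<^esub> \<iota> w = \<iota> (\<lambda>x. v x + w x)"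
  using module_hom_add[OF iota_hom, of v w] span_cell_U by (simp add: U_simps A_simps)

lemma iota_scalar:
  assumes "k \<in> K" "v \<in> basis_span K S L"
  shows "(\<lambda>t. k * delta \<one> t) \<odot>\<^bsub>M\<^esub> \<iota> v = \<iota> (\<lambda>x. k * v x)"
proof -
  have "v \<in> carrier A" using assms by (simp add: basis_span_def)
  then show ?thesis
    using module_hom_smult[OF iota_hom delta_in_A(2)[OF one_closed assms(1)] span_cell_U[OF assms(2)]]
    by (simp add: U_simps scalar_mult)
qed

lemma iota_M: "v \<in> basis_span K S L \<Longrightarrow> \<iota> v \<in> carrier M"
  using iota_surj span_cell_U by blast

lemma span_L_iff: "v \<in> basis_span K S L \<longleftrightarrow> (\<forall>x\<in>L. v x \<in> K) \<and> (\<forall>x. x \<notin> L \<longrightarrow> v x = 0)"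
  using cell_carrier by (intro basis_span_iff) auto

lemma iota_zero: "\<iota> (\<lambda>x. 0) = \<zero>\<^bsub>M\<^esub>"
  using U.quotient_projection_hom(3)[OF W_submodule, folded \<iota>_def cell_module_def] by (simp add: U_simps A_simps)

end

section \<open>Stability and the group at the apex\<close>

context finite_monoid_algebra
begin

lemma maximal_subgroup_iff:
  assumes e: "e \<in> carrier S" "e \<otimes> e = e"
  shows "g \<in> carrier (maximal_subgroup S e) \<longleftrightarrow> g \<in> carrier S \<and> e \<otimes> g = g \<and> g \<otimes> e = g \<and>
    (\<exists>h\<in>carrier S. e \<otimes> h = h \<and> h \<otimes> e = h \<and> h \<otimes> g = e \<and> g \<otimes> h = e)"
proof -
  have "x \<in> carrier (local_monoid S e) \<longleftrightarrow> x \<in> carrier S \<and> e \<otimes> x = x \<and> x \<otimes> e = x" for x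
  proof
    assume "x \<in> carrier (local_monoid S e)"
    then obtain s where s: "s \<in> carrier S" "x = e \<otimes> s \<otimes> e" by (auto simp: local_monoid_def)
    then have "e \<otimes> x = e \<otimes> e \<otimes> s \<otimes> e" "x \<otimes> e = e \<otimes> s \<otimes> (e \<otimes> e)" using e(1) by (simp_all add: m_assoc)
    then show "x \<in> carrier S \<and> e \<otimes> x = x \<and> x \<otimes> e = x" using s e by simp
  qed (auto simp: local_monoid_def intro!: exI[of _ x])
  then show ?thesis
    by (auto simp: maximal_subgroup_def units_of_def Units_def) (auto simp: local_monoid_def)
qed

text \<open>
  Left multiplication by \<open>x\<close> is injective on the finite monoid \<open>eSe\<close>, hence surjective, which yields a
  right inverse as well.
\<close>

lemma left_invertible_imp_maximal_subgroup:
  assumes e: "e \<in> carrier S" "e \<otimes> e = e" and x: "x \<in> carrier S" "e \<otimes> x = x" "x \<otimes> e = x"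
    and b: "b \<in> carrier S" "b \<otimes> x = e"
  shows "x \<in> carrier (maximal_subgroup S e)"
proof -
  define E where "E = {y \<in> carrier S. e \<otimes> y = y \<and> y \<otimes> e = y}"
  define c where "c = e \<otimes> b \<otimes> e"
  have c: "c \<in> carrier S" "e \<otimes> c = c" "c \<otimes> e = c" "c \<otimes> x = e"
  proof -
    show "c \<in> carrier S" unfolding c_def using e b by simp
    have "e \<otimes> c = e \<otimes> e \<otimes> b \<otimes> e" unfolding c_def using e(1) b by (simp add: m_assoc)
    then show "e \<otimes> c = c" unfolding c_def using e by simp
    have "c \<otimes> e = e \<otimes> b \<otimes> (e \<otimes> e)" unfolding c_def using e(1) b by (simp add: m_assoc)
    then show "c \<otimes> e = c" unfolding c_def using e by simp
    have "c \<otimes> x = e \<otimes> (b \<otimes> (e \<otimes> x))" unfolding c_def using e(1) b(1) x(1) by (simp add: m_assoc)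
    then show "c \<otimes> x = e" using e x b by simp
  qed
  have "inj_on (\<lambda>y. x \<otimes> y) E"
  proof (rule inj_onI)
    fix y z assume yz: "y \<in> E" "z \<in> E" "x \<otimes> y = x \<otimes> z"
    then have y: "y \<in> carrier S" "e \<otimes> y = y" and z: "z \<in> carrier S" "e \<otimes> z = z" by (simp_all add: E_def)
    have "c \<otimes> x \<otimes> y = c \<otimes> x \<otimes> z"
      using yz(3) m_assoc[OF c(1) x(1) y(1)] m_assoc[OF c(1) x(1) z(1)] by simp
    then show "y = z" using y z c(4) by simp
  qed
  moreover have "(\<lambda>y. x \<otimes> y) ` E \<subseteq> E"
    using x e by (auto simp: E_def m_assoc[symmetric]) (simp add: m_assoc)
  ultimately have "(\<lambda>y. x \<otimes> y) ` E = E" using finite_S by (simp add: endo_inj_surj E_def)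
  moreover have "e \<in> E" using e by (simp add: E_def)
  ultimately obtain y where y: "y \<in> E" "x \<otimes> y = e" by (metis imageE)
  have "c = c \<otimes> (x \<otimes> y)" using y(2) c(3) by simp
  also have "\<dots> = c \<otimes> x \<otimes> y" using y(1) c(1) x(1) by (simp add: m_assoc E_def)
  also have "\<dots> = y" using y(1) c(4) by (simp add: E_def)
  finally have "x \<otimes> c = e" using y(2) by simp
  then show ?thesis using x c maximal_subgroup_iff[OF e] by blast
qed

text \<open>
  Finite monoids are stable: an element of \<open>Se\<close> that divides \<open>e\<close> on two sides divides it on one side.
  From \<open>e = u s v\<close> follows \<open>(e u s)(e v e) = e\<close> in \<open>eSe\<close>, where a one-sided inverse is two-sided.
\<close>

lemma left_stability:
  assumes e: "e \<in> carrier S" "e \<otimes> e = e" and s: "s \<in> carrier S" "s \<otimes> e = s"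
    and uv: "u \<in> carrier S" "v \<in> carrier S" "e = u \<otimes> s \<otimes> v"
  shows "\<exists>w\<in>carrier S. e = w \<otimes> s"
proof -
  define x where "x = e \<otimes> u \<otimes> s"
  define b where "b = e \<otimes> v \<otimes> e"
  have xb: "x \<otimes> b = e"
  proof -
    have "x \<otimes> b = e \<otimes> (u \<otimes> (s \<otimes> e) \<otimes> v) \<otimes> e"
      unfolding x_def b_def using e(1) s(1) uv(1,2) by (simp add: m_assoc)
    then show ?thesis using e s uv(3)[symmetric] by simp
  qed
  have b: "b \<in> carrier S" "e \<otimes> b = b" "b \<otimes> e = b" and x: "x \<in> carrier S" "x \<otimes> e = x"
  proof -
    show "b \<in> carrier S" "x \<in> carrier S" unfolding b_def x_def using e s uv by auto
    have "e \<otimes> b = e \<otimes> e \<otimes> v \<otimes> e" "b \<otimes> e = e \<otimes> v \<otimes> (e \<otimes> e)" "x \<otimes> e = e \<otimes> u \<otimes> (s \<otimes> e)"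
      unfolding b_def x_def using e(1) s(1) uv(1,2) by (simp_all add: m_assoc)
    then show "e \<otimes> b = b" "b \<otimes> e = b" "x \<otimes> e = x" unfolding b_def x_def using e s by simp_all
  qed
  have "b \<in> carrier (maximal_subgroup S e)"
    by (rule left_invertible_imp_maximal_subgroup[OF e b x(1) xb])
  then obtain h where h: "h \<in> carrier S" "e \<otimes> h = h" "b \<otimes> h = e" using maximal_subgroup_iff[OF e] by auto
  have "x = x \<otimes> (b \<otimes> h)" using h(3) x(2) by simp
  also have "\<dots> = x \<otimes> b \<otimes> h" using h(1) x(1) b(1) by (simp add: m_assoc)
  also have "\<dots> = h" using h(2) xb by simp
  finally have "b \<otimes> x = e" using h(3) by simp
  then have "e = b \<otimes> e \<otimes> u \<otimes> s" unfolding x_def using e(1) b(1) uv(1) s(1) by (simp add: m_assoc)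
  then show ?thesis using e b uv by blast
qed

end

text \<open>
  The elementwise meaning of an idempotent in the apex of the cell module: \<open>e\<close> does not annihilate the
  module, and every \<open>s\<close> that does not annihilate it is a two-sided divisor of \<open>e\<close>.
\<close>

locale apex_cell = left_cell +
  fixes e assumes e: "e \<in> carrier S" "e \<otimes> e = e"
    and e_acts: "\<exists>x\<in>L. e \<otimes> x \<in> L"
    and apex: "\<And>s x. s \<in> carrier S \<Longrightarrow> x \<in> L \<Longrightarrow> s \<otimes> x \<in> L \<Longrightarrow>
      \<exists>u\<in>carrier S. \<exists>v\<in>carrier S. e = u \<otimes> s \<otimes> v"
begin

abbreviation "G \<equiv> carrier (maximal_subgroup S e)"

lemmas G_iff = maximal_subgroup_iff[OF e]

lemma G_D: "g \<in> G \<Longrightarrow> g \<in> carrier S" "g \<in> G \<Longrightarrow> e \<otimes> g = g" "g \<in> G \<Longrightarrow> g \<otimes> e = g"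
  by (simp_all add: G_iff)

lemma e_in_G: "e \<in> G" using e by (auto simp: G_iff)

lemma G_inverse: "g \<in> G \<Longrightarrow> \<exists>h\<in>G. h \<otimes> g = e \<and> g \<otimes> h = e"
proof -
  assume g: "g \<in> G"
  then obtain h where h: "h \<in> carrier S" "e \<otimes> h = h" "h \<otimes> e = h" "h \<otimes> g = e" "g \<otimes> h = e"
    unfolding G_iff by blast
  then have "h \<in> G" using G_D[OF g] unfolding G_iff by blast
  then show ?thesis using h by blast
qed

lemma G_closed: assumes "g \<in> G" "h \<in> G" shows "g \<otimes> h \<in> G"
proof -
  obtain g' h' where i: "g' \<in> G" "h' \<in> G" "g' \<otimes> g = e" "h' \<otimes> h = e" using assms G_inverse by metis
  note c = G_D[OF assms(1)] G_D[OF assms(2)] G_D[OF i(1)] G_D[OF i(2)]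
  show ?thesis
  proof (rule left_invertible_imp_maximal_subgroup[OF e, where b = "h' \<otimes> g'"])
    have "h' \<otimes> g' \<otimes> (g \<otimes> h) = h' \<otimes> ((g' \<otimes> g) \<otimes> h)" using c e(1) by (simp add: m_assoc)
    then show "h' \<otimes> g' \<otimes> (g \<otimes> h) = e" using c i by simp
    show "e \<otimes> (g \<otimes> h) = g \<otimes> h" using c e(1) by (simp add: m_assoc[symmetric])
    show "g \<otimes> h \<otimes> e = g \<otimes> h" using c e(1) by (simp add: m_assoc)
  qed (use c in auto)
qed

lemma finite_G: "finite G"
  using G_D(1) finite_S by (meson finite_subset subsetI)

text \<open>
  An element of \<open>eSe\<close> that does not annihilate the cell module divides \<open>e\<close> on two sides by maximality
  of the apex, on the left by stability, and is therefore a unit of \<open>eSe\<close>.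
\<close>

lemma local_acts_imp_G:
  assumes s: "s \<in> carrier S" "e \<otimes> s = s" "s \<otimes> e = s" and x: "x \<in> L" "s \<otimes> x \<in> L"
  shows "s \<in> G"
proof -
  obtain u v where uv: "u \<in> carrier S" "v \<in> carrier S" "e = u \<otimes> s \<otimes> v" using apex[OF s(1) x] by blast
  obtain w where "w \<in> carrier S" "e = w \<otimes> s" using left_stability[OF e s(1,3) uv] by blast
  then show ?thesis using left_invertible_imp_maximal_subgroup[OF e s] by simp
qed

definition "X0 = {x \<in> L. e \<otimes> x = x}"

lemma X0_nonempty: "\<exists>x. x \<in> X0"
proof -
  obtain x where x: "x \<in> L" "e \<otimes> x \<in> L" using e_acts by blast
  then have "e \<otimes> (e \<otimes> x) = e \<otimes> x" using e cell_carrier by (simp add: m_assoc[symmetric])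
  then show ?thesis using x unfolding X0_def by blast
qed

lemma X0_D: "x \<in> X0 \<Longrightarrow> x \<in> L" "x \<in> X0 \<Longrightarrow> e \<otimes> x = x" "x \<in> X0 \<Longrightarrow> x \<in> carrier S"
  by (auto simp: X0_def cell_carrier)

lemma G_X0: assumes g: "g \<in> G" and x: "x \<in> X0" shows "g \<otimes> x \<in> X0"
proof -
  obtain h where h: "h \<in> G" "h \<otimes> g = e" using G_inverse[OF g] by blast
  note c = G_D[OF g] G_D[OF h(1)] X0_D[OF x]
  have "x = h \<otimes> (g \<otimes> x)" using c h(2) by (simp add: m_assoc[symmetric])
  then have "left_le S (g \<otimes> x) x" using c unfolding left_le_def by blast
  moreover have "left_le S x (g \<otimes> x)" using c unfolding left_le_def by blast
  ultimately have "g \<otimes> x \<in> L" using cellI[of x "g \<otimes> x"] c by simp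
  then show ?thesis unfolding X0_def using c e by (simp add: m_assoc[symmetric])
qed

text \<open>
  Two elements of a left cell differ by some left factor \<open>s\<close>. On points fixed by \<open>e\<close> it may be replaced by
  \<open>e s e\<close>, which lies in \<open>G\<close> because it does not annihilate the module.
\<close>

lemma G_transitive: assumes x: "x \<in> X0" and z: "z \<in> X0" shows "\<exists>g\<in>G. z = g \<otimes> x"
proof -
  note c = X0_D[OF x] X0_D[OF z]
  obtain s where s: "s \<in> carrier S" "z = s \<otimes> x" using cell_le[of x z] c unfolding left_le_def by blast
  have "e \<otimes> s \<otimes> e \<otimes> x = e \<otimes> (s \<otimes> (e \<otimes> x))" using c(1,3) e(1) s(1) by (simp add: m_assoc)
  then have z': "e \<otimes> s \<otimes> e \<otimes> x = z" using c s by simp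
  have "e \<otimes> (e \<otimes> s \<otimes> e) = e \<otimes> e \<otimes> s \<otimes> e" "e \<otimes> s \<otimes> e \<otimes> e = e \<otimes> s \<otimes> (e \<otimes> e)"
    using e(1) s(1) by (simp_all add: m_assoc)
  then have "e \<otimes> s \<otimes> e \<in> G"
    using e s c z' by (intro local_acts_imp_G[of _ x]) simp_all
  then show ?thesis using z' by blast
qed

definition gsum :: "'a \<Rightarrow> complex" where "gsum s = (if s \<in> G then 1 else 0)"
definition v0 :: "'a \<Rightarrow> complex" where "v0 x = (if x \<in> X0 then 1 else 0)"

lemma gsum_A: "gsum \<in> carrier A"
  using K_closed(1,2) G_D(1) by (auto simp: A_simps gsum_def)

lemma v0_span: "v0 \<in> basis_span K S L"
  using K_closed(1,2) X0_D(1) by (auto simp: span_L_iff v0_def)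

lemma sum_gsum: "(\<Sum>s\<in>carrier S. if P s then gsum s else 0) = (\<Sum>g\<in>G. if P g then 1 else 0)"
proof -
  have "(\<Sum>s\<in>carrier S. if P s then gsum s else 0) = (\<Sum>s\<in>carrier S. if s \<in> G then (if P s then 1 else 0) else 0)"
    by (intro sum.cong) (auto simp: gsum_def)
  also have "\<dots> = (\<Sum>g\<in>carrier S \<inter> G. if P g then 1 else 0)"
    using finite_S by (simp add: sum.inter_restrict)
  also have "carrier S \<inter> G = G" using G_D(1) by auto
  finally show ?thesis .
qed

text \<open>
  Since \<open>e \<epsilon> = \<epsilon>\<close>, the values of the operator \<open>\<epsilon>\<close> are supported on \<open>X0\<close>; since \<open>h \<epsilon> = \<epsilon>\<close> for \<open>h\<close> in \<open>G\<close>
  and \<open>G\<close> is transitive on \<open>X0\<close>, they are constant there. So \<open>\<epsilon>\<close> has rank at most one.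
\<close>

lemma act_gsum:
  assumes v: "v \<in> basis_span K S L"
  shows "\<exists>k\<in>K. act gsum v = (\<lambda>x. k * v0 x)"
proof -
  obtain y where y: "y \<in> X0" using X0_nonempty by blast
  have out: "act gsum v z = 0" if z: "z \<notin> X0" for z
  proof (cases "z \<in> L")
    case True
    have "g \<otimes> x \<noteq> z" if g: "g \<in> G" and x: "x \<in> L" for g x
    proof
      assume eq: "g \<otimes> x = z"
      have "e \<otimes> z = z" using G_D[OF g] e cell_carrier[OF x] unfolding eq[symmetric]
        by (simp add: m_assoc[symmetric])
      then show False using z True by (simp add: X0_def)
    qed
    then show ?thesis unfolding act_def entry_def sum_gsum by (auto intro!: sum.neutral)
  qed (simp add: act_def)
  have const: "act gsum v z = act gsum v y" if z: "z \<in> X0" for z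
  proof -
    obtain h where h: "h \<in> G" "z = h \<otimes> y" using G_transitive[OF y z] by blast
    obtain h' where h': "h' \<in> G" "h' \<otimes> h = e" "h \<otimes> h' = e" using G_inverse[OF h(1)] by blast
    note c = G_D[OF h(1)] G_D[OF h'(1)]
    have "(\<Sum>g\<in>G. if g \<otimes> x = z then 1 else 0) = (\<Sum>g\<in>G. if g \<otimes> x = y then 1 else (0::complex))" if x: "x \<in> L" for x
    proof (rule sum.reindex_bij_witness[where i = "\<lambda>g. h \<otimes> g" and j = "\<lambda>g. h' \<otimes> g"])
      fix g assume g: "g \<in> G"
      note d = G_D[OF g] cell_carrier[OF x] X0_D[OF y]
      show "h \<otimes> (h' \<otimes> g) = g" "h' \<otimes> (h \<otimes> g) = g" using c d h' by (simp_all add: m_assoc[symmetric])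
      show "h' \<otimes> g \<in> G" "h \<otimes> g \<in> G" using G_closed g h h' by auto
      have "h' \<otimes> g \<otimes> x = y \<longleftrightarrow> g \<otimes> x = z"
      proof
        assume "h' \<otimes> g \<otimes> x = y"
        then have "z = h \<otimes> h' \<otimes> g \<otimes> x" unfolding h(2) using c d by (simp add: m_assoc)
        then show "g \<otimes> x = z" using d h' by simp
      next
        assume "g \<otimes> x = z"
        then have "h' \<otimes> g \<otimes> x = h' \<otimes> h \<otimes> y" unfolding h(2) using c d by (simp add: m_assoc)
        then show "h' \<otimes> g \<otimes> x = y" using d h' by simp
      qed
      then show "(if h' \<otimes> g \<otimes> x = y then 1 else 0) = (if g \<otimes> x = z then 1 else (0::complex))" by simp
    qed
    then show ?thesis unfolding act_def entry_def sum_gsum using X0_D(1)[OF y] X0_D(1)[OF z] by simp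
  qed
  have "act gsum v y \<in> K"
    using act_span[OF gsum_A v] X0_D(1)[OF y] by (simp add: span_L_iff)
  moreover have "act gsum v = (\<lambda>x. act gsum v y * v0 x)"
    using out const by (auto simp: v0_def)
  ultimately show ?thesis by blast
qed

text \<open>
  The coefficient of \<open>\<epsilon> v0\<close> at a point \<open>y\<close> of \<open>X0\<close> counts the pairs \<open>(g, x)\<close> with \<open>g x = y\<close>; the pair
  \<open>(e, y)\<close> is among them, and the characteristic is zero.
\<close>

lemma act_gsum_v0: "\<exists>x. act gsum v0 x \<noteq> 0"
proof -
  obtain y where y: "y \<in> X0" using X0_nonempty by blast
  define N where "N x = card {g \<in> G. g \<otimes> x = y}" for x
  have N: "(\<Sum>g\<in>G. if g \<otimes> x = y then 1 else 0) = (of_nat (N x) :: complex)" for x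
    unfolding N_def using finite_G by (simp add: sum.If_cases Int_def)
  have X0: "X0 \<subseteq> L" "finite X0" using X0_D(1) finite_cell by (auto intro: finite_subset)
  have "act gsum v0 y = (\<Sum>x\<in>L. of_nat (N x) * v0 x)"
    unfolding act_def entry_def sum_gsum N using X0_D(1)[OF y] by simp
  also have "\<dots> = (\<Sum>x\<in>X0. of_nat (N x) * v0 x)"
    using X0 finite_cell by (intro sum.mono_neutral_right) (auto simp: v0_def)
  also have "\<dots> = of_nat (\<Sum>x\<in>X0. N x)" by (simp add: v0_def)
  finally have act: "act gsum v0 y = of_nat (\<Sum>x\<in>X0. N x)" .
  have "e \<in> {g \<in> G. g \<otimes> y = y}" using e_in_G X0_D(2)[OF y] by simp
  then have "0 < N y" unfolding N_def using finite_G by (intro card_gt_0_iff[THEN iffD2]) auto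
  also have "N y \<le> (\<Sum>x\<in>X0. N x)" using X0 y by (intro member_le_sum) auto
  finally have "act gsum v0 y \<noteq> 0" unfolding act of_nat_eq_0_iff by simp
  then show ?thesis by blast
qed

end

section \<open>Tensor products\<close>

text \<open>
  Three facts about \<open>T = M \<otimes>\<^sub>R N\<close> are extracted from its presentation by generators and relations: the
  calculation rules for pure tensors, the action on them, and the universal property. The free group \<open>F\<close>
  is not an \<open>A\<close>-module (only its quotient by the relations \<open>I\<close> is), so that \<open>T\<close> is treated as a
  structure whose module axioms are derived later from a surjection.
\<close>

locale bimodule_tensor = left_module A M
  for A :: "('r, 'm) ring_scheme" and M :: "('r, 'x, 'n) module_scheme" +
  fixes R :: "('s, 'k) ring_scheme" and ract :: "'x \<Rightarrow> 's \<Rightarrow> 'x" and N :: "('s, 'y, 'p) module_scheme"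
  assumes ract_closed: "\<And>m r. m \<in> carrier M \<Longrightarrow> r \<in> carrier R \<Longrightarrow> ract m r \<in> carrier M"
    and ract_smult: "\<And>a m r. a \<in> carrier A \<Longrightarrow> m \<in> carrier M \<Longrightarrow> r \<in> carrier R \<Longrightarrow>
      a \<odot>\<^bsub>M\<^esub> ract m r = ract (a \<odot>\<^bsub>M\<^esub> m) r"
    and N_add: "\<And>n n'. n \<in> carrier N \<Longrightarrow> n' \<in> carrier N \<Longrightarrow> n \<oplus>\<^bsub>N\<^esub> n' \<in> carrier N"
    and N_smult: "\<And>r n. r \<in> carrier R \<Longrightarrow> n \<in> carrier N \<Longrightarrow> r \<odot>\<^bsub>N\<^esub> n \<in> carrier N"
begin

definition "FG = free_Abelian_group (carrier M \<times> carrier N)"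
definition "F = free_module_pairs M N"
definition "Rel = tensor_relations M R ract N"
definition "I = generate FG Rel"
definition "T = tensor_product M R ract N"

lemma F_simps: "carrier F = carrier FG" "\<zero>\<^bsub>F\<^esub> = 0" "x \<oplus>\<^bsub>F\<^esub> y = x + y"
  "a \<odot>\<^bsub>F\<^esub> c = frag_extend (\<lambda>(m, n). frag_of (a \<odot>\<^bsub>M\<^esub> m, n)) c"
  by (simp_all add: F_def FG_def free_module_pairs_def)

lemma FG_iff: "c \<in> carrier FG \<longleftrightarrow> Poly_Mapping.keys c \<subseteq> carrier M \<times> carrier N"
  by (simp add: FG_def)

lemma group_FG: "group FG" by (simp add: FG_def)

lemma FG_add: "c \<in> carrier FG \<Longrightarrow> d \<in> carrier FG \<Longrightarrow> c + d \<in> carrier FG"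
  using keys_add[of c d] unfolding FG_iff by blast

lemma FG_diff: "c \<in> carrier FG \<Longrightarrow> d \<in> carrier FG \<Longrightarrow> c - d \<in> carrier FG"
  using keys_diff[of c d] unfolding FG_iff by blast

lemma frag_FG: "m \<in> carrier M \<Longrightarrow> n \<in> carrier N \<Longrightarrow> frag_of (m, n) \<in> carrier FG"
  by (simp add: FG_iff)

lemma abelian_group_F: "abelian_group F"
proof (rule abelian_groupI)
  fix c assume "c \<in> carrier F"
  then show "\<exists>d\<in>carrier F. d \<oplus>\<^bsub>F\<^esub> c = \<zero>\<^bsub>F\<^esub>"
    by (intro bexI[of _ "- c"]) (simp_all add: F_simps FG_iff)
qed (simp_all add: F_simps FG_add FG_iff[of 0] add_ac)

lemma a_inv_F: "c \<in> carrier FG \<Longrightarrow> \<ominus>\<^bsub>F\<^esub> c = - c"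
proof -
  interpret F: abelian_group F by (rule abelian_group_F)
  show "c \<in> carrier FG \<Longrightarrow> \<ominus>\<^bsub>F\<^esub> c = - c"
    by (rule F.minus_equality) (simp_all add: F_simps FG_iff)
qed

lemma T_eq: "T = quotient_module F I"
  by (simp add: T_def tensor_product_def F_def I_def FG_def Rel_def)

lemma Rel_FG: "Rel \<subseteq> carrier FG"
  unfolding Rel_def tensor_relations_def
  by (auto intro!: FG_diff frag_FG simp: ract_closed N_add N_smult)

lemma subgroup_I: "subgroup I FG"
  unfolding I_def by (rule group.generate_is_subgroup[OF group_FG Rel_FG])

lemma I_sub: "I \<subseteq> carrier FG" using subgroup_I by (rule subgroup.subset)

lemma I_closed: "0 \<in> I" "c \<in> I \<Longrightarrow> d \<in> I \<Longrightarrow> c + d \<in> I" "c \<in> I \<Longrightarrow> - c \<in> I"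
  "c \<in> I \<Longrightarrow> d \<in> I \<Longrightarrow> c - d \<in> I"
proof -
  show z: "0 \<in> I" using subgroup.one_closed[OF subgroup_I] by (simp add: FG_def)
  show add: "c + d \<in> I" if "c \<in> I" "d \<in> I" for c d
    using subgroup.m_closed[OF subgroup_I that] by (simp add: FG_def)
  show minus: "- c \<in> I" if "c \<in> I" for c
  proof -
    have "Poly_Mapping.keys c \<subseteq> carrier M \<times> carrier N" using I_sub that FG_iff by blast
    then have "inv\<^bsub>FG\<^esub> c = - c" by (simp add: FG_def)
    then show ?thesis using subgroup.m_inv_closed[OF subgroup_I that] by simp
  qed
  show "c - d \<in> I" if "c \<in> I" "d \<in> I" using add[OF that(1) minus[OF that(2)]] by simp
qed

lemma Rel_I: "c \<in> Rel \<Longrightarrow> c \<in> I" unfolding I_def by (rule generate.incl)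

sublocale I: abelian_subgroup I F
proof (rule abelian_subgroupI3)
  have "inv\<^bsub>add_monoid F\<^esub> c = - c" if "c \<in> I" for c
    using a_inv_F[of c] I_sub that by (auto simp: a_inv_def)
  then show "additive_subgroup I F"
    using I_sub I_closed by (intro additive_subgroup.intro subgroup.intro) (auto simp: F_simps)
qed (rule abelian_group_F)

lemma rcos_I_eq: "c \<in> carrier FG \<Longrightarrow> d \<in> carrier FG \<Longrightarrow> I +>\<^bsub>F\<^esub> c = I +>\<^bsub>F\<^esub> d \<longleftrightarrow> c - d \<in> I"
proof -
  assume c: "c \<in> carrier FG" and d: "d \<in> carrier FG"
  have iff: "c' \<in> I +>\<^bsub>F\<^esub> d' \<longleftrightarrow> c' - d' \<in> I" for c' d'
  proof
    assume "c' \<in> I +>\<^bsub>F\<^esub> d'"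
    then obtain h where "h \<in> I" "c' = h + d'" by (auto simp: a_r_coset_def' F_simps)
    then show "c' - d' \<in> I" by simp
  next
    assume "c' - d' \<in> I"
    then show "c' \<in> I +>\<^bsub>F\<^esub> d'" by (auto simp: a_r_coset_def' F_simps intro!: bexI[of _ "c' - d'"])
  qed
  show ?thesis
  proof
    assume "I +>\<^bsub>F\<^esub> c = I +>\<^bsub>F\<^esub> d"
    then show "c - d \<in> I" using iff[of c c] I_closed(1) iff[of c d] by simp
  next
    assume "c - d \<in> I"
    then show "I +>\<^bsub>F\<^esub> c = I +>\<^bsub>F\<^esub> d" using I.a_repr_independence'[of c d] iff d by (simp add: F_simps)
  qed
qed

lemma rcos_I_zero: "I +>\<^bsub>F\<^esub> 0 = I"
  by (simp add: a_r_coset_def' F_simps)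

definition tens :: "'x \<Rightarrow> 'y \<Rightarrow> ('x \<times> 'y \<Rightarrow>\<^sub>0 int) set" where
  "tens m n = I +>\<^bsub>F\<^esub> frag_of (m, n)"

lemma rcos_add: "c \<in> carrier FG \<Longrightarrow> d \<in> carrier FG \<Longrightarrow>
  (I +>\<^bsub>F\<^esub> c) \<oplus>\<^bsub>T\<^esub> (I +>\<^bsub>F\<^esub> d) = I +>\<^bsub>F\<^esub> (c + d)"
  using I.a_rcos_sum[of c d] by (simp add: T_eq F_simps)

lemma tens_add:
  assumes "m \<in> carrier M" "m' \<in> carrier M" "n \<in> carrier N"
  shows "tens (m \<oplus>\<^bsub>M\<^esub> m') n = tens m n \<oplus>\<^bsub>T\<^esub> tens m' n"
    "frag_of (m \<oplus>\<^bsub>M\<^esub> m', n) - frag_of (m, n) - frag_of (m', n) \<in> I"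
proof -
  show *: "frag_of (m \<oplus>\<^bsub>M\<^esub> m', n) - frag_of (m, n) - frag_of (m', n) \<in> I"
    by (rule Rel_I) (use assms in \<open>auto simp: Rel_def tensor_relations_def\<close>)
  then show "tens (m \<oplus>\<^bsub>M\<^esub> m') n = tens m n \<oplus>\<^bsub>T\<^esub> tens m' n"
    unfolding tens_def using assms by (simp add: rcos_add frag_FG rcos_I_eq FG_add diff_diff_eq)
qed

lemma tens_ract:
  assumes "m \<in> carrier M" "r \<in> carrier R" "n \<in> carrier N"
  shows "tens (ract m r) n = tens m (r \<odot>\<^bsub>N\<^esub> n)"
proof -
  have "frag_of (ract m r, n) - frag_of (m, r \<odot>\<^bsub>N\<^esub> n) \<in> I"
    by (rule Rel_I) (use assms in \<open>auto simp: Rel_def tensor_relations_def\<close>)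
  then show ?thesis unfolding tens_def using assms by (simp add: frag_FG rcos_I_eq ract_closed N_smult)
qed

lemma smult_F_FG: "a \<in> carrier A \<Longrightarrow> c \<in> carrier FG \<Longrightarrow> a \<odot>\<^bsub>F\<^esub> c \<in> carrier FG"
proof -
  assume a: "a \<in> carrier A" and c: "c \<in> carrier FG"
  have "Poly_Mapping.keys c \<subseteq> carrier M \<times> carrier N" using c FG_iff by blast
  then show ?thesis
  proof (rule free_Abelian_group_induct[where P = "\<lambda>c. a \<odot>\<^bsub>F\<^esub> c \<in> carrier FG"])
    show "a \<odot>\<^bsub>F\<^esub> frag_of p \<in> carrier FG" if "p \<in> carrier M \<times> carrier N" for p
      using a that by (cases p) (simp add: F_simps(4) frag_FG smult_closed)
  qed (simp_all add: F_simps(4) frag_extend_diff FG_diff FG_iff[of 0])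
qed

text \<open>
  The operators respect the relations generator by generator, which makes the action on cosets
  computable on representatives.
\<close>

lemma smult_F_I:
  assumes a: "a \<in> carrier A" and c: "c \<in> I"
  shows "a \<odot>\<^bsub>F\<^esub> c \<in> I"
  using c unfolding I_def
proof (induction rule: generate.induct)
  case one
  then show ?case using I_closed(1) by (simp add: F_simps(4) FG_def I_def)
next
  case (incl c)
  have "a \<odot>\<^bsub>F\<^esub> c \<in> Rel"
    using incl a unfolding Rel_def tensor_relations_def
    by (auto simp: F_simps(4) frag_extend_diff smult_r_distr ract_smult smult_closed)
      (metis smult_closed)+
  then show ?case using Rel_I by (simp add: I_def)
next
  case (inv c)
  have "a \<odot>\<^bsub>F\<^esub> c \<in> Rel"
    using inv a unfolding Rel_def tensor_relations_def
    by (auto simp: F_simps(4) frag_extend_diff smult_r_distr ract_smult smult_closed)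
      (metis smult_closed)+
  moreover have "inv\<^bsub>FG\<^esub> c = - c" using inv Rel_FG FG_iff by (auto simp: FG_def)
  ultimately show ?case using Rel_I I_closed(3) by (simp add: I_def F_simps(4) frag_extend_minus)
next
  case (eng c d)
  then show ?case using I_closed(2) by (simp add: I_def F_simps(4) frag_extend_add FG_def)
qed

lemma smult_tens:
  assumes a: "a \<in> carrier A" and m: "m \<in> carrier M" and n: "n \<in> carrier N"
  shows "a \<odot>\<^bsub>T\<^esub> tens m n = tens (a \<odot>\<^bsub>M\<^esub> m) n"
proof -
  have "coset_map F I (module.smult F a) (I +>\<^bsub>F\<^esub> frag_of (m, n)) = I +>\<^bsub>F\<^esub> (a \<odot>\<^bsub>F\<^esub> frag_of (m, n))"
  proof (rule coset_map_rcos[OF abelian_group_F I.additive_subgroup_axioms])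
    show "module.smult F a \<in> carrier F \<rightarrow> carrier F" using smult_F_FG[OF a] by (auto simp: F_simps(1))
    show "a \<odot>\<^bsub>F\<^esub> (c \<oplus>\<^bsub>F\<^esub> d) = a \<odot>\<^bsub>F\<^esub> c \<oplus>\<^bsub>F\<^esub> a \<odot>\<^bsub>F\<^esub> d" for c d
      by (simp add: F_simps(3,4) frag_extend_add)
    show "frag_of (m, n) \<in> carrier F" using m n by (simp add: F_simps(1) frag_FG)
  qed (rule smult_F_I[OF a])
  moreover have "a \<odot>\<^bsub>F\<^esub> frag_of (m, n) = frag_of (a \<odot>\<^bsub>M\<^esub> m, n)" by (simp add: F_simps(4))
  ultimately show ?thesis by (simp add: T_eq tens_def)
qed

lemma T_simps: "\<zero>\<^bsub>T\<^esub> = I" "carrier T = (\<lambda>c. I +>\<^bsub>F\<^esub> c) ` carrier FG"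
  by (auto simp: T_eq A_RCOSETS_def' F_simps)

text \<open>
  The universal property in the form in which it is used to construct maps: a balanced biadditive
  \<open>\<beta>\<close> extends to the free group, its extension kills the relations, and so \<open>\<beta> m n\<close> vanishes
  whenever the pure tensor does.
\<close>

lemma tens_zero_imp:
  assumes Z: "abelian_group Z"
    and b: "\<And>m n. m \<in> carrier M \<Longrightarrow> n \<in> carrier N \<Longrightarrow> \<beta> m n \<in> carrier Z"
    and add1: "\<And>m m' n. m \<in> carrier M \<Longrightarrow> m' \<in> carrier M \<Longrightarrow> n \<in> carrier N \<Longrightarrow>
      \<beta> (m \<oplus>\<^bsub>M\<^esub> m') n = \<beta> m n \<oplus>\<^bsub>Z\<^esub> \<beta> m' n"
    and add2: "\<And>m n n'. m \<in> carrier M \<Longrightarrow> n \<in> carrier N \<Longrightarrow> n' \<in> carrier N \<Longrightarrow>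
      \<beta> m (n \<oplus>\<^bsub>N\<^esub> n') = \<beta> m n \<oplus>\<^bsub>Z\<^esub> \<beta> m n'"
    and bal: "\<And>m r n. m \<in> carrier M \<Longrightarrow> r \<in> carrier R \<Longrightarrow> n \<in> carrier N \<Longrightarrow>
      \<beta> (ract m r) n = \<beta> m (r \<odot>\<^bsub>N\<^esub> n)"
    and m: "m \<in> carrier M" and n: "n \<in> carrier N" and zero: "tens m n = \<zero>\<^bsub>T\<^esub>"
  shows "\<beta> m n = \<zero>\<^bsub>Z\<^esub>"
proof -
  interpret Z: abelian_group Z by fact
  obtain h where h: "h \<in> hom FG (add_monoid Z)"
    "\<And>p. p \<in> carrier M \<times> carrier N \<Longrightarrow> h (frag_of p) = \<beta> (fst p) (snd p)"
  proof -
    have "(\<lambda>p. \<beta> (fst p) (snd p)) ` (carrier M \<times> carrier N) \<subseteq> carrier (add_monoid Z)" using b by auto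
    from comm_group.free_Abelian_group_universal[OF Z.a_comm_group this] show thesis
      using that unfolding FG_def by blast
  qed
  interpret h: group_hom FG "add_monoid Z" h
    by (intro group_hom.intro group_FG Z.a_group group_hom_axioms.intro h(1))
  have hc: "h c \<in> carrier Z" if "c \<in> carrier FG" for c using h.hom_closed[OF that] by simp
  have hd: "h (c - d) = h c \<ominus>\<^bsub>Z\<^esub> h d" if cd: "c \<in> carrier FG" "d \<in> carrier FG" for c d
  proof -
    have "h ((c - d) + d) = h (c - d) \<oplus>\<^bsub>Z\<^esub> h d"
      using h.hom_mult[OF FG_diff[OF cd] cd(2)] by (simp add: FG_def)
    then have "h c = h (c - d) \<oplus>\<^bsub>Z\<^esub> h d" by simp
    then show ?thesis using hc[OF cd(2)] hc[OF FG_diff[OF cd]]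
      by (simp add: a_minus_def Z.a_assoc Z.r_neg)
  qed
  have "Rel \<subseteq> kernel FG (add_monoid Z) h"
  proof
    fix c assume c: "c \<in> Rel"
    then have cF: "c \<in> carrier FG" using Rel_FG by blast
    have hf: "h (frag_of (m, n)) = \<beta> m n" if "m \<in> carrier M" "n \<in> carrier N" for m n
      using h(2)[of "(m, n)"] that by simp
    from c consider (left) m m' n where "m \<in> carrier M" "m' \<in> carrier M" "n \<in> carrier N"
        "c = frag_of (m \<oplus>\<^bsub>M\<^esub> m', n) - frag_of (m, n) - frag_of (m', n)"
      | (right) m n n' where "m \<in> carrier M" "n \<in> carrier N" "n' \<in> carrier N"
        "c = frag_of (m, n \<oplus>\<^bsub>N\<^esub> n') - frag_of (m, n) - frag_of (m, n')"
      | (balanced) m r n where "m \<in> carrier M" "r \<in> carrier R" "n \<in> carrier N"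
        "c = frag_of (ract m r, n) - frag_of (m, r \<odot>\<^bsub>N\<^esub> n)"
      unfolding Rel_def tensor_relations_def by blast
    then have "h c = \<zero>\<^bsub>Z\<^esub>"
    proof cases
      case left
      have "(\<beta> m n \<oplus>\<^bsub>Z\<^esub> \<beta> m' n) \<ominus>\<^bsub>Z\<^esub> \<beta> m n \<ominus>\<^bsub>Z\<^esub> \<beta> m' n = \<zero>\<^bsub>Z\<^esub>"
        using b[OF left(1,3)] b[OF left(2,3)] by (simp add: a_minus_def Z.a_ac Z.r_neg Z.r_neg1)
      then show ?thesis using left by (simp add: hd hf frag_FG FG_diff add1)
    next
      case right
      have "(\<beta> m n \<oplus>\<^bsub>Z\<^esub> \<beta> m n') \<ominus>\<^bsub>Z\<^esub> \<beta> m n \<ominus>\<^bsub>Z\<^esub> \<beta> m n' = \<zero>\<^bsub>Z\<^esub>"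
        using b[OF right(1,2)] b[OF right(1,3)] by (simp add: a_minus_def Z.a_ac Z.r_neg Z.r_neg1)
      then show ?thesis using right by (simp add: hd hf frag_FG FG_diff add2 N_add)
    next
      case balanced
      then show ?thesis by (simp add: hd hf frag_FG bal ract_closed N_smult b)
    qed
    then show "c \<in> kernel FG (add_monoid Z) h" using cF by (simp add: kernel_def)
  qed
  then have "I \<subseteq> kernel FG (add_monoid Z) h"
    unfolding I_def by (intro group.generate_subgroup_incl[OF group_FG] h.subgroup_kernel)
  moreover have "frag_of (m, n) \<in> I"
    using zero rcos_I_eq[OF frag_FG[OF m n], of 0] by (simp add: tens_def T_simps(1) rcos_I_zero FG_iff)
  ultimately show ?thesis using h(2) m n by (auto simp: kernel_def)
qed

end

section \<open>The standard module of the trivial representation\<close>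

context finite_monoid_algebra
begin

lemma mult_scalar:
  assumes "g \<in> carrier A"
  shows "g \<otimes>\<^bsub>A\<^esub> (\<lambda>t. k * delta \<one> t) = (\<lambda>t. k * g t)"
proof
  fix u
  have "(\<Sum>t\<in>carrier S. if t \<otimes> \<one> = u then g t else 0) = (\<Sum>t\<in>carrier S. if t = u then g t else 0)"
    by (intro sum.cong) auto
  also have "\<dots> = g u" using assms finite_S by (auto simp: A_simps)
  finally show "(g \<otimes>\<^bsub>A\<^esub> (\<lambda>t. k * delta \<one> t)) u = k * g u" by (simp add: mult_scaled_delta)
qed

lemma A_mult_nonzero:
  assumes "(f \<otimes>\<^bsub>A\<^esub> g) u \<noteq> 0"
  shows "\<exists>s\<in>carrier S. \<exists>t\<in>carrier S. f s \<noteq> 0 \<and> g t \<noteq> 0 \<and> u = s \<otimes> t"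
proof (rule ccontr)
  assume "\<not> ?thesis"
  then have "(f \<otimes>\<^bsub>A\<^esub> g) u = 0" unfolding A_mult by (intro sum.neutral ballI) auto
  with assms show False by simp
qed

end

sublocale apex_cell \<subseteq> Le: left_cell S K "left_cell_of S e"
  by unfold_locales (simp add: left_cell_of_def left_cells_def quotientI e)

context apex_cell
begin

lemma e_Le: "e \<in> left_cell_of S e"
  using e left_le_refl by (simp add: left_cell_of_def left_equiv_def)

lemma Le_C_iff: "y \<in> Le.C \<longleftrightarrow> y \<in> carrier S \<and> y \<otimes> e = y"
proof -
  have "left_le S e y \<longleftrightarrow> y \<otimes> e = y" if "y \<in> carrier S"
    using e that unfolding left_le_def by (metis m_assoc)
  then show ?thesis using Le.closure_iff[OF e_Le] by blast
qed

lemma Le_U_D: "u \<in> carrier Le.U \<Longrightarrow> u \<in> carrier A" "u \<in> carrier Le.U \<Longrightarrow> u s \<noteq> 0 \<Longrightarrow> s \<in> Le.C"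
  by (auto simp: Le.U_simps basis_span_def)

lemma Le_U_I: "u \<in> carrier A \<Longrightarrow> (\<And>s. u s \<noteq> 0 \<Longrightarrow> s \<in> Le.C) \<Longrightarrow> u \<in> carrier Le.U"
  by (auto simp: Le.U_simps basis_span_def)

lemma Le_W_iff: "u \<in> Le.W \<longleftrightarrow> u \<in> carrier A \<and> (\<forall>s. u s \<noteq> 0 \<longrightarrow> s \<in> Le.C \<and> s \<notin> left_cell_of S e)"
  by (auto simp: Le.W_eq basis_span_def)

text \<open>
  The closure of the left cell of \<open>e\<close> is the left ideal \<open>Se\<close>. An element of it that acts on \<open>L\<close> is a two-sided divisor of \<open>e\<close>; by stability it is
  left-equivalent to \<open>e\<close>.
\<close>

lemma lower_annihilates:
  assumes s: "s \<in> Le.C" "s \<notin> left_cell_of S e" and x: "x \<in> L"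
  shows "s \<otimes> x \<notin> L"
proof
  assume sx: "s \<otimes> x \<in> L"
  have sS: "s \<in> carrier S" "s \<otimes> e = s" using s Le_C_iff by auto
  obtain u v where "u \<in> carrier S" "v \<in> carrier S" "e = u \<otimes> s \<otimes> v" using apex[OF sS(1) x sx] by blast
  then obtain w where w: "w \<in> carrier S" "e = w \<otimes> s" using left_stability[OF e sS] by blast
  have "left_le S e s" "left_le S s e" unfolding left_le_def using w sS(1) sS(2)[symmetric] by blast+
  then show False using Le.cellI[OF e_Le sS(1)] s by blast
qed

abbreviation "KG \<equiv> semigroup_algebra K (maximal_subgroup S e)"
abbreviation "triv \<equiv> trivial_module K (maximal_subgroup S e)"
abbreviation "ract \<equiv> cell_right_action K S (left_cell_of S e)"

lemma KG_iff: "p \<in> carrier KG \<longleftrightarrow> (\<forall>g. p g \<in> K) \<and> (\<forall>s. s \<notin> G \<longrightarrow> p s = 0)"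
  using K_closed(1) by (auto simp: semigroup_algebra_def)

lemma KG_A: "p \<in> carrier KG \<Longrightarrow> p \<in> carrier A"
  using G_D(1) by (auto simp: KG_iff A_simps)

lemma G_Le: "g \<in> G \<Longrightarrow> g \<in> Le.C" using G_D by (simp add: Le_C_iff)

lemma mult_KG_U: "u \<in> carrier Le.U \<Longrightarrow> p \<in> carrier KG \<Longrightarrow> u \<otimes>\<^bsub>A\<^esub> p \<in> carrier Le.U"
proof (rule Le_U_I)
  assume u: "u \<in> carrier Le.U" and p: "p \<in> carrier KG"
  show "u \<otimes>\<^bsub>A\<^esub> p \<in> carrier A" using A_mult_closed Le_U_D(1)[OF u] KG_A[OF p] by blast
  fix t assume "(u \<otimes>\<^bsub>A\<^esub> p) t \<noteq> 0"
  then obtain s g where sg: "s \<in> carrier S" "p g \<noteq> 0" "t = s \<otimes> g" using A_mult_nonzero by blast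
  then have g: "g \<in> G" using p KG_iff by blast
  show "t \<in> Le.C" using sg(1,3) G_D[OF g] e by (simp add: Le_C_iff m_assoc)
qed

text \<open>
  Right multiplication by \<open>g\<close> is a bijection of \<open>Se\<close> whose inverse is right multiplication by \<open>h\<close>.
  If \<open>s g\<close> is left-equivalent to \<open>e\<close>, say \<open>w s g = e\<close>, then \<open>w s = h\<close> and \<open>g w s = e\<close>, so that \<open>s\<close> itself is
  left-equivalent to \<open>e\<close>.
\<close>

lemma mult_KG_W: "u \<in> Le.W \<Longrightarrow> p \<in> carrier KG \<Longrightarrow> u \<otimes>\<^bsub>A\<^esub> p \<in> Le.W"
proof -
  assume u: "u \<in> Le.W" and p: "p \<in> carrier KG"
  have uU: "u \<in> carrier Le.U" using u Le.U.submoduleD(1)[OF Le.W_submodule] by blast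
  have "t \<notin> left_cell_of S e" if t: "(u \<otimes>\<^bsub>A\<^esub> p) t \<noteq> 0" for t
  proof
    assume tL: "t \<in> left_cell_of S e"
    obtain s g where sg: "s \<in> carrier S" "u s \<noteq> 0" "p g \<noteq> 0" "t = s \<otimes> g" using A_mult_nonzero[OF t] by blast
    then have g: "g \<in> G" using p KG_iff by blast
    have s: "s \<in> Le.C" "s \<notin> left_cell_of S e" using u sg(2) Le_W_iff by auto
    obtain h where h: "h \<in> G" "g \<otimes> h = e" using G_inverse[OF g] by blast
    note c = G_D[OF g] G_D[OF h(1)]
    obtain w where w: "w \<in> carrier S" "e = w \<otimes> t" using Le.cell_le[OF tL e_Le] unfolding left_le_def by blast
    have "w \<otimes> t \<otimes> h = w \<otimes> (s \<otimes> (g \<otimes> h))" using w(1) sg(1) c unfolding sg(4) by (simp add: m_assoc)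
    then have "e \<otimes> h = w \<otimes> (s \<otimes> e)" unfolding w(2)[symmetric] h(2) .
    then have hw: "h = w \<otimes> s" using c(5) s(1) Le_C_iff by simp
    have "g \<otimes> w \<otimes> s = g \<otimes> (w \<otimes> s)" using c w(1) sg(1) by (simp add: m_assoc)
    then have "g \<otimes> w \<otimes> s = e" using hw h(2) by simp
    then have "left_le S s e" unfolding left_le_def using c(1) w(1) by (metis m_closed)
    moreover have "left_le S e s" unfolding left_le_def using s(1)[unfolded Le_C_iff] sg(1) by force
    ultimately show False using Le.cellI[OF e_Le sg(1)] s by blast
  qed
  then show ?thesis
    unfolding Le_W_iff using Le_U_D[OF mult_KG_U[OF uU p]] by blast
qed

lemma ract_iota: "u \<in> carrier Le.U \<Longrightarrow> p \<in> carrier KG \<Longrightarrow> ract (Le.\<iota> u) p = Le.\<iota> (u \<otimes>\<^bsub>A\<^esub> p)"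
  unfolding cell_right_action_def Le.\<iota>_def
proof (rule coset_map_rcos)
  assume p: "p \<in> carrier KG"
  show "abelian_group Le.U" by (rule Le.U.M.abelian_group_axioms)
  show "additive_subgroup Le.W Le.U" by (rule Le.U.submoduleD(6)[OF Le.W_submodule])
  show "(\<lambda>x. x \<otimes>\<^bsub>A\<^esub> p) \<in> carrier Le.U \<rightarrow> carrier Le.U" using mult_KG_U p by blast
  show "(x \<oplus>\<^bsub>Le.U\<^esub> y) \<otimes>\<^bsub>A\<^esub> p = x \<otimes>\<^bsub>A\<^esub> p \<oplus>\<^bsub>Le.U\<^esub> y \<otimes>\<^bsub>A\<^esub> p"
    if "x \<in> carrier Le.U" "y \<in> carrier Le.U" for x y
    using that Le_U_D(1) KG_A[OF p] by (simp add: Le.U_simps(2) A.l_distr)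
  show "x \<otimes>\<^bsub>A\<^esub> p \<in> Le.W" if "x \<in> Le.W" for x using mult_KG_W that p by blast
qed

lemma Le_iota_ex: "m \<in> carrier Le.M \<Longrightarrow> \<exists>u\<in>carrier Le.U. m = Le.\<iota> u"
  using Le.iota_surj by auto

lemma Le_iota_M: "u \<in> carrier Le.U \<Longrightarrow> Le.\<iota> u \<in> carrier Le.M"
  using Le.iota_surj by auto

lemma triv_simps: "carrier triv = K" "k \<oplus>\<^bsub>triv\<^esub> l = k + l" "p \<odot>\<^bsub>triv\<^esub> k = (\<Sum>g\<in>G. p g) * k"
  by (simp_all add: trivial_module_def)

lemma sum_KG: "p \<in> carrier KG \<Longrightarrow> (\<Sum>g\<in>G. p g) \<in> K"
  by (intro subfield_complex_sum[OF subfield_K]) (simp add: KG_iff)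

sublocale D: bimodule_tensor A Le.M KG ract triv
proof unfold_locales
  fix m p assume m: "m \<in> carrier Le.M" and p: "p \<in> carrier KG"
  obtain u where u: "u \<in> carrier Le.U" "m = Le.\<iota> u" using Le_iota_ex[OF m] by blast
  show "ract m p \<in> carrier Le.M" using u p by (simp add: ract_iota Le_iota_M mult_KG_U)
  show "a \<odot>\<^bsub>Le.M\<^esub> ract m p = ract (a \<odot>\<^bsub>Le.M\<^esub> m) p" if a: "a \<in> carrier A" for a
  proof -
    have "a \<odot>\<^bsub>Le.M\<^esub> Le.\<iota> x = Le.\<iota> (a \<otimes>\<^bsub>A\<^esub> x)" if "x \<in> carrier Le.U" for x
      using module_hom_smult[OF Le.iota_hom a that] by (simp add: Le.U_simps)
    moreover have "a \<otimes>\<^bsub>A\<^esub> u \<in> carrier Le.U" using Le.U.smult_closed[OF a u(1)] by (simp add: Le.U_simps)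
    ultimately show ?thesis using u p a
      by (simp add: ract_iota mult_KG_U A_mult_assoc)
  qed
next
  fix k l p assume kl: "k \<in> carrier triv"
  show "l \<in> carrier triv \<Longrightarrow> k \<oplus>\<^bsub>triv\<^esub> l \<in> carrier triv" using kl K_closed(3) by (simp add: triv_simps)
  show "p \<in> carrier KG \<Longrightarrow> p \<odot>\<^bsub>triv\<^esub> k \<in> carrier triv"
    using kl K_closed(4) sum_KG by (simp add: triv_simps)
qed

abbreviation "\<Delta> \<equiv> standard_module K S e triv"

lemma D_T: "D.T = \<Delta>" by (simp add: D.T_def standard_module_def)

text \<open>
  The element \<open>u \<otimes> 1\<close>. As a function on the left ideal spanned by \<open>Se\<close>, this map presents the standard
  module as a quotient of a left ideal, and homomorphisms out of it can be defined on that ideal.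
\<close>

definition "Tm u = D.tens (Le.\<iota> u) 1"

lemma Tm_hom: "Tm \<in> module_hom A Le.U \<Delta>"
  unfolding module_hom_def
proof (intro CollectI conjI allI impI)
  show "Tm \<in> carrier Le.U \<rightarrow> carrier \<Delta>"
    using Le_iota_M K_closed(2) unfolding Tm_def D.tens_def D_T[symmetric] D.T_simps
    by (auto intro!: imageI D.frag_FG simp: triv_simps)
  show "Tm (x \<oplus>\<^bsub>Le.U\<^esub> y) = Tm x \<oplus>\<^bsub>\<Delta>\<^esub> Tm y" if "x \<in> carrier Le.U \<and> y \<in> carrier Le.U" for x y
    using that D.tens_add(1)[of "Le.\<iota> x" "Le.\<iota> y" 1] K_closed(2) Le_iota_M
      module_hom_add[OF Le.iota_hom, of x y]
    by (simp add: Tm_def D_T triv_simps)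
  show "Tm (a \<odot>\<^bsub>Le.U\<^esub> x) = a \<odot>\<^bsub>\<Delta>\<^esub> Tm x" if "a \<in> carrier A \<and> x \<in> carrier Le.U" for a x
    using that D.smult_tens[of a "Le.\<iota> x" 1] K_closed(2) Le_iota_M
      module_hom_smult[OF Le.iota_hom, of a x]
    by (simp add: Tm_def D_T triv_simps)
qed

lemma Tm_diff_I:
  assumes "x \<in> carrier Le.U" "y \<in> carrier Le.U"
  shows "frag_of (Le.\<iota> (x \<ominus>\<^bsub>Le.U\<^esub> y), 1) - (frag_of (Le.\<iota> x, 1) - frag_of (Le.\<iota> y, 1)) \<in> D.I"
proof -
  have d: "x \<ominus>\<^bsub>Le.U\<^esub> y \<in> carrier Le.U" using assms by simp
  have "(x \<ominus>\<^bsub>Le.U\<^esub> y) \<oplus>\<^bsub>Le.U\<^esub> y = x" using assms by (simp add: a_minus_def Le.U.M.a_assoc Le.U.M.l_neg)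
  then have "Le.\<iota> (x \<ominus>\<^bsub>Le.U\<^esub> y) \<oplus>\<^bsub>Le.M\<^esub> Le.\<iota> y = Le.\<iota> x"
    using module_hom_add[OF Le.iota_hom d assms(2)] by simp
  then have "frag_of (Le.\<iota> x, 1) - frag_of (Le.\<iota> (x \<ominus>\<^bsub>Le.U\<^esub> y), 1) - frag_of (Le.\<iota> y, 1) \<in> D.I"
    using D.tens_add(2)[OF Le_iota_M[OF d] Le_iota_M[OF assms(2)], of 1] K_closed(2) by (simp add: triv_simps)
  from D.I_closed(3)[OF this] show ?thesis by (simp add: algebra_simps)
qed

text \<open>
  The module axioms for the standard module are derived from this equation, which is therefore checked
  in the free abelian group.
\<close>

lemma Tm_zero: "Tm \<zero>\<^bsub>Le.U\<^esub> = \<zero>\<^bsub>\<Delta>\<^esub>"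
proof -
  have "frag_of (Le.\<iota> \<zero>\<^bsub>Le.U\<^esub>, 1) \<in> D.I"
    using Tm_diff_I[OF Le.U.M.zero_closed Le.U.M.zero_closed] by (simp add: a_minus_def Le.U.M.r_neg)
  moreover have "frag_of (Le.\<iota> \<zero>\<^bsub>Le.U\<^esub>, 1) \<in> carrier D.FG"
    using calculation D.I_sub by blast
  ultimately show ?thesis
    using D.rcos_I_eq[of "frag_of (Le.\<iota> \<zero>\<^bsub>Le.U\<^esub>, 1)" 0]
    by (simp add: Tm_def D.tens_def D_T[symmetric] D.T_simps(1) D.rcos_I_zero D.FG_iff[of 0])
qed

text \<open>
  Since the second factor is one-dimensional, \<open>u \<otimes> k = u (k e) \<otimes> 1\<close>, and a formal difference of
  generators is represented by the difference of representatives.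
\<close>

lemma Tm_surj: "Tm ` carrier Le.U = carrier \<Delta>"
proof
  show "Tm ` carrier Le.U \<subseteq> carrier \<Delta>" using module_hom_closed[OF Tm_hom] by auto
  have fr: "frag_of (Le.\<iota> u, 1) \<in> carrier D.FG" if "u \<in> carrier Le.U" for u
    using that Le_iota_M K_closed(2) by (intro D.frag_FG) (auto simp: triv_simps)
  have ex: "\<exists>u\<in>carrier Le.U. c - frag_of (Le.\<iota> u, 1) \<in> D.I" if "Poly_Mapping.keys c \<subseteq> carrier Le.M \<times> carrier triv" for c
    using that
  proof (rule free_Abelian_group_induct)
    have "frag_of (Le.\<iota> \<zero>\<^bsub>Le.U\<^esub>, 1) \<in> D.I"
      using Tm_diff_I[OF Le.U.M.zero_closed Le.U.M.zero_closed] by (simp add: a_minus_def Le.U.M.r_neg)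
    then show "\<exists>u\<in>carrier Le.U. 0 - frag_of (Le.\<iota> u, 1) \<in> D.I"
      using D.I_closed(1,4) Le.U.M.zero_closed by blast
  next
    fix x y assume "\<exists>u\<in>carrier Le.U. x - frag_of (Le.\<iota> u, 1) \<in> D.I" "\<exists>u\<in>carrier Le.U. y - frag_of (Le.\<iota> u, 1) \<in> D.I"
    then obtain u v where u: "u \<in> carrier Le.U" "x - frag_of (Le.\<iota> u, 1) \<in> D.I"
      and v: "v \<in> carrier Le.U" "y - frag_of (Le.\<iota> v, 1) \<in> D.I" by blast
    have "(x - frag_of (Le.\<iota> u, 1)) - (y - frag_of (Le.\<iota> v, 1)) -
      (frag_of (Le.\<iota> (u \<ominus>\<^bsub>Le.U\<^esub> v), 1) - (frag_of (Le.\<iota> u, 1) - frag_of (Le.\<iota> v, 1))) \<in> D.I"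
      by (intro D.I_closed(4) u v Tm_diff_I)
    then have "x - y - frag_of (Le.\<iota> (u \<ominus>\<^bsub>Le.U\<^esub> v), 1) \<in> D.I" by (simp add: algebra_simps)
    then show "\<exists>u\<in>carrier Le.U. x - y - frag_of (Le.\<iota> u, 1) \<in> D.I" using u v by (meson Le.U.M.minus_closed)
  next
    fix p assume "p \<in> carrier Le.M \<times> carrier triv"
    then obtain m k where mk: "p = (m, k)" "m \<in> carrier Le.M" "k \<in> K" by (auto simp: triv_simps)
    obtain u where "u \<in> carrier Le.U" "m = Le.\<iota> u" using Le_iota_ex[OF mk(2)] by blast
    with mk have p: "p = (Le.\<iota> u, k)" "u \<in> carrier Le.U" "k \<in> K" by simp_all
    have ke: "(\<lambda>t. k * delta e t) \<in> carrier KG"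
      using p(3) e_in_G K_closed(1,2,4) by (auto simp: KG_iff delta_def)
    have "D.tens (ract (Le.\<iota> u) (\<lambda>t. k * delta e t)) 1 = D.tens (Le.\<iota> u) ((\<lambda>t. k * delta e t) \<odot>\<^bsub>triv\<^esub> 1)"
      using p Le_iota_M ke K_closed(2) by (intro D.tens_ract) (auto simp: triv_simps)
    also have "(\<lambda>t. k * delta e t) \<odot>\<^bsub>triv\<^esub> 1 = k"
      using e_in_G finite_G by (simp add: triv_simps delta_def if_distrib cong: if_cong)
    finally have "D.tens (Le.\<iota> u) k = D.tens (Le.\<iota> (u \<otimes>\<^bsub>A\<^esub> (\<lambda>t. k * delta e t))) 1"
      using ract_iota[OF p(2) ke] by simp
    then have "frag_of p - frag_of (Le.\<iota> (u \<otimes>\<^bsub>A\<^esub> (\<lambda>t. k * delta e t)), 1) \<in> D.I"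
      unfolding D.tens_def using D.rcos_I_eq D.frag_FG[OF Le_iota_M[OF p(2)], of k] fr[OF mult_KG_U[OF p(2) ke]] p
      by (simp add: triv_simps)
    then show "\<exists>u\<in>carrier Le.U. frag_of p - frag_of (Le.\<iota> u, 1) \<in> D.I" using mult_KG_U[OF p(2) ke] by blast
  qed
  show "carrier \<Delta> \<subseteq> Tm ` carrier Le.U"
  proof
    fix y assume "y \<in> carrier \<Delta>"
    then obtain c where c: "c \<in> carrier D.FG" "y = D.I +>\<^bsub>D.F\<^esub> c" unfolding D_T[symmetric] D.T_simps by auto
    then obtain u where u: "u \<in> carrier Le.U" "c - frag_of (Le.\<iota> u, 1) \<in> D.I" using ex D.FG_iff by blast
    then have "y = Tm u" unfolding Tm_def D.tens_def c(2) using D.rcos_I_eq[OF c(1) fr] by simp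
    then show "y \<in> Tm ` carrier Le.U" using u by blast
  qed
qed

lemma left_module_Delta: "left_module A \<Delta>"
proof (rule left_module_image)
  show "left_module A Le.U" by (rule Le.left_module_U)
  show "Tm \<in> module_hom A Le.U \<Delta>" by (rule Tm_hom)
  show "Tm ` carrier Le.U = carrier \<Delta>" by (rule Tm_surj)
  show "Tm \<zero>\<^bsub>Le.U\<^esub> = \<zero>\<^bsub>\<Delta>\<^esub>" by (rule Tm_zero)
qed

sublocale \<Delta>: left_module A \<Delta> by (rule left_module_Delta)

lemma delta_e_U: "delta e \<in> carrier Le.U" "k \<in> K \<Longrightarrow> (\<lambda>t. k * delta e t) \<in> carrier Le.U"
  using delta_in_A[OF e(1)] G_Le[OF e_in_G] by (auto intro!: Le_U_I simp: delta_def split: if_splits)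

lemma Tm_generator: "u \<in> carrier Le.U \<Longrightarrow> Tm u = u \<odot>\<^bsub>\<Delta>\<^esub> Tm (delta e)"
proof -
  assume u: "u \<in> carrier Le.U"
  have "u \<otimes>\<^bsub>A\<^esub> delta e = u"
  proof
    fix t
    have ue: "s \<otimes> e = s" if "u s \<noteq> 0" for s using Le_U_D(2)[OF u that] Le_C_iff by blast
    have "(\<Sum>s\<in>carrier S. if s \<otimes> e = t then u s else 0) = (\<Sum>s\<in>carrier S. if s = t then u s else 0)"
      using ue by (intro sum.cong refl) (metis (full_types))
    also have "\<dots> = u t" using Le_U_D(1)[OF u] finite_S by (auto simp: A_simps)
    finally have "(u \<otimes>\<^bsub>A\<^esub> (\<lambda>t. 1 * delta e t)) t = u t" by (subst mult_scaled_delta[OF e(1)]) simp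
    then show "(u \<otimes>\<^bsub>A\<^esub> delta e) t = u t" by simp
  qed
  then show ?thesis
    using module_hom_smult[OF Tm_hom Le_U_D(1)[OF u] delta_e_U(1)] by (simp add: Le.U_simps)
qed

lemma Tm_KG: "p \<in> carrier KG \<Longrightarrow> Tm p = D.tens (Le.\<iota> (delta e)) (\<Sum>g\<in>G. p g)"
proof -
  assume p: "p \<in> carrier KG"
  have "delta e \<otimes>\<^bsub>A\<^esub> p = p"
  proof
    fix t
    have ep: "e \<otimes> s = s" if "p s \<noteq> 0" for s using p that G_D(2) KG_iff by blast
    have "(\<Sum>s\<in>carrier S. if e \<otimes> s = t then p s else 0) = (\<Sum>s\<in>carrier S. if s = t then p s else 0)"
      using ep by (intro sum.cong refl) (metis (full_types))
    also have "\<dots> = p t" using KG_A[OF p] finite_S by (auto simp: A_simps)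
    finally have "((\<lambda>t. 1 * delta e t) \<otimes>\<^bsub>A\<^esub> p) t = p t" by (subst scaled_delta_mult[OF e(1)]) simp
    then show "(delta e \<otimes>\<^bsub>A\<^esub> p) t = p t" by simp
  qed
  then have "Tm p = D.tens (ract (Le.\<iota> (delta e)) p) 1"
    unfolding Tm_def using ract_iota[OF delta_e_U(1) p] by simp
  also have "\<dots> = D.tens (Le.\<iota> (delta e)) (p \<odot>\<^bsub>triv\<^esub> 1)"
    using p Le_iota_M[OF delta_e_U(1)] K_closed(2) by (intro D.tens_ract) (auto simp: triv_simps)
  finally show ?thesis by (simp add: triv_simps)
qed

text \<open>
  For \<open>u\<close> in the span of \<open>Se\<close> the product \<open>\<epsilon> u\<close> is supported on \<open>eSe\<close>, whose elements in the left cell of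
  \<open>e\<close> are left invertible and thus in \<open>G\<close>. Modulo the lower ideal \<open>\<epsilon> u\<close> is therefore an element \<open>p\<close> of
  \<open>K[G]\<close>, and \<open>p \<otimes> 1 = e \<otimes> p 1\<close> lies on the line of the generator \<open>e \<otimes> 1\<close>.
\<close>

lemma gsum_Delta:
  assumes y: "y \<in> carrier \<Delta>"
  shows "gsum \<odot>\<^bsub>\<Delta>\<^esub> y = \<zero>\<^bsub>\<Delta>\<^esub> \<or> (\<exists>b\<in>carrier A. b \<odot>\<^bsub>\<Delta>\<^esub> (gsum \<odot>\<^bsub>\<Delta>\<^esub> y) = Tm (delta e))"
proof -
  obtain u where u: "u \<in> carrier Le.U" "y = Tm u" using y Tm_surj by auto
  define w where "w = gsum \<otimes>\<^bsub>A\<^esub> u"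
  have w: "w \<in> carrier Le.U" using Le.U.smult_closed[OF gsum_A u(1)] by (simp add: w_def Le.U_simps)
  have gy: "gsum \<odot>\<^bsub>\<Delta>\<^esub> y = Tm w"
    using module_hom_smult[OF Tm_hom gsum_A u(1)] by (simp add: w_def u(2) Le.U_simps)
  define p where "p s = (if s \<in> G then w s else 0)" for s
  have wK: "w s \<in> K" for s using A_K[OF Le_U_D(1)[OF w]] .
  have p: "p \<in> carrier KG" unfolding KG_iff p_def using wK K_closed(1) by auto
  have pU: "p \<in> carrier Le.U" using KG_A[OF p] G_Le by (intro Le_U_I) (auto simp: p_def split: if_splits)
  \<comment> \<open>the remainder of \<open>w\<close>, which vanishes in the cell module\<close>
  define q where "q s = (if s \<in> G then 0 else w s)" for s
  have q: "q \<in> Le.W"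
    unfolding Le_W_iff
  proof (intro conjI allI impI)
    show "q \<in> carrier A" using Le_U_D(1)[OF w] K_closed(1) by (auto simp: A_simps q_def)
    fix s assume s: "q s \<noteq> 0"
    then have sw: "w s \<noteq> 0" "s \<notin> G" by (auto simp: q_def split: if_splits)
    show sC: "s \<in> Le.C" using Le_U_D(2)[OF w sw(1)] .
    obtain g t where gt: "t \<in> carrier S" "gsum g \<noteq> 0" "s = g \<otimes> t" using A_mult_nonzero sw(1) unfolding w_def by blast
    then have g: "g \<in> G" by (auto simp: gsum_def split: if_splits)
    have es: "e \<otimes> s = s" using G_D[OF g] gt e by (simp add: m_assoc[symmetric])
    show "s \<notin> left_cell_of S e"
    proof
      assume "s \<in> left_cell_of S e"
      then obtain b where "b \<in> carrier S" "e = b \<otimes> s" using Le.cell_le[OF _ e_Le] unfolding left_le_def by blast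
      then have "s \<in> G" using left_invertible_imp_maximal_subgroup[OF e] sC es Le_C_iff by auto
      then show False using sw by blast
    qed
  qed
  have "w = q \<oplus>\<^bsub>Le.U\<^esub> p" by (auto simp: Le.U_simps A_simps p_def q_def)
  moreover have "q \<in> carrier Le.U" using q Le.U.submoduleD(1)[OF Le.W_submodule] by blast
  ultimately have "w \<ominus>\<^bsub>Le.U\<^esub> p = q" using pU by (simp add: a_minus_def Le.U.M.a_assoc Le.U.M.r_neg)
  then have "Le.\<iota> w = Le.\<iota> p" using Le.iota_eq_iff[OF w pU] q by simp
  then have "Tm w = Tm p" by (simp add: Tm_def)
  define k where "k = (\<Sum>g\<in>G. p g)"
  have kK: "k \<in> K" unfolding k_def by (rule sum_KG[OF p])
  have ke: "(\<lambda>t. k * delta e t) \<in> carrier KG"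
    using kK e_in_G K_closed(1) by (auto simp: KG_iff delta_def)
  have "(\<Sum>g\<in>G. k * delta e g) = k" using e_in_G finite_G by (simp add: delta_def if_distrib cong: if_cong)
  then have Tp: "Tm p = Tm (\<lambda>t. k * delta e t)" unfolding Tm_KG[OF p] Tm_KG[OF ke] k_def[symmetric] by simp
  have sc: "(\<lambda>t. c * delta \<one> t) \<otimes>\<^bsub>A\<^esub> (\<lambda>t. k' * delta e t) = (\<lambda>t. c * (k' * delta e t))" if "k' \<in> K" for c k'
    using scalar_mult[OF delta_in_A(2)[OF e(1) that]] by simp
  show ?thesis
  proof (cases "k = 0")
    case True
    then have "Tm p = \<zero>\<^bsub>\<Delta>\<^esub>" using Tp Tm_zero by (simp add: Le.U_simps A_simps)
    then show ?thesis using gy \<open>Tm w = Tm p\<close> by simp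
  next
    case False
    have ik: "(\<lambda>t. inverse k * delta \<one> t) \<in> carrier A" using K_closed(6)[OF kK] delta_in_A(2) by simp
    have "(\<lambda>t. inverse k * delta \<one> t) \<odot>\<^bsub>\<Delta>\<^esub> (gsum \<odot>\<^bsub>\<Delta>\<^esub> y) = Tm (delta e)"
      unfolding gy \<open>Tm w = Tm p\<close> Tp
      using module_hom_smult[OF Tm_hom ik delta_e_U(2)[OF kK]] False
      by (simp add: Le.U_simps sc[OF kK] mult.assoc[symmetric])
    then show ?thesis using ik by blast
  qed
qed

lemma Delta_generated:
  assumes "Module.submodule H A \<Delta>" "Tm (delta e) \<in> H"
  shows "H = carrier \<Delta>"
proof
  show "H \<subseteq> carrier \<Delta>" using \<Delta>.submoduleD(1)[OF assms(1)] .
  show "carrier \<Delta> \<subseteq> H"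
    unfolding Tm_surj[symmetric] using Tm_generator \<Delta>.submoduleD(4)[OF assms(1)] assms(2) Le_U_D(1) by auto
qed

end

section \<open>Eigenvalues as functionals\<close>

context finite_monoid_algebra
begin

abbreviation "KF \<equiv> class_ring\<lparr>carrier := K\<rparr>"
abbreviation "scal k \<equiv> (\<lambda>t. k * delta \<one> t)"

lemma field_KF: "field KF"
  using ring.subfield_iff(2)[OF class_ring.ring_axioms subfield_K] .

lemma KF_simps: "carrier KF = K" "x \<oplus>\<^bsub>KF\<^esub> y = x + y" "x \<otimes>\<^bsub>KF\<^esub> y = x * y" "\<zero>\<^bsub>KF\<^esub> = 0" "\<one>\<^bsub>KF\<^esub> = 1"
  by simp_all

lemma scal_A: "k \<in> K \<Longrightarrow> scal k \<in> carrier A" by (rule delta_in_A(2)[OF one_closed])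

lemma scal_add: "scal (k + l) = scal k \<oplus>\<^bsub>A\<^esub> scal l" by (simp add: A_simps algebra_simps)

lemma scal_mult: "k \<in> K \<Longrightarrow> l \<in> K \<Longrightarrow> scal (k * l) = scal k \<otimes>\<^bsub>A\<^esub> scal l"
  using scalar_mult[OF scal_A] by (simp add: mult.assoc)

lemma scal_one: "scal 1 = \<one>\<^bsub>A\<^esub>" by (simp add: A_simps)

lemma scal_central: "k \<in> K \<Longrightarrow> f \<in> carrier A \<Longrightarrow> f \<otimes>\<^bsub>A\<^esub> scal k = scal k \<otimes>\<^bsub>A\<^esub> f"
  by (simp add: scalar_mult mult_scalar)

lemma underlying_simps: "carrier (underlying_space S X) = carrier X"
  "x \<oplus>\<^bsub>underlying_space S X\<^esub> y = x \<oplus>\<^bsub>X\<^esub> y" "\<zero>\<^bsub>underlying_space S X\<^esub> = \<zero>\<^bsub>X\<^esub>"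
  "k \<odot>\<^bsub>underlying_space S X\<^esub> x = scal k \<odot>\<^bsub>X\<^esub> x"
  by (simp_all add: underlying_space_def)

lemma finsum_underlying: "finsum (underlying_space S X) f B = finsum X f B"
  by (simp add: finsum_def finprod_def underlying_space_def)

lemma vectorspace_underlying:
  assumes "left_module A X"
  shows "vectorspace KF (underlying_space S X)"
proof -
  interpret X: left_module A X by fact
  have "abelian_group (underlying_space S X)"
  proof (rule abelian_groupI)
    fix x assume "x \<in> carrier (underlying_space S X)"
    then show "\<exists>y\<in>carrier (underlying_space S X). y \<oplus>\<^bsub>underlying_space S X\<^esub> x = \<zero>\<^bsub>underlying_space S X\<^esub>"
      by (intro bexI[of _ "\<ominus>\<^bsub>X\<^esub> x"]) (simp_all add: underlying_simps X.M.l_neg)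
  qed (simp_all add: underlying_simps X.M.a_ac)
  moreover have one: "delta \<one> \<odot>\<^bsub>X\<^esub> x = x" if "x \<in> carrier X" for x
    using X.smult_one[OF that] by (simp add: A_simps(2))
  ultimately have "Module.module KF (underlying_space S X)"
    using domain.axioms(1)[OF field.axioms(1)[OF field_KF]] one
    by (intro Module.module.intro Module.module_axioms.intro)
      (simp_all add: KF_simps underlying_simps scal_A X.smult_closed scal_add X.smult_l_distr X.smult_r_distr
        scal_mult X.smult_assoc scal_one X.smult_one)
  then show ?thesis using field_KF by (simp add: vectorspace_def)
qed

text \<open>
  A left eigenvector of \<open>a\<close> for \<open>\<mu>\<close>, written without a basis: a \<open>K\<close>-linear map to the complex numbers
  through which \<open>a\<close> acts as \<open>\<mu>\<close>. It passes between a module and its quotients by composition with the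
  projection, and it stays over \<open>K\<close> although \<open>\<mu>\<close> need not lie in \<open>K\<close>.
\<close>

definition eigenfunctional :: "('a \<Rightarrow> complex, 'x) module \<Rightarrow> ('a \<Rightarrow> complex) \<Rightarrow> complex \<Rightarrow> ('x \<Rightarrow> complex) \<Rightarrow> bool" where
  "eigenfunctional X a \<mu> \<psi> \<longleftrightarrow>
     (\<forall>x\<in>carrier X. \<forall>y\<in>carrier X. \<psi> (x \<oplus>\<^bsub>X\<^esub> y) = \<psi> x + \<psi> y) \<and>
     (\<forall>k\<in>K. \<forall>x\<in>carrier X. \<psi> (scal k \<odot>\<^bsub>X\<^esub> x) = k * \<psi> x) \<and>
     (\<forall>x\<in>carrier X. \<psi> (a \<odot>\<^bsub>X\<^esub> x) = \<mu> * \<psi> x) \<and> (\<exists>x\<in>carrier X. \<psi> x \<noteq> 0)"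

lemma functional_finsum:
  assumes X: "left_module A X"
    and add: "\<And>x y. x \<in> carrier X \<Longrightarrow> y \<in> carrier X \<Longrightarrow> \<psi> (x \<oplus>\<^bsub>X\<^esub> y) = \<psi> x + \<psi> y"
    and fin: "finite B" and g: "g \<in> B \<rightarrow> carrier X"
  shows "\<psi> (finsum X g B) = (\<Sum>b\<in>B. \<psi> (g b) :: complex)"
proof -
  interpret X: left_module A X by fact
  have zero: "\<psi> \<zero>\<^bsub>X\<^esub> = 0" using add[OF X.M.zero_closed X.M.zero_closed] by simp
  show ?thesis using fin g
    by (induction B rule: finite_induct) (simp_all add: add zero Pi_iff)
qed

text \<open>
  The functional maps the \<open>i\<close>-th basis vector to the \<open>i\<close>-th entry \<open>z i\<close> of a left eigenvector of the
  matrix.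
\<close>

lemma acts_with_eigenvalue_imp_functional:
  assumes X: "left_module A X" and a: "a \<in> carrier A" and acts: "acts_with_eigenvalue K S X a \<mu>"
  shows "\<exists>\<psi>. eigenfunctional X a \<mu> \<psi>"
proof -
  interpret X: left_module A X by fact
  let ?V = "underlying_space S X"
  interpret V: vectorspace KF ?V by (rule vectorspace_underlying[OF X])
  obtain bs B where bs: "distinct bs" "V.basis (set bs)" "B \<in> carrier_mat (length bs) (length bs)"
      "elements_mat B \<subseteq> K"
    and B: "\<And>j. j < length bs \<Longrightarrow> a \<odot>\<^bsub>X\<^esub> bs ! j = (\<Oplus>\<^bsub>X\<^esub>i \<in> {..<length bs}. B $$ (i, j) \<odot>\<^bsub>?V\<^esub> bs ! i)"
    and ev: "eigenvalue B \<mu>"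
    using acts unfolding acts_with_eigenvalue_def matrix_in_basis_def by blast
  define n where "n = length bs"
  obtain z i0 where z: "i0 < n" "z i0 \<noteq> 0" "\<And>j. j < n \<Longrightarrow> (\<Sum>i<n. z i * B $$ (i, j)) = \<mu> * z j"
    using ev unfolding eigenvalue_iff_left_eigenvector[OF bs(3)] n_def by blast
  have bsX: "set bs \<subseteq> carrier ?V" using bs(2) unfolding V.basis_def by blast
  then have bX: "bs ! i \<in> carrier X" if "i < n" for i
    using that by (auto simp: n_def underlying_simps)
  have unique: "\<exists>!c. c \<in> set bs \<rightarrow>\<^sub>E K \<and> V.lincomb c (set bs) = x" if "x \<in> carrier X" for x
    using V.basis_criterion[OF finite_set bsX] bs(2) that by (simp add: KF_simps underlying_simps)
  define crd where "crd x = (THE c. c \<in> set bs \<rightarrow>\<^sub>E K \<and> V.lincomb c (set bs) = x)" for x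
  have crd: "crd x \<in> set bs \<rightarrow>\<^sub>E K" "V.lincomb (crd x) (set bs) = x" if "x \<in> carrier X" for x
    using theI'[OF unique[OF that]] unfolding crd_def by auto
  have crdK: "crd x \<in> set bs \<rightarrow> K" if "x \<in> carrier X" for x using crd(1)[OF that] by (auto simp: PiE_iff)
  have crd_eq: "crd x b = c b" if "c \<in> set bs \<rightarrow> K" "V.lincomb c (set bs) = x" "b \<in> set bs" for x c b
  proof -
    have x: "x \<in> carrier X" using V.lincomb_closed[OF bsX, of c] that by (simp add: KF_simps underlying_simps)
    have "V.lincomb (restrict c (set bs)) (set bs) = V.lincomb c (set bs)"
      by (rule V.lincomb_cong[OF refl bsX]) (use that in \<open>auto simp: KF_simps\<close>)
    then have "restrict c (set bs) \<in> set bs \<rightarrow>\<^sub>E K \<and> V.lincomb (restrict c (set bs)) (set bs) = x"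
      using that by auto
    then have "crd x = restrict c (set bs)" unfolding crd_def using unique[OF x] by (intro the1_equality)
    then show ?thesis using that by simp
  qed
  define \<psi> where "\<psi> x = (\<Sum>i<n. crd x (bs ! i) * z i)" for x
  have add: "\<psi> (x \<oplus>\<^bsub>X\<^esub> y) = \<psi> x + \<psi> y" if xy: "x \<in> carrier X" "y \<in> carrier X" for x y
  proof -
    have "V.lincomb (\<lambda>b. crd x b + crd y b) (set bs) = x \<oplus>\<^bsub>X\<^esub> y"
      using V.lincomb_sum[OF finite_set bsX, unfolded KF_simps underlying_simps, OF crdK[OF xy(1)] crdK[OF xy(2)]]
        crd(2)[OF xy(1)] crd(2)[OF xy(2)] by simp
    moreover have "(\<lambda>b. crd x b + crd y b) \<in> set bs \<rightarrow> K"
      using crd(1)[OF xy(1)] crd(1)[OF xy(2)] K_closed(3) by (auto simp: PiE_iff)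
    ultimately have "crd (x \<oplus>\<^bsub>X\<^esub> y) b = crd x b + crd y b" if "b \<in> set bs" for b
      using that by (intro crd_eq)
    then show ?thesis unfolding \<psi>_def sum.distrib[symmetric]
      by (intro sum.cong) (simp_all add: n_def distrib_right)
  qed
  have smult: "\<psi> (scal k \<odot>\<^bsub>X\<^esub> x) = k * \<psi> x" if k: "k \<in> K" and x: "x \<in> carrier X" for k x
  proof -
    have "V.lincomb (\<lambda>b. k * crd x b) (set bs) = scal k \<odot>\<^bsub>X\<^esub> x"
      using V.lincomb_smult[OF bsX, unfolded KF_simps underlying_simps, OF crdK[OF x] k] crd(2)[OF x] by simp
    moreover have "(\<lambda>b. k * crd x b) \<in> set bs \<rightarrow> K"
      using crd(1)[OF x] k K_closed(4) by (auto simp: PiE_iff)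
    ultimately have "crd (scal k \<odot>\<^bsub>X\<^esub> x) b = k * crd x b" if "b \<in> set bs" for b
      using that by (intro crd_eq)
    then show ?thesis unfolding \<psi>_def sum_distrib_left
      by (intro sum.cong) (simp_all add: n_def mult.assoc)
  qed
  have psi_b: "\<psi> (bs ! j) = z j" if j: "j < n" for j
  proof -
    have "V.lincomb (\<lambda>b. if bs ! j = b then 1 else 0) (set bs) =
        (\<Oplus>\<^bsub>?V\<^esub>b\<in>set bs. if bs ! j = b then b else \<zero>\<^bsub>?V\<^esub>)"
      unfolding V.lincomb_def
    proof (rule V.module.M.finsum_cong'[OF refl])
      fix b assume "b \<in> set bs"
      then have b: "b \<in> carrier X" using bsX by (auto simp: underlying_simps)
      have "scal 0 \<odot>\<^bsub>X\<^esub> b = \<zero>\<^bsub>X\<^esub>" using X.zero_smult[OF b] by (simp add: A_simps)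
      then show "(if bs ! j = b then 1 else 0) \<odot>\<^bsub>?V\<^esub> b = (if bs ! j = b then b else \<zero>\<^bsub>?V\<^esub>)"
        using X.smult_one[OF b] scal_one by (simp add: underlying_simps)
    qed (use bsX in \<open>auto simp: underlying_simps\<close>)
    also have "\<dots> = bs ! j"
      using j bsX by (intro V.module.M.finsum_singleton) (auto simp: n_def)
    finally have "crd (bs ! j) b = (if bs ! j = b then 1 else 0)" if "b \<in> set bs" for b
      using that K_closed(1,2) by (intro crd_eq) auto
    then have "\<psi> (bs ! j) = (\<Sum>i<n. if i = j then z i else 0)"
      unfolding \<psi>_def using bs(1) j by (intro sum.cong) (auto simp: n_def nth_eq_iff_index_eq)
    then show ?thesis using j by simp
  qed
  have BK: "B $$ (i, j) \<in> K" if "i < n" "j < n" for i j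
    using elements_matI[OF bs(3), of i j] bs(4) that by (auto simp: n_def)
  have ab: "\<psi> (a \<odot>\<^bsub>X\<^esub> bs ! j) = \<mu> * \<psi> (bs ! j)" if j: "j < n" for j
  proof -
    have "\<psi> (a \<odot>\<^bsub>X\<^esub> bs ! j) = (\<Sum>i<n. \<psi> (scal (B $$ (i, j)) \<odot>\<^bsub>X\<^esub> bs ! i))"
      unfolding B[OF j[unfolded n_def]] n_def[symmetric] underlying_simps
      using X j by (intro functional_finsum add) (auto intro!: X.smult_closed scal_A BK bX)
    also have "\<dots> = (\<Sum>i<n. z i * B $$ (i, j))"
      using j by (intro sum.cong) (auto simp: smult BK bX psi_b)
    finally show ?thesis using z(3)[OF j] psi_b[OF j] by simp
  qed
  have eig: "\<psi> (a \<odot>\<^bsub>X\<^esub> x) = \<mu> * \<psi> x" if x: "x \<in> carrier X" for x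
  proof -
    have xs: "x = (\<Oplus>\<^bsub>X\<^esub>b\<in>set bs. scal (crd x b) \<odot>\<^bsub>X\<^esub> b)"
      using crd(2)[OF x] by (simp add: V.lincomb_def finsum_underlying underlying_simps)
    have sx: "(\<lambda>b. scal (crd x b) \<odot>\<^bsub>X\<^esub> b) \<in> set bs \<rightarrow> carrier X"
      using crd(1)[OF x] bsX by (auto intro!: X.smult_closed scal_A simp: underlying_simps)
    have "\<psi> (a \<odot>\<^bsub>X\<^esub> (\<Oplus>\<^bsub>X\<^esub>b\<in>set bs. scal (crd x b) \<odot>\<^bsub>X\<^esub> b)) = (\<Sum>b\<in>set bs. \<psi> (a \<odot>\<^bsub>X\<^esub> (scal (crd x b) \<odot>\<^bsub>X\<^esub> b)))"
      using X sx a by (intro functional_finsum[where \<psi> = "\<lambda>x. \<psi> (a \<odot>\<^bsub>X\<^esub> x)"])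
        (auto simp: X.smult_r_distr add X.smult_closed)
    also have "\<dots> = (\<Sum>b\<in>set bs. \<mu> * \<psi> (scal (crd x b) \<odot>\<^bsub>X\<^esub> b))"
    proof (intro sum.cong refl)
      fix b assume b: "b \<in> set bs"
      then obtain j where j: "j < n" "b = bs ! j" unfolding n_def by (metis in_set_conv_nth)
      have k: "crd x b \<in> K" using Pi_mem[OF crdK[OF x] b] .
      have bc: "b \<in> carrier X" using bX[OF j(1)] j(2) by (simp only:)
      have "a \<odot>\<^bsub>X\<^esub> (scal (crd x b) \<odot>\<^bsub>X\<^esub> b) = scal (crd x b) \<odot>\<^bsub>X\<^esub> (a \<odot>\<^bsub>X\<^esub> b)"
        using X.smult_assoc[OF a scal_A[OF k] bc] X.smult_assoc[OF scal_A[OF k] a bc] scal_central[OF k a] by simp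
      then show "\<psi> (a \<odot>\<^bsub>X\<^esub> (scal (crd x b) \<odot>\<^bsub>X\<^esub> b)) = \<mu> * \<psi> (scal (crd x b) \<odot>\<^bsub>X\<^esub> b)"
        using ab[OF j(1)] j(2) smult[OF k bc] smult[OF k X.smult_closed[OF a bc]] by simp
    qed
    also have "\<dots> = \<mu> * \<psi> (\<Oplus>\<^bsub>X\<^esub>b\<in>set bs. scal (crd x b) \<odot>\<^bsub>X\<^esub> b)"
      using functional_finsum[OF X add finite_set sx] by (simp add: sum_distrib_left)
    finally show ?thesis using xs by simp
  qed
  have "\<psi> (bs ! i0) \<noteq> 0" using psi_b[OF z(1)] z(2) by simp
  then have "\<exists>x\<in>carrier X. \<psi> x \<noteq> 0" using bX[OF z(1)] by blast
  then have "eigenfunctional X a \<mu> \<psi>" unfolding eigenfunctional_def by (intro conjI ballI add smult eig)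
  then show ?thesis by blast
qed

lemma cyclic_fin_dim:
  assumes X: "left_module A X" and x: "x \<in> carrier X" and gen: "(\<lambda>f. f \<odot>\<^bsub>X\<^esub> x) ` carrier A = carrier X"
  shows "vectorspace.fin_dim KF (underlying_space S X)"
proof -
  interpret X: left_module A X by fact
  let ?V = "underlying_space S X"
  interpret V: vectorspace KF ?V by (rule vectorspace_underlying[OF X])
  define H where "H f = f \<odot>\<^bsub>X\<^esub> x" for f
  have H: "H \<in> module_hom A (regular_module A) X" "H ` carrier A = carrier X"
    using X.regular_module_orbit_hom[OF x] gen unfolding H_def by simp_all
  define B where "B = (\<lambda>s. H (delta s)) ` carrier S"
  have BX: "B \<subseteq> carrier ?V"
    using module_hom_closed[OF H(1)] delta_in_A(1) by (auto simp: B_def regular_module_def underlying_simps)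
  have sub: "submodule KF (V.span B) ?V" using V.span_is_submodule[OF BX] .
  have "H f \<in> V.span B" if f: "f \<in> carrier A" for f
  proof -
    have part: "H (\<lambda>s. if s \<in> T then f s else 0) \<in> V.span B" if "T \<subseteq> carrier S" for T
      using finite_subset[OF that finite_S] that
    proof (induction T rule: finite_induct)
      case empty
      have "H \<zero>\<^bsub>regular_module A\<^esub> = \<zero>\<^bsub>X\<^esub>" using module_hom_zero[OF left_module_regular X H(1)] .
      then show ?case using submodule.zero_closed[OF sub]
        by (simp add: regular_module_def A_simps underlying_simps)
    next
      case (insert s T)
      let ?fT = "\<lambda>u. if u \<in> T then f u else 0"
      have fT: "?fT \<in> carrier A" using f K_closed(1) by (auto simp: A_simps)
      have k: "f s \<in> K" using A_K[OF f] .
      have ds: "delta s \<in> carrier A" using insert delta_in_A by simp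
      have "(\<lambda>u. if u \<in> insert s T then f u else 0) = scal (f s) \<otimes>\<^bsub>A\<^esub> delta s \<oplus>\<^bsub>A\<^esub> ?fT"
        unfolding scalar_mult[OF ds] using insert.hyps by (auto simp: A_simps delta_def)
      moreover have "H (scal (f s) \<otimes>\<^bsub>A\<^esub> delta s \<oplus>\<^bsub>A\<^esub> ?fT) = scal (f s) \<odot>\<^bsub>X\<^esub> H (delta s) \<oplus>\<^bsub>X\<^esub> H ?fT"
        using module_hom_add[OF H(1), of "scal (f s) \<otimes>\<^bsub>A\<^esub> delta s" ?fT]
          module_hom_smult[OF H(1) scal_A[OF k], of "delta s"] ds fT scal_A[OF k]
        by (simp add: regular_module_def A_mult_closed)
      moreover have "H (delta s) \<in> V.span B"
        using V.in_own_span[OF BX] insert by (auto simp: B_def)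
      then have "f s \<odot>\<^bsub>?V\<^esub> H (delta s) \<oplus>\<^bsub>?V\<^esub> H ?fT \<in> V.span B"
        using insert k by (intro submodule.m_closed[OF sub] submodule.smult_closed[OF sub]) (auto simp: KF_simps)
      ultimately show ?case by (simp add: underlying_simps)
    qed
    have "(\<lambda>s. if s \<in> carrier S then f s else 0) = f" using f by (auto simp: A_simps)
    with part[of "carrier S"] show ?thesis by simp
  qed
  then have "carrier ?V \<subseteq> V.span B" unfolding underlying_simps H(2)[symmetric] by blast
  then have "V.span B = carrier ?V" using submodule.subset[OF sub] by blast
  then show ?thesis unfolding V.fin_dim_def using BX finite_S by (auto simp: B_def)
qed

text \<open>
  The values of the functional at a basis form a left eigenvector of the matrix.
\<close>

lemma functional_imp_acts_with_eigenvalue: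
  assumes X: "left_module A X" and a: "a \<in> carrier A" and \<psi>: "eigenfunctional X a \<mu> \<psi>"
    and fin: "vectorspace.fin_dim KF (underlying_space S X)"
  shows "acts_with_eigenvalue K S X a \<mu>"
proof -
  interpret X: left_module A X by fact
  let ?V = "underlying_space S X"
  interpret V: vectorspace KF ?V by (rule vectorspace_underlying[OF X])
  have add: "\<psi> (x \<oplus>\<^bsub>X\<^esub> y) = \<psi> x + \<psi> y" if "x \<in> carrier X" "y \<in> carrier X" for x y
    using \<psi> that unfolding eigenfunctional_def by blast
  have smult: "\<psi> (scal k \<odot>\<^bsub>X\<^esub> x) = k * \<psi> x" if "k \<in> K" "x \<in> carrier X" for k x
    using \<psi> that unfolding eigenfunctional_def by blast
  have eig: "\<psi> (a \<odot>\<^bsub>X\<^esub> x) = \<mu> * \<psi> x" if "x \<in> carrier X" for x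
    using \<psi> that unfolding eigenfunctional_def by blast
  obtain x0 where x0: "x0 \<in> carrier X" "\<psi> x0 \<noteq> 0" using \<psi> unfolding eigenfunctional_def by blast
  obtain \<beta> where "finite \<beta>" "V.basis \<beta>" using V.finite_basis_exists[OF fin] by blast
  then obtain bs where bs: "distinct bs" "V.basis (set bs)" using finite_distinct_list by metis
  define n where "n = length bs"
  have bsX: "set bs \<subseteq> carrier ?V" using bs(2) unfolding V.basis_def by blast
  have bX: "bs ! i \<in> carrier X" if "i < n" for i using bsX that by (auto simp: n_def underlying_simps)
  have expand: "\<exists>c. (\<forall>i<n. c i \<in> K) \<and> x = (\<Oplus>\<^bsub>X\<^esub>i\<in>{..<n}. scal (c i) \<odot>\<^bsub>X\<^esub> bs ! i)" if x: "x \<in> carrier X" for x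
  proof -
    have "V.span (set bs) = carrier ?V" using bs(2) unfolding V.basis_def by blast
    then have "x \<in> V.span (set bs)" using x by (simp only: underlying_simps)
    then obtain c where c: "c \<in> set bs \<rightarrow> K" "V.lincomb c (set bs) = x"
      using V.finite_in_span[OF finite_set bsX] by (auto simp: KF_simps)
    have set: "set bs = (\<lambda>i. bs ! i) ` {..<n}" by (auto simp: n_def in_set_conv_nth)
    have inj: "inj_on (\<lambda>i. bs ! i) {..<n}" using bs(1) by (auto simp: inj_on_def n_def nth_eq_iff_index_eq)
    have "x = (\<Oplus>\<^bsub>X\<^esub>b\<in>set bs. scal (c b) \<odot>\<^bsub>X\<^esub> b)"
      using c(2) by (simp add: V.lincomb_def finsum_underlying underlying_simps)
    also have "\<dots> = (\<Oplus>\<^bsub>X\<^esub>i\<in>{..<n}. scal (c (bs ! i)) \<odot>\<^bsub>X\<^esub> bs ! i)"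
      unfolding set using inj
      by (intro X.M.finsum_reindex) (use c bX in \<open>auto intro!: X.smult_closed scal_A simp: n_def\<close>)
    finally show ?thesis using c(1) by (intro exI[of _ "\<lambda>i. c (bs ! i)"]) (auto simp: n_def)
  qed
  define P where "P j c \<longleftrightarrow> (\<forall>i<n. c i \<in> K) \<and> a \<odot>\<^bsub>X\<^esub> bs ! j = (\<Oplus>\<^bsub>X\<^esub>i\<in>{..<n}. scal (c i) \<odot>\<^bsub>X\<^esub> bs ! i)" for j c
  have "\<forall>j\<in>{..<n}. \<exists>c. P j c" using expand[OF X.smult_closed[OF a bX]] unfolding P_def by simp
  from bchoice[OF this] obtain c where "\<forall>j\<in>{..<n}. P j (c j)" by blast
  then have c: "\<And>i j. j < n \<Longrightarrow> i < n \<Longrightarrow> c j i \<in> K"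
    "\<And>j. j < n \<Longrightarrow> a \<odot>\<^bsub>X\<^esub> bs ! j = (\<Oplus>\<^bsub>X\<^esub>i\<in>{..<n}. scal (c j i) \<odot>\<^bsub>X\<^esub> bs ! i)"
    unfolding P_def by auto
  define B where "B = mat n n (\<lambda>(i, j). c j i)"
  have B: "B \<in> carrier_mat n n" unfolding B_def by simp
  have psi_sum: "\<psi> (\<Oplus>\<^bsub>X\<^esub>i\<in>{..<n}. scal (d i) \<odot>\<^bsub>X\<^esub> bs ! i) = (\<Sum>i<n. d i * \<psi> (bs ! i))" if "\<forall>i<n. d i \<in> K" for d
    using functional_finsum[OF X add, of "{..<n}" "\<lambda>i. scal (d i) \<odot>\<^bsub>X\<^esub> bs ! i"] that
    by (simp add: smult bX scal_A X.smult_closed Pi_iff)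
  have "matrix_in_basis K S X a bs B"
    unfolding matrix_in_basis_def
  proof (intro conjI allI impI)
    show "a \<odot>\<^bsub>X\<^esub> bs ! j = (\<Oplus>\<^bsub>X\<^esub>i\<in>{..<length bs}. B $$ (i, j) \<odot>\<^bsub>?V\<^esub> bs ! i)" if "j < length bs" for j
      unfolding c(2)[OF that[folded n_def]] n_def[symmetric] underlying_simps
      using that c(1) by (intro X.M.finsum_cong') (auto simp: B_def n_def[symmetric] intro!: X.smult_closed scal_A bX)
    show "elements_mat B \<subseteq> K" using c(1) by (auto simp: elements_mat_def B_def)
  qed (use bs B in \<open>simp_all add: n_def\<close>)
  moreover have "eigenvalue B \<mu>"
    unfolding eigenvalue_iff_left_eigenvector[OF B]
  proof (intro exI[of _ "\<lambda>i. \<psi> (bs ! i)"] conjI allI impI)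
    obtain d where d: "\<forall>i<n. d i \<in> K" "x0 = (\<Oplus>\<^bsub>X\<^esub>i\<in>{..<n}. scal (d i) \<odot>\<^bsub>X\<^esub> bs ! i)" using expand[OF x0(1)] by blast
    show "\<exists>i<n. \<psi> (bs ! i) \<noteq> 0"
    proof (rule ccontr)
      assume "\<not> (\<exists>i<n. \<psi> (bs ! i) \<noteq> 0)"
      then have "\<psi> x0 = 0" unfolding d(2) psi_sum[OF d(1)] by (intro sum.neutral) auto
      then show False using x0 by simp
    qed
    fix j assume j: "j < n"
    have "(\<Sum>i<n. \<psi> (bs ! i) * B $$ (i, j)) = (\<Sum>i<n. c j i * \<psi> (bs ! i))"
      using j by (intro sum.cong) (auto simp: B_def)
    also have "\<dots> = \<psi> (a \<odot>\<^bsub>X\<^esub> bs ! j)" unfolding c(2)[OF j] using psi_sum c(1) j by simp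
    finally show "(\<Sum>i<n. \<psi> (bs ! i) * B $$ (i, j)) = \<mu> * \<psi> (bs ! j)" using eig[OF bX[OF j]] by simp
  qed
  ultimately show ?thesis unfolding acts_with_eigenvalue_def by blast
qed

end

section \<open>The matrix of an algebra element on a cell module\<close>

context left_cell
begin

lemma entry_of_real:
  assumes "\<And>s. s \<in> carrier S \<Longrightarrow> a s = complex_of_real (w s)"
  shows "entry a y x = complex_of_real (entry w y x)"
  unfolding entry_def of_real_sum using assms by (intro sum.cong) auto

lemma delta_span: "x \<in> L \<Longrightarrow> delta x \<in> basis_span K S L"
  using K_closed(1,2) by (auto simp: span_L_iff delta_def)

lemma act_delta: "x \<in> L \<Longrightarrow> act f (delta x) y = (if y \<in> L then entry f y x else 0)"
proof -
  assume x: "x \<in> L"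
  have "(\<Sum>z\<in>L. entry f y z * delta x z) = (\<Sum>z\<in>L. if z = x then entry f y x else 0)"
    by (intro sum.cong) (auto simp: delta_def)
  then show ?thesis using x finite_cell by (simp add: act_def)
qed

lemma finsum_iota:
  assumes "finite I" "x ` I \<subseteq> L" "inj_on x I" "\<And>i. i \<in> I \<Longrightarrow> c i \<in> K"
  shows "(\<Oplus>\<^bsub>M\<^esub>i\<in>I. scal (c i) \<odot>\<^bsub>M\<^esub> \<iota> (delta (x i))) = \<iota> (\<lambda>z. \<Sum>i\<in>I. c i * delta (x i) z)"
  using assms
proof (induction I rule: finite_induct)
  case empty
  then show ?case using iota_zero by simp
next
  case (insert j I)
  let ?f = "\<lambda>i. scal (c i) \<odot>\<^bsub>M\<^esub> \<iota> (delta (x i))"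
  have mem: "?f i = \<iota> (\<lambda>z. c i * delta (x i) z)" "(\<lambda>z. c i * delta (x i) z) \<in> basis_span K S L" if "i \<in> insert j I" for i
    using that insert.prems iota_scalar[OF _ delta_span] K_closed(1,4) by (auto simp: span_L_iff delta_def)
  have sp: "(\<lambda>z. \<Sum>i\<in>I. c i * delta (x i) z) \<in> basis_span K S L"
    using mem(2) by (auto simp: span_L_iff intro!: subfield_complex_sum[OF subfield_K] sum.neutral)
  have "(\<Oplus>\<^bsub>M\<^esub>i\<in>insert j I. ?f i) = ?f j \<oplus>\<^bsub>M\<^esub> (\<Oplus>\<^bsub>M\<^esub>i\<in>I. ?f i)"
    using insert.hyps mem iota_M by (intro M.M.finsum_insert) auto
  also have "(\<Oplus>\<^bsub>M\<^esub>i\<in>I. ?f i) = \<iota> (\<lambda>z. \<Sum>i\<in>I. c i * delta (x i) z)"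
    using insert by (auto simp: inj_on_def)
  finally show ?case using mem[of j] iota_add[OF mem(2) sp, of j] insert.hyps by simp
qed

text \<open>
  In the coordinates given by \<open>\<iota>\<close> the elements of the cell are the standard basis, and the action of \<open>f\<close>
  is by definition the matrix \<open>entry f\<close>.
\<close>

lemma cell_matrix:
  assumes xs: "distinct xs" "set xs = L" and f: "f \<in> carrier A"
  defines "n \<equiv> length xs"
  shows "matrix_in_basis K S M f (map (cell_basis K S L) xs) (mat n n (\<lambda>(i, j). entry f (xs ! i) (xs ! j)))"
    (is "matrix_in_basis K S M f ?bs ?B")
proof -
  let ?V = "underlying_space S M"
  interpret V: vectorspace KF ?V by (rule vectorspace_underlying[OF left_module_M])
  have bij: "bij_betw (\<lambda>i. xs ! i) {..<n} L" using bij_betw_nth[OF xs(1)] xs(2) by (auto simp: n_def)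
  have len: "length ?bs = n" by (simp add: n_def)
  have nth: "?bs ! i = \<iota> (delta (xs ! i))" if "i < n" for i using that by (simp add: n_def cell_basis_eq)
  have inj: "inj_on (cell_basis K S L) L"
  proof (rule inj_onI)
    fix x y assume xy: "x \<in> L" "y \<in> L" "cell_basis K S L x = cell_basis K S L y"
    then have "delta x = delta y" using iota_inj[OF delta_span delta_span] by (simp add: cell_basis_eq)
    then have "delta x x = delta y x" by simp
    then show "x = y" by (auto simp: delta_def split: if_splits)
  qed
  have setbs: "set ?bs = cell_basis K S L ` L" using xs by simp
  have bsV: "set ?bs \<subseteq> carrier ?V"
    unfolding setbs using iota_M[OF delta_span] by (auto simp: cell_basis_eq underlying_simps)
  have lincomb: "V.lincomb c (set ?bs) = \<iota> (\<lambda>z. if z \<in> L then c (cell_basis K S L z) else 0)"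
    if c: "c \<in> set ?bs \<rightarrow> K" for c
  proof -
    have "V.lincomb c (set ?bs) = (\<Oplus>\<^bsub>M\<^esub>b\<in>cell_basis K S L ` L. scal (c b) \<odot>\<^bsub>M\<^esub> b)"
      unfolding V.lincomb_def setbs by (simp add: finsum_underlying underlying_simps)
    also have "\<dots> = (\<Oplus>\<^bsub>M\<^esub>x\<in>L. scal (c (cell_basis K S L x)) \<odot>\<^bsub>M\<^esub> cell_basis K S L x)"
      using inj c bsV unfolding setbs
      by (intro M.M.finsum_reindex) (auto intro!: M.smult_closed scal_A simp: underlying_simps)
    also have "\<dots> = \<iota> (\<lambda>z. \<Sum>x\<in>L. c (cell_basis K S L x) * delta x z)"
      unfolding cell_basis_eq using c finite_cell unfolding setbs cell_basis_eq
      by (intro finsum_iota[where x = "\<lambda>x. x"]) auto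
    also have "(\<lambda>z. \<Sum>x\<in>L. c (cell_basis K S L x) * delta x z) = (\<lambda>z. if z \<in> L then c (cell_basis K S L z) else 0)"
      using finite_cell by (auto simp: delta_def fun_eq_iff if_distrib cong: if_cong)
    finally show ?thesis .
  qed
  have "V.basis (set ?bs)"
    unfolding V.basis_criterion[OF finite_set bsV]
  proof (intro allI impI)
    fix m assume "m \<in> carrier ?V"
    then obtain v where v: "v \<in> basis_span K S L" "m = \<iota> v" using M_iota_ex by (auto simp: underlying_simps)
    define c where "c = restrict (\<lambda>b. v (inv_into L (cell_basis K S L) b)) (set ?bs)"
    have c: "c \<in> set ?bs \<rightarrow>\<^sub>E K" unfolding c_def setbs using v(1) by (auto simp: span_L_iff inv_into_into)
    have cL: "c (cell_basis K S L z) = v z" if "z \<in> L" for z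
      using that inj unfolding c_def setbs by (simp add: inv_into_f_f)
    have "(\<lambda>z. if z \<in> L then c (cell_basis K S L z) else 0) = v"
      using v(1) by (auto simp: cL span_L_iff)
    moreover have "c \<in> set ?bs \<rightarrow> K" using c unfolding PiE_iff Pi_iff by blast
    ultimately have "V.lincomb c (set ?bs) = \<iota> v" using lincomb[of c] by simp
    moreover have "d = c" if d: "d \<in> set ?bs \<rightarrow>\<^sub>E K" "V.lincomb d (set ?bs) = m" for d
    proof (rule PiE_ext[OF d(1) c])
      fix b assume "b \<in> set ?bs"
      then obtain z where z: "z \<in> L" "b = cell_basis K S L z" unfolding setbs by blast
      have dK: "d \<in> set ?bs \<rightarrow> K" using d(1) by (auto simp: PiE_iff)
      have "\<iota> (\<lambda>z. if z \<in> L then d (cell_basis K S L z) else 0) = \<iota> v" using lincomb[OF dK] d(2) v(2) by simp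
      moreover have "(\<lambda>z. if z \<in> L then d (cell_basis K S L z) else 0) \<in> basis_span K S L"
        using dK unfolding span_L_iff setbs by auto
      ultimately have "(\<lambda>z. if z \<in> L then d (cell_basis K S L z) else 0) = v" using iota_inj v(1) by blast
      from fun_cong[OF this, of z] show "d b = c b" using z(1) cL[OF z(1)] unfolding z(2) by simp
    qed
    ultimately show "\<exists>!c. c \<in> set ?bs \<rightarrow>\<^sub>E carrier KF \<and> V.lincomb c (set ?bs) = m"
      using c v(2) unfolding KF_simps by blast
  qed
  moreover have entryK: "entry f y x \<in> K" for y x
    unfolding entry_def using A_K[OF f] K_closed(1) by (intro subfield_complex_sum[OF subfield_K]) auto
  moreover have "f \<odot>\<^bsub>M\<^esub> ?bs ! j = (\<Oplus>\<^bsub>M\<^esub>i\<in>{..<n}. ?B $$ (i, j) \<odot>\<^bsub>?V\<^esub> ?bs ! i)" if j: "j < n" for j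
  proof -
    have xj: "xs ! i \<in> L" if "i < n" for i using that xs by (auto simp: n_def)
    have "(\<Oplus>\<^bsub>M\<^esub>i\<in>{..<n}. ?B $$ (i, j) \<odot>\<^bsub>?V\<^esub> ?bs ! i) =
        (\<Oplus>\<^bsub>M\<^esub>i\<in>{..<n}. scal (entry f (xs ! i) (xs ! j)) \<odot>\<^bsub>M\<^esub> \<iota> (delta (xs ! i)))"
      using j by (intro M.M.finsum_cong')
        (auto simp: underlying_simps nth intro!: M.smult_closed scal_A entryK iota_M delta_span xj)
    also have "\<dots> = \<iota> (\<lambda>z. \<Sum>i<n. entry f (xs ! i) (xs ! j) * delta (xs ! i) z)"
      using xs xj entryK by (intro finsum_iota) (auto simp: inj_on_def n_def nth_eq_iff_index_eq)
    also have "(\<lambda>z. \<Sum>i<n. entry f (xs ! i) (xs ! j) * delta (xs ! i) z) = act f (delta (xs ! j))"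
    proof
      fix z
      have "(\<Sum>i<n. entry f (xs ! i) (xs ! j) * delta (xs ! i) z) = (\<Sum>x\<in>L. entry f x (xs ! j) * delta x z)"
        by (rule sum.reindex_bij_betw[OF bij])
      also have "\<dots> = (if z \<in> L then entry f z (xs ! j) else 0)"
        using finite_cell by (auto simp: delta_def if_distrib cong: if_cong)
      finally show "(\<Sum>i<n. entry f (xs ! i) (xs ! j) * delta (xs ! i) z) = act f (delta (xs ! j)) z"
        using act_delta[OF xj[OF j]] by simp
    qed
    also have "\<iota> (act f (delta (xs ! j))) = f \<odot>\<^bsub>M\<^esub> ?bs ! j"
      using iota_act[OF f delta_span[OF xj[OF j]]] nth[OF j] by simp
    finally show ?thesis by simp
  qed
  moreover have "distinct ?bs" using xs inj by (simp add: distinct_map)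
  ultimately show ?thesis
    unfolding matrix_in_basis_def len by (auto simp: elements_mat_def)
qed

lemma cell_matrix_unique:
  assumes xs: "distinct xs" "set xs = L" and f: "f \<in> carrier A"
    and B: "matrix_in_basis K S M f (map (cell_basis K S L) xs) B"
  shows "B = mat (length xs) (length xs) (\<lambda>(i, j). entry f (xs ! i) (xs ! j))"
proof (rule eq_matI)
  let ?n = "length xs"
  have Bc: "B \<in> carrier_mat ?n ?n" and BK: "elements_mat B \<subseteq> K"
    using B unfolding matrix_in_basis_def by auto
  show "dim_row B = dim_row (mat ?n ?n (\<lambda>(i, j). entry f (xs ! i) (xs ! j)))"
    "dim_col B = dim_col (mat ?n ?n (\<lambda>(i, j). entry f (xs ! i) (xs ! j)))" using Bc by auto
  fix i j assume ij: "i < dim_row (mat ?n ?n (\<lambda>(i, j). entry f (xs ! i) (xs ! j)))"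
    "j < dim_col (mat ?n ?n (\<lambda>(i, j). entry f (xs ! i) (xs ! j)))"
  have xL: "xs ! k \<in> L" if "k < ?n" for k using that xs by auto
  have BKi: "B $$ (k, j) \<in> K" if "k < ?n" for k using elements_matI[OF Bc that, of j] BK ij by auto
  have "\<iota> (act f (delta (xs ! j))) = f \<odot>\<^bsub>M\<^esub> (map (cell_basis K S L) xs ! j)"
    using iota_act[OF f delta_span[OF xL]] ij by (simp add: cell_basis_eq)
  also have "\<dots> = (\<Oplus>\<^bsub>M\<^esub>k\<in>{..<?n}. B $$ (k, j) \<odot>\<^bsub>underlying_space S M\<^esub> map (cell_basis K S L) xs ! k)"
    using B ij unfolding matrix_in_basis_def by simp
  also have "\<dots> = (\<Oplus>\<^bsub>M\<^esub>k\<in>{..<?n}. scal (B $$ (k, j)) \<odot>\<^bsub>M\<^esub> \<iota> (delta (xs ! k)))"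
    by (intro M.M.finsum_cong')
      (auto simp: underlying_simps cell_basis_eq intro!: M.smult_closed scal_A BKi iota_M delta_span xL)
  also have "\<dots> = \<iota> (\<lambda>z. \<Sum>k<?n. B $$ (k, j) * delta (xs ! k) z)"
    using xs xL BKi by (intro finsum_iota) (auto simp: inj_on_def nth_eq_iff_index_eq)
  finally have eq: "\<iota> (act f (delta (xs ! j))) = \<iota> (\<lambda>z. \<Sum>k<?n. B $$ (k, j) * delta (xs ! k) z)" .
  have "(\<lambda>z. \<Sum>k<?n. B $$ (k, j) * delta (xs ! k) z) \<in> basis_span K S L"
    unfolding span_L_iff
  proof (intro conjI ballI allI impI)
    show "(\<Sum>k<?n. B $$ (k, j) * delta (xs ! k) z) \<in> K" for z
      using BKi K_closed(1,2,4) by (intro subfield_complex_sum[OF subfield_K]) (auto simp: delta_def)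
    show "(\<Sum>k<?n. B $$ (k, j) * delta (xs ! k) z) = 0" if "z \<notin> L" for z
      using that xL by (intro sum.neutral) (auto simp: delta_def)
  qed
  then have "act f (delta (xs ! j)) = (\<lambda>z. \<Sum>k<?n. B $$ (k, j) * delta (xs ! k) z)"
    using iota_inj[OF act_span[OF f delta_span] _ eq] xL ij by simp
  from fun_cong[OF this, of "xs ! i"]
  have "act f (delta (xs ! j)) (xs ! i) = (\<Sum>k<?n. B $$ (k, j) * delta (xs ! k) (xs ! i))" .
  also have "\<dots> = (\<Sum>k<?n. if k = i then B $$ (i, j) else 0)"
    using xs(1) ij by (intro sum.cong) (auto simp: delta_def nth_eq_iff_index_eq)
  finally show "B $$ (i, j) = mat ?n ?n (\<lambda>(i, j). entry f (xs ! i) (xs ! j)) $$ (i, j)"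
    using ij act_delta[OF xL] xL by simp
qed

lemma delta_acts_iff:
  assumes s: "s \<in> carrier S"
  shows "(\<exists>m\<in>carrier M. delta s \<odot>\<^bsub>M\<^esub> m \<noteq> \<zero>\<^bsub>M\<^esub>) \<longleftrightarrow> (\<exists>x\<in>L. s \<otimes> x \<in> L)"
proof -
  have entry: "entry (delta s) y x = (if s \<otimes> x = y then 1 else 0)" for x y
  proof -
    have "entry (delta s) y x = (\<Sum>t\<in>carrier S. if t = s then (if s \<otimes> x = y then 1 else 0) else 0)"
      unfolding entry_def by (intro sum.cong) (auto simp: delta_def)
    then show ?thesis using s finite_S by simp
  qed
  show ?thesis
  proof
    assume "\<exists>x\<in>L. s \<otimes> x \<in> L"
    then obtain x where x: "x \<in> L" "s \<otimes> x \<in> L" by blast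
    have "delta s \<odot>\<^bsub>M\<^esub> \<iota> (delta x) \<noteq> \<zero>\<^bsub>M\<^esub>"
    proof
      assume "delta s \<odot>\<^bsub>M\<^esub> \<iota> (delta x) = \<zero>\<^bsub>M\<^esub>"
      then have "\<iota> (act (delta s) (delta x)) = \<iota> (\<lambda>x. 0)"
        using iota_act[OF delta_in_A(1)[OF s] delta_span[OF x(1)]] iota_zero by simp
      moreover have "(\<lambda>x. 0) \<in> basis_span K S L" using K_closed(1) by (simp add: span_L_iff)
      ultimately have "act (delta s) (delta x) = (\<lambda>x. 0)"
        using iota_inj act_span[OF delta_in_A(1)[OF s] delta_span[OF x(1)]] by blast
      then have "act (delta s) (delta x) (s \<otimes> x) = 0" by simp
      then show False using act_delta[OF x(1)] x(2) entry by simp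
    qed
    then show "\<exists>m\<in>carrier M. delta s \<odot>\<^bsub>M\<^esub> m \<noteq> \<zero>\<^bsub>M\<^esub>" using iota_M[OF delta_span[OF x(1)]] by blast
  next
    assume "\<exists>m\<in>carrier M. delta s \<odot>\<^bsub>M\<^esub> m \<noteq> \<zero>\<^bsub>M\<^esub>"
    then obtain m where m: "m \<in> carrier M" "delta s \<odot>\<^bsub>M\<^esub> m \<noteq> \<zero>\<^bsub>M\<^esub>" by blast
    then obtain v where v: "v \<in> basis_span K S L" "m = \<iota> v" using M_iota_ex by blast
    show "\<exists>x\<in>L. s \<otimes> x \<in> L"
    proof (rule ccontr)
      assume none: "\<not> (\<exists>x\<in>L. s \<otimes> x \<in> L)"
      have "act (delta s) v y = 0" for y
        unfolding act_def using none entry by (auto intro!: sum.neutral)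
      then have "act (delta s) v = (\<lambda>x. 0)" by auto
      then show False using m(2) iota_act[OF delta_in_A(1)[OF s] v(1)] iota_zero unfolding v(2) by simp
    qed
  qed
qed

lemma entry_pos:
  fixes w :: "'a \<Rightarrow> real"
  assumes w: "\<And>s. s \<in> carrier S \<Longrightarrow> 0 < w s" and zx: "z \<in> L" "x \<in> L"
  shows "0 < entry w z x"
proof -
  obtain s where s: "s \<in> carrier S" "z = s \<otimes> x" using cell_le[OF zx(2,1)] unfolding left_le_def by blast
  show ?thesis unfolding entry_def using finite_S w s by (intro sum_pos2[of _ s]) (auto intro: less_imp_le)
qed

text \<open>
  Any two elements of a left cell are left multiples of each other, so positive coefficients give a
  positive matrix. The left eigenvector is indexed by the elements of the cell, independently of the
  enumeration \<open>xs\<close>.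
\<close>

lemma cell_perron_frobenius_left:
  assumes xs: "distinct xs" "set xs = L" and a: "a \<in> carrier A"
    and w: "\<And>s. s \<in> carrier S \<Longrightarrow> 0 < w s" "\<And>s. s \<in> carrier S \<Longrightarrow> a s = complex_of_real (w s)"
    and B: "matrix_in_basis K S M a (map (cell_basis K S L) xs) B"
  obtains r y where "perron_frobenius_eigenvalue B r" "\<And>x. x \<in> L \<Longrightarrow> 0 < y x"
    "\<And>x. x \<in> L \<Longrightarrow> (\<Sum>z\<in>L. y z * entry w z x) = r * y x"
proof -
  let ?n = "length xs"
  have Beq: "B = mat ?n ?n (\<lambda>(i, j). entry a (xs ! i) (xs ! j))" by (rule cell_matrix_unique[OF xs a B])
  have n: "0 < ?n" using cell_nonempty xs(2) by (metis length_greater_0_conv list.set(1) empty_iff)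
  have xL: "xs ! i \<in> L" if "i < ?n" for i using that xs by auto
  obtain r y where ry: "perron_frobenius_eigenvalue B r" "\<And>i. i < ?n \<Longrightarrow> 0 < y i"
    "\<And>j. j < ?n \<Longrightarrow> (\<Sum>i<?n. y i * entry w (xs ! i) (xs ! j)) = r * y j"
  proof (rule perron_frobenius_left[of B ?n "\<lambda>i j. entry w (xs ! i) (xs ! j)"])
    show "B \<in> carrier_mat ?n ?n" unfolding Beq by simp
    show "B $$ (i, j) = entry w (xs ! i) (xs ! j)" if "i < ?n" "j < ?n" for i j
      using that unfolding Beq using entry_of_real[OF w(2)] by simp
    show "0 < entry w (xs ! i) (xs ! j)" if "i < ?n" "j < ?n" for i j
      using entry_pos[OF w(1) xL[OF that(1)] xL[OF that(2)]] .
    show "0 < ?n" by (rule n)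
  qed (rule that; assumption)
  have bij: "bij_betw (\<lambda>i. xs ! i) {..<?n} L" using bij_betw_nth[OF xs(1)] xs(2) by auto
  define y' where "y' x = y (inv_into {..<?n} (\<lambda>i. xs ! i) x)" for x
  have y': "y' (xs ! i) = y i" if "i < ?n" for i
    using that bij unfolding y'_def bij_betw_def by (simp add: inv_into_f_f)
  have ex: "\<exists>i<?n. x = xs ! i" if "x \<in> L" for x using that xs(2) by (metis in_set_conv_nth)
  show thesis
  proof (rule that[OF ry(1), of y'])
    fix x assume x: "x \<in> L"
    then obtain j where j: "j < ?n" "x = xs ! j" using ex by blast
    show "0 < y' x" using j y' ry(2) by simp
    have "(\<Sum>z\<in>L. y' z * entry w z x) = (\<Sum>i<?n. y' (xs ! i) * entry w (xs ! i) x)"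
      by (rule sum.reindex_bij_betw[OF bij, symmetric])
    also have "\<dots> = (\<Sum>i<?n. y i * entry w (xs ! i) (xs ! j))" using y' j by (intro sum.cong) auto
    finally show "(\<Sum>z\<in>L. y' z * entry w z x) = r * y' x" using ry(3) j y' by simp
  qed
qed

end

section \<open>The special subquotient and the top of the standard module\<close>

context apex_cell
begin

lemma scal_cancel:
  assumes "left_module A X" "x \<in> carrier X" "k \<in> K" "k \<noteq> 0"
  shows "scal (inverse k) \<odot>\<^bsub>X\<^esub> (scal k \<odot>\<^bsub>X\<^esub> x) = x"
proof -
  interpret X: left_module A X by fact
  have "scal (inverse k) \<odot>\<^bsub>X\<^esub> (scal k \<odot>\<^bsub>X\<^esub> x) = scal (inverse k * k) \<odot>\<^bsub>X\<^esub> x"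
    using assms K_closed(6) by (simp only: scal_mult X.smult_assoc scal_A)
  also have "\<dots> = \<one>\<^bsub>A\<^esub> \<odot>\<^bsub>X\<^esub> x" using assms(4) scal_one by simp
  finally show ?thesis using X.smult_one[OF assms(2)] by simp
qed

abbreviation "m0 \<equiv> \<iota> v0"

lemma m0_M: "m0 \<in> carrier M" by (rule iota_M[OF v0_span])

lemma gsum_M: "m \<in> carrier M \<Longrightarrow> \<exists>k\<in>K. gsum \<odot>\<^bsub>M\<^esub> m = scal k \<odot>\<^bsub>M\<^esub> m0"
proof -
  assume "m \<in> carrier M"
  then obtain v where v: "v \<in> basis_span K S L" "m = \<iota> v" using M_iota_ex by blast
  obtain k where k: "k \<in> K" "act gsum v = (\<lambda>x. k * v0 x)" using act_gsum[OF v(1)] by blast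
  have "gsum \<odot>\<^bsub>M\<^esub> m = scal k \<odot>\<^bsub>M\<^esub> m0"
    using iota_act[OF gsum_A v(1)] iota_scalar[OF k(1) v0_span] k(2) v(2) by simp
  then show ?thesis using k(1) by blast
qed

lemma gsum_m0: "\<exists>k\<in>K. k \<noteq> 0 \<and> gsum \<odot>\<^bsub>M\<^esub> m0 = scal k \<odot>\<^bsub>M\<^esub> m0"
proof -
  obtain k where k: "k \<in> K" "act gsum v0 = (\<lambda>x. k * v0 x)" using act_gsum[OF v0_span] by blast
  have "k \<noteq> 0" using act_gsum_v0 k(2) by auto
  then show ?thesis using iota_act[OF gsum_A v0_span] iota_scalar[OF k(1) v0_span] k by auto
qed

lemma act_v0_lower: assumes u: "u \<in> Le.W" shows "act u v0 = (\<lambda>x. 0)"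
proof
  fix y
  have "(if s \<otimes> x = y then u s else 0) * v0 x = 0" if "y \<in> L" "x \<in> L" "s \<in> carrier S" for s x
    using lower_annihilates[of s x] u that Le_W_iff by auto
  then show "act u v0 y = 0"
    unfolding act_def entry_def by (auto simp: sum_distrib_right intro!: sum.neutral)
qed

text \<open>
  Each \<open>g\<close> in \<open>G\<close> permutes \<open>X0\<close> and hence fixes \<open>v0\<close>. The value at \<open>y\<close> is computed from the only
  preimage of \<open>y\<close> in \<open>X0\<close>, namely \<open>h y\<close> for the inverse \<open>h\<close> of \<open>g\<close>.
\<close>

lemma act_v0_KG: assumes p: "p \<in> carrier KG" shows "act p v0 = (\<lambda>x. (\<Sum>g\<in>G. p g) * v0 x)"
proof
  fix y
  have out: "p s = 0" if "s \<notin> G" for s using p that KG_iff by blast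
  have count: "(\<Sum>x\<in>L. (if g \<otimes> x = y then p g else 0) * v0 x) = p g * v0 y" if g: "g \<in> G" and y: "y \<in> L" for g
  proof -
    obtain h where h: "h \<in> G" "h \<otimes> g = e" "g \<otimes> h = e" using G_inverse[OF g] by blast
    note c = G_D[OF g] G_D[OF h(1)]
    show ?thesis
    proof (cases "y \<in> X0")
      case True
      have gx: "g \<otimes> x = y \<longleftrightarrow> x = h \<otimes> y" if x: "x \<in> X0" for x
      proof
        assume "g \<otimes> x = y"
        then have "h \<otimes> y = h \<otimes> g \<otimes> x" using c X0_D(3)[OF x] by (simp add: m_assoc)
        then show "x = h \<otimes> y" using h X0_D[OF x] by simp
      next
        assume "x = h \<otimes> y"
        then have "g \<otimes> x = g \<otimes> h \<otimes> y" using c X0_D(3)[OF True] by (simp add: m_assoc)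
        then show "g \<otimes> x = y" using h X0_D[OF True] by simp
      qed
      have "(\<Sum>x\<in>L. (if g \<otimes> x = y then p g else 0) * v0 x) = (\<Sum>x\<in>L. if x = h \<otimes> y then p g else 0)"
        using gx G_X0[OF h(1) True] by (intro sum.cong) (auto simp: v0_def)
      then show ?thesis using finite_cell X0_D(1)[OF G_X0[OF h(1) True]] True by (simp add: v0_def)
    next
      case False
      then have "(if g \<otimes> x = y then p g else 0) * v0 x = 0" for x using G_X0[OF g] by (auto simp: v0_def)
      then show ?thesis using False by (simp add: v0_def)
    qed
  qed
  show "act p v0 y = (\<Sum>g\<in>G. p g) * v0 y"
  proof (cases "y \<in> L")
    case True
    have "act p v0 y = (\<Sum>s\<in>carrier S. \<Sum>x\<in>L. (if s \<otimes> x = y then p s else 0) * v0 x)"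
      unfolding act_def entry_def using True by (subst sum.swap) (simp add: sum_distrib_right)
    also have "\<dots> = (\<Sum>s\<in>G. \<Sum>x\<in>L. (if s \<otimes> x = y then p s else 0) * v0 x)"
      using finite_S G_D(1) out by (intro sum.mono_neutral_right) (auto intro!: sum.neutral)
    also have "\<dots> = (\<Sum>g\<in>G. p g) * v0 y" using count True by (simp add: sum_distrib_right)
    finally show ?thesis .
  next
    case False
    then show ?thesis using X0_D(1) by (auto simp: act_def v0_def)
  qed
qed

lemma phi_hom: "(\<lambda>u. u \<odot>\<^bsub>M\<^esub> m0) \<in> module_hom A Le.U M"
  unfolding module_hom_def
  using Le_U_D(1) m0_M by (auto simp: Le.U_simps M.smult_closed M.smult_l_distr M.smult_assoc)

lemma phi_lower: "u \<in> Le.W \<Longrightarrow> u \<odot>\<^bsub>M\<^esub> m0 = \<zero>\<^bsub>M\<^esub>"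
  using iota_act[OF _ v0_span, of u] act_v0_lower[of u] iota_zero Le_W_iff by simp

text \<open>
  The rule \<open>s \<otimes> 1 \<mapsto> s v0\<close> is well defined. It descends to the cell module of \<open>e\<close> because the lower
  ideal annihilates \<open>v0\<close>, and the pairing \<open>(m, k) \<mapsto> k \<phi>(m)\<close> is balanced because \<open>G\<close> fixes \<open>v0\<close>.
\<close>

lemma Tm_zero_imp:
  assumes u: "u \<in> carrier Le.U" "Tm u = \<zero>\<^bsub>\<Delta>\<^esub>"
  shows "u \<odot>\<^bsub>M\<^esub> m0 = \<zero>\<^bsub>M\<^esub>"
proof -
  have "Le.\<iota> u = \<zero>\<^bsub>Le.M\<^esub> \<Longrightarrow> u \<odot>\<^bsub>M\<^esub> m0 = \<zero>\<^bsub>M\<^esub>" if "u \<in> carrier Le.U" for u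
    using that Le.iota_zero_iff[OF that] phi_lower by (simp add: Le.M_zero)
  then obtain \<phi> where \<phi>: "\<phi> \<in> module_hom A Le.M M" "\<And>u. u \<in> carrier Le.U \<Longrightarrow> \<phi> (Le.\<iota> u) = u \<odot>\<^bsub>M\<^esub> m0"
    using module_hom_factor[OF Le.left_module_U Le.left_module_M left_module_M Le.iota_hom Le.iota_surj phi_hom] by blast
  have \<phi>c: "\<phi> m \<in> carrier M" if "m \<in> carrier Le.M" for m using module_hom_closed[OF \<phi>(1)] that by auto
  have "scal 1 \<odot>\<^bsub>M\<^esub> \<phi> (Le.\<iota> u) = \<zero>\<^bsub>M\<^esub>"
  proof (rule D.tens_zero_imp[where \<beta> = "\<lambda>m k. scal k \<odot>\<^bsub>M\<^esub> \<phi> m"])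
    show "abelian_group M" by (rule M.M.abelian_group_axioms)
    show "scal k \<odot>\<^bsub>M\<^esub> \<phi> m \<in> carrier M" if "m \<in> carrier Le.M" "k \<in> carrier triv" for m k
      using that \<phi>c by (simp add: triv_simps M.smult_closed scal_A)
    show "scal k \<odot>\<^bsub>M\<^esub> \<phi> (m \<oplus>\<^bsub>Le.M\<^esub> m') = scal k \<odot>\<^bsub>M\<^esub> \<phi> m \<oplus>\<^bsub>M\<^esub> scal k \<odot>\<^bsub>M\<^esub> \<phi> m'"
      if "m \<in> carrier Le.M" "m' \<in> carrier Le.M" "k \<in> carrier triv" for m m' k
      using that \<phi>c by (simp add: triv_simps M.smult_r_distr scal_A module_hom_add[OF \<phi>(1)])
    show "scal (k \<oplus>\<^bsub>triv\<^esub> k') \<odot>\<^bsub>M\<^esub> \<phi> m = scal k \<odot>\<^bsub>M\<^esub> \<phi> m \<oplus>\<^bsub>M\<^esub> scal k' \<odot>\<^bsub>M\<^esub> \<phi> m"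
      if "m \<in> carrier Le.M" "k \<in> carrier triv" "k' \<in> carrier triv" for m k k'
      using that \<phi>c by (simp only: triv_simps scal_add M.smult_l_distr scal_A)
    show "scal k \<odot>\<^bsub>M\<^esub> \<phi> (ract m p) = scal (p \<odot>\<^bsub>triv\<^esub> k) \<odot>\<^bsub>M\<^esub> \<phi> m"
      if m: "m \<in> carrier Le.M" and p: "p \<in> carrier KG" and k: "k \<in> carrier triv" for m p k
    proof -
      obtain w where w: "w \<in> carrier Le.U" "m = Le.\<iota> w" using Le_iota_ex[OF m] by blast
      have wA: "w \<in> carrier A" using Le_U_D(1)[OF w(1)] .
      have kK: "k \<in> K" using k by (simp add: triv_simps)
      define c where "c = (\<Sum>g\<in>G. p g)"
      have cK: "c \<in> K" unfolding c_def by (rule sum_KG[OF p])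
      have pm0: "p \<odot>\<^bsub>M\<^esub> m0 = scal c \<odot>\<^bsub>M\<^esub> m0"
        using iota_act[OF KG_A[OF p] v0_span] act_v0_KG[OF p] iota_scalar[OF cK v0_span] by (simp add: c_def)
      have "\<phi> (ract m p) = (w \<otimes>\<^bsub>A\<^esub> p) \<odot>\<^bsub>M\<^esub> m0"
        using w p ract_iota \<phi>(2)[OF mult_KG_U[OF w(1) p]] by simp
      also have "\<dots> = w \<odot>\<^bsub>M\<^esub> (scal c \<odot>\<^bsub>M\<^esub> m0)" using M.smult_assoc[OF wA KG_A[OF p] m0_M] pm0 by simp
      also have "\<dots> = (w \<otimes>\<^bsub>A\<^esub> scal c) \<odot>\<^bsub>M\<^esub> m0" using M.smult_assoc[OF wA scal_A[OF cK] m0_M] by simp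
      also have "\<dots> = scal c \<odot>\<^bsub>M\<^esub> \<phi> m"
        unfolding scal_central[OF cK wA] w(2) \<phi>(2)[OF w(1)] using M.smult_assoc[OF scal_A[OF cK] wA m0_M] by simp
      finally have "scal k \<odot>\<^bsub>M\<^esub> \<phi> (ract m p) = (scal k \<otimes>\<^bsub>A\<^esub> scal c) \<odot>\<^bsub>M\<^esub> \<phi> m"
        using M.smult_assoc[OF scal_A[OF kK] scal_A[OF cK] \<phi>c[OF m]] by simp
      also have "scal k \<otimes>\<^bsub>A\<^esub> scal c = scal (p \<odot>\<^bsub>triv\<^esub> k)"
        unfolding scal_mult[OF kK cK, symmetric] triv_simps c_def[symmetric] by (simp add: mult.commute)
      finally show ?thesis .
    qed
    show "Le.\<iota> u \<in> carrier Le.M" by (rule Le_iota_M[OF u(1)])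
    show "1 \<in> carrier triv" using K_closed(2) by (simp add: triv_simps)
    show "D.tens (Le.\<iota> u) 1 = \<zero>\<^bsub>D.T\<^esub>" using u(2) by (simp only: Tm_def D_T)
  qed
  then show ?thesis
    using M.smult_one[OF \<phi>c[OF Le_iota_M[OF u(1)]]] \<phi>(2)[OF u(1)] scal_one by simp
qed

text \<open>
  The map \<open>u \<otimes> 1 \<mapsto> u v0\<close>, followed by the projection, is nonzero since it sends the generator
  \<open>e \<otimes> 1\<close> to the class of \<open>v0\<close>, and hence onto. The element \<open>\<epsilon>\<close> acts as a nonzero operator on the target,
  where it multiplies the class of \<open>v0\<close> by a nonzero scalar, while it maps the standard module into the
  line of the generator.
\<close>

theorem standard_top_isomorphic:
  assumes P: "Module.submodule P A M" and Q: "Module.submodule Q A M" and QP: "Q \<subseteq> P"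
    and simple: "simple_module A (quotient_module (M\<lparr>carrier := P\<rparr>) Q)"
    and m0: "m0 \<in> P" "m0 \<notin> Q"
  shows "module_isomorphic A (module_top A \<Delta>) (quotient_module (M\<lparr>carrier := P\<rparr>) Q)"
    (is "module_isomorphic A _ ?X")
proof -
  let ?p = "\<lambda>x. Q +>\<^bsub>M\<lparr>carrier := P\<rparr>\<^esub> x"
  note X = M.subquotient_projection(1)[OF P Q QP] and pc = M.subquotient_projection(2)[OF P Q QP]
    and padd = M.subquotient_projection(4)[OF P Q QP] and psm = M.subquotient_projection(5)[OF P Q QP]
    and pz = M.subquotient_projection(6)[OF P Q QP]
  interpret X: left_module A ?X by (rule X)
  note PD = M.submoduleD[OF P] and QD = M.submoduleD[OF Q]
  define F where "F u = ?p (u \<odot>\<^bsub>M\<^esub> m0)" for u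
  have um0: "u \<odot>\<^bsub>M\<^esub> m0 \<in> P" if "u \<in> carrier A" for u using PD(4) that m0 by blast
  have F: "F \<in> module_hom A Le.U ?X"
    unfolding module_hom_def F_def
  proof (intro CollectI conjI allI impI)
    show "(\<lambda>u. ?p (u \<odot>\<^bsub>M\<^esub> m0)) \<in> carrier Le.U \<rightarrow> carrier ?X"
      using pc um0 Le_U_D(1) by blast
    show "?p ((u \<oplus>\<^bsub>Le.U\<^esub> v) \<odot>\<^bsub>M\<^esub> m0) = ?p (u \<odot>\<^bsub>M\<^esub> m0) \<oplus>\<^bsub>?X\<^esub> ?p (v \<odot>\<^bsub>M\<^esub> m0)"
      if "u \<in> carrier Le.U \<and> v \<in> carrier Le.U" for u v
      using that module_hom_add[OF phi_hom, of u v] padd[OF um0 um0] Le_U_D(1) by simp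
    show "?p ((f \<odot>\<^bsub>Le.U\<^esub> u) \<odot>\<^bsub>M\<^esub> m0) = f \<odot>\<^bsub>?X\<^esub> ?p (u \<odot>\<^bsub>M\<^esub> m0)"
      if "f \<in> carrier A \<and> u \<in> carrier Le.U" for f u
      using that module_hom_smult[OF phi_hom, of f u] psm[OF _ um0] Le_U_D(1) by simp
  qed
  have ker: "F u = \<zero>\<^bsub>?X\<^esub>" if u: "u \<in> carrier Le.U" "Tm u = \<zero>\<^bsub>\<Delta>\<^esub>" for u
    unfolding F_def Tm_zero_imp[OF u] using pz[OF PD(2)] QD(2) by simp
  obtain f where f: "f \<in> module_hom A \<Delta> ?X" "\<And>u. u \<in> carrier Le.U \<Longrightarrow> f (Tm u) = F u"
    using module_hom_factor[OF Le.left_module_U left_module_Delta X Tm_hom Tm_surj F ker] by blast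
  have em0: "delta e \<odot>\<^bsub>M\<^esub> m0 = m0"
  proof -
    have de: "delta e \<in> carrier KG" using e_in_G K_closed(1,2) by (auto simp: KG_iff delta_def)
    have "(\<Sum>g\<in>G. delta e g) = 1" using e_in_G finite_G by (simp add: delta_def)
    then show ?thesis using iota_act[OF KG_A[OF de] v0_span] act_v0_KG[OF de] by simp
  qed
  have fe: "f (Tm (delta e)) = ?p m0" using f(2)[OF delta_e_U(1)] em0 by (simp add: F_def)
  have surj: "f ` carrier \<Delta> = carrier ?X"
  proof -
    have "Module.submodule (f ` carrier \<Delta>) A ?X"
      by (rule module_hom_image_submodule[OF left_module_Delta X f(1) \<Delta>.carrier_submodule])
    moreover have "?p m0 \<in> f ` carrier \<Delta>"
      using fe module_hom_closed[OF Tm_hom] delta_e_U(1) by (metis PiE imageI)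
    then have "f ` carrier \<Delta> \<noteq> {\<zero>\<^bsub>?X\<^esub>}" using pz[OF m0(1)] m0(2) by auto
    ultimately show ?thesis using simple unfolding simple_module_def by blast
  qed
  have eps: "\<exists>x\<in>carrier ?X. gsum \<odot>\<^bsub>?X\<^esub> x \<noteq> \<zero>\<^bsub>?X\<^esub>"
  proof (rule bexI[OF _ pc[OF m0(1)]])
    obtain k where k: "k \<in> K" "k \<noteq> 0" "gsum \<odot>\<^bsub>M\<^esub> m0 = scal k \<odot>\<^bsub>M\<^esub> m0" using gsum_m0 by blast
    show "gsum \<odot>\<^bsub>?X\<^esub> ?p m0 \<noteq> \<zero>\<^bsub>?X\<^esub>"
    proof
      assume "gsum \<odot>\<^bsub>?X\<^esub> ?p m0 = \<zero>\<^bsub>?X\<^esub>"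
      then have "scal k \<odot>\<^bsub>M\<^esub> m0 \<in> Q"
        using psm[OF gsum_A m0(1)] pz[OF PD(4)[OF gsum_A m0(1)]] k(3) by simp
      then have "scal (inverse k) \<odot>\<^bsub>M\<^esub> (scal k \<odot>\<^bsub>M\<^esub> m0) \<in> Q" by (rule QD(4)[OF scal_A[OF K_closed(6)[OF k(1)]]])
      then show False using scal_cancel[OF left_module_M m0_M k(1,2)] m0(2) by simp
    qed
  qed
  show ?thesis
    by (rule module_top_isomorphic[OF left_module_Delta simple f(1) surj Delta_generated gsum_A eps gsum_Delta])
qed

end

locale weighted_apex_cell = apex_cell +
  fixes a w
  assumes a: "a \<in> carrier A" and w: "\<And>s. s \<in> carrier S \<Longrightarrow> 0 < w s"
    "\<And>s. s \<in> carrier S \<Longrightarrow> a s = complex_of_real (w s)"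
begin

lemma entry_a: "entry a y x = complex_of_real (entry w y x)"
  by (rule entry_of_real) (rule w(2))

text \<open>
  The general vanishing theorem, applied to the coordinate space \<open>V\<close> of the submodule \<open>P\<close> and to the
  matrices of \<open>a\<close> and \<open>\<epsilon>\<close>. The latter is nonnegative, and positive at \<open>(x0, x0)\<close> for \<open>x0\<close> in \<open>X0\<close>
  because \<open>e x0 = x0\<close>.
\<close>

lemma eigenfunctional_vanishes:
  assumes B: "matrix_in_basis K S M a (map (cell_basis K S L) xs) B" "distinct xs" "set xs = L"
    and r: "perron_frobenius_eigenvalue B r"
    and P: "Module.submodule P A M"
    and add: "\<And>x y. x \<in> P \<Longrightarrow> y \<in> P \<Longrightarrow> \<psi> (x \<oplus>\<^bsub>M\<^esub> y) = \<psi> x + \<psi> y"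
    and smult: "\<And>k x. k \<in> K \<Longrightarrow> x \<in> P \<Longrightarrow> \<psi> (scal k \<odot>\<^bsub>M\<^esub> x) = k * \<psi> x"
    and eig: "\<And>x. x \<in> P \<Longrightarrow> \<psi> (a \<odot>\<^bsub>M\<^esub> x) = complex_of_real r * \<psi> x"
    and kill: "\<And>x. x \<in> P \<Longrightarrow> \<psi> (gsum \<odot>\<^bsub>M\<^esub> x) = 0"
    and x: "x \<in> P"
  shows "\<psi> x = 0"
proof -
  define g :: "'a \<Rightarrow> 'a \<Rightarrow> real" where "g = entry (\<lambda>s. if s \<in> G then 1 else 0)"
  obtain r' y where ry: "perron_frobenius_eigenvalue B r'" "\<And>x. x \<in> L \<Longrightarrow> 0 < y x"
    "\<And>x. x \<in> L \<Longrightarrow> (\<Sum>z\<in>L. y z * entry w z x) = r' * y x"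
    by (rule cell_perron_frobenius_left[OF B(2,3) a w B(1)]) (assumption | (rule that; assumption))+
  have r': "r' = r" using perron_frobenius_eigenvalue_unique ry(1) r by blast
  define V where "V = {v \<in> basis_span K S L. \<iota> v \<in> P}"
  note PD = M.submoduleD[OF P]
  have act_b: "mat_act L (entry w) v = act a v" for v
    by (auto simp: mat_act_def act_def entry_a)
  have act_g: "mat_act L g v = act gsum v" for v
  proof -
    have "entry gsum z x = complex_of_real (g z x)" for z x
      unfolding g_def by (rule entry_of_real) (simp add: gsum_def)
    then show ?thesis by (auto simp: mat_act_def act_def)
  qed
  obtain x0 where x0: "x0 \<in> X0" using X0_nonempty by blast
  have actV: "act f v \<in> V" "f \<odot>\<^bsub>M\<^esub> \<iota> v = \<iota> (act f v)" if fv: "f \<in> carrier A" "v \<in> V" for f v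
  proof -
    have v: "v \<in> basis_span K S L" "\<iota> v \<in> P" using fv(2) by (simp_all add: V_def)
    show *: "f \<odot>\<^bsub>M\<^esub> \<iota> v = \<iota> (act f v)" by (rule iota_act[OF fv(1) v(1)])
    show "act f v \<in> V" using act_span[OF fv(1) v(1)] PD(4)[OF fv(1) v(2)] unfolding * by (simp add: V_def)
  qed
  obtain v where v: "v \<in> basis_span K S L" "x = \<iota> v" using x PD(1) M_iota_ex by blast
  have "\<psi> (\<iota> v) = 0"
  proof (rule perron_eigenfunctional_vanishes[where V = V and a = "entry w" and e = g and y = y and r = r and I = L
        and \<psi> = "\<lambda>v. \<psi> (\<iota> v)" and k = x0 and l = x0 and K = K])
    show "0 < entry w i j" if "i \<in> L" "j \<in> L" for i j using w(1) that by (rule entry_pos)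
    show "0 \<le> g i j" for i j unfolding g_def entry_def by (intro sum_nonneg) auto
    show "0 < g x0 x0"
      unfolding g_def entry_def using finite_S e e_in_G X0_D(2)[OF x0] by (intro sum_pos2[of _ e]) auto
    show "(\<Sum>i\<in>L. y i * entry w i j) = r * y j" if "j \<in> L" for j using ry(3)[OF that] r' by simp
    show "v \<in> V" using v x by (simp add: V_def)
    fix v assume vV: "v \<in> V"
    then have vs: "v \<in> basis_span K S L" "\<iota> v \<in> P" by (simp_all add: V_def)
    show "v i \<in> K" for i using vs(1) K_closed(1) by (cases "i \<in> L") (auto simp: span_L_iff)
    show "i \<notin> L \<Longrightarrow> v i = 0" for i using vs(1) by (simp add: span_L_iff)
    show "mat_act L (entry w) v \<in> V" "mat_act L g v \<in> V" unfolding act_b act_g using actV(1) a gsum_A vV by auto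
    show "\<psi> (\<iota> (mat_act L (entry w) v)) = complex_of_real r * \<psi> (\<iota> v)"
      unfolding act_b using actV(2)[OF a vV] eig[OF vs(2)] by simp
    show "\<psi> (\<iota> (mat_act L g v)) = 0"
      unfolding act_g using actV(2)[OF gsum_A vV] kill[OF vs(2)] by simp
    { fix w assume "w \<in> V"
      then have ws: "w \<in> basis_span K S L" "\<iota> w \<in> P" by (simp_all add: V_def)
      show "(\<lambda>i. v i + w i) \<in> V"
        using vs ws iota_add[OF vs(1) ws(1)] PD(3)[OF vs(2) ws(2)] K_closed(3) by (auto simp: V_def span_L_iff)
      show "\<psi> (\<iota> (\<lambda>i. v i + w i)) = \<psi> (\<iota> v) + \<psi> (\<iota> w)"
        using iota_add[OF vs(1) ws(1)] add[OF vs(2) ws(2)] by simp }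
    { fix c assume c: "c \<in> K"
      show "(\<lambda>i. c * v i) \<in> V"
        using vs c iota_scalar[OF c vs(1)] PD(4)[OF scal_A[OF c] vs(2)] K_closed(4) by (auto simp: V_def span_L_iff)
      show "\<psi> (\<iota> (\<lambda>i. c * v i)) = c * \<psi> (\<iota> v)"
        using iota_scalar[OF c vs(1)] smult[OF c vs(2)] by simp }
  qed (use ry subfield_K finite_cell X0_D(1)[OF x0] in auto)
  then show ?thesis using v by simp
qed

text \<open>
  An eigenfunctional on \<open>P/Q\<close>, pulled back to \<open>P\<close>, would vanish if \<open>\<epsilon>\<close> mapped \<open>P\<close> into \<open>Q\<close>. So some \<open>\<epsilon> x\<close>
  with \<open>x\<close> in \<open>P\<close> lies outside \<open>Q\<close>, and it is a nonzero multiple of \<open>v0\<close>.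
\<close>

lemma special_contains_m0:
  assumes sp: "special_subquotient K S L a X"
  shows "\<exists>P Q. Module.submodule P A M \<and> Module.submodule Q A M \<and> Q \<subseteq> P \<and>
    X = quotient_module (M\<lparr>carrier := P\<rparr>) Q \<and> simple_module A X \<and> m0 \<in> P \<and> m0 \<notin> Q"
proof -
  obtain P Q where P: "Module.submodule P A M" and Q: "Module.submodule Q A M" and QP: "Q \<subseteq> P"
    and X: "X = quotient_module (M\<lparr>carrier := P\<rparr>) Q" and simple: "simple_module A X"
    using sp unfolding special_subquotient_def subquotient_def by blast
  obtain r xs B where B: "distinct xs" "set xs = L" "matrix_in_basis K S M a (map (cell_basis K S L) xs) B"
    "perron_frobenius_eigenvalue B r" and acts: "acts_with_eigenvalue K S X a (complex_of_real r)"
    using sp unfolding special_subquotient_def cell_perron_frobenius_def by blast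
  let ?p = "\<lambda>x. Q +>\<^bsub>M\<lparr>carrier := P\<rparr>\<^esub> x"
  note pr = M.subquotient_projection[OF P Q QP, folded X]
  note Xm = pr(1) and pc = pr(2) and p_ex = pr(3) and padd = pr(4) and psm = pr(5) and pz = pr(6)
  note PD = M.submoduleD[OF P] and QD = M.submoduleD[OF Q]
  obtain \<psi> where "eigenfunctional X a (complex_of_real r) \<psi>"
    using acts_with_eigenvalue_imp_functional[OF Xm a acts] by blast
  then have \<psi>: "\<And>x y. x \<in> carrier X \<Longrightarrow> y \<in> carrier X \<Longrightarrow> \<psi> (x \<oplus>\<^bsub>X\<^esub> y) = \<psi> x + \<psi> y"
    "\<And>k x. k \<in> K \<Longrightarrow> x \<in> carrier X \<Longrightarrow> \<psi> (scal k \<odot>\<^bsub>X\<^esub> x) = k * \<psi> x"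
    "\<And>x. x \<in> carrier X \<Longrightarrow> \<psi> (a \<odot>\<^bsub>X\<^esub> x) = complex_of_real r * \<psi> x"
    "\<exists>x\<in>carrier X. \<psi> x \<noteq> 0"
    unfolding eigenfunctional_def by blast+
  have "\<exists>x\<in>P. gsum \<odot>\<^bsub>M\<^esub> x \<notin> Q"
  proof (rule ccontr)
    assume "\<not> (\<exists>x\<in>P. gsum \<odot>\<^bsub>M\<^esub> x \<notin> Q)"
    then have inQ: "gsum \<odot>\<^bsub>M\<^esub> x \<in> Q" if "x \<in> P" for x using that by blast
    have \<psi>0: "\<psi> \<zero>\<^bsub>X\<^esub> = 0"
      using \<psi>(2)[OF K_closed(1) pc[OF PD(2)]] psm[OF scal_A[OF K_closed(1)] PD(2)]
        M.smult_zero[OF scal_A[OF K_closed(1)]] pz[OF PD(2)] QD(2) by simp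
    have "\<psi> (?p x) = 0" if x: "x \<in> P" for x
    proof (rule eigenfunctional_vanishes[OF B(3,1,2,4) P, where \<psi> = "\<lambda>x. \<psi> (?p x)"])
      show "\<psi> (?p (x \<oplus>\<^bsub>M\<^esub> y)) = \<psi> (?p x) + \<psi> (?p y)" if "x \<in> P" "y \<in> P" for x y
        using that \<psi>(1) pc padd by simp
      show "\<psi> (?p (scal k \<odot>\<^bsub>M\<^esub> x)) = k * \<psi> (?p x)" if "k \<in> K" "x \<in> P" for k x
        using that \<psi>(2) pc psm scal_A by simp
      show "\<psi> (?p (a \<odot>\<^bsub>M\<^esub> x)) = complex_of_real r * \<psi> (?p x)" if "x \<in> P" for x
        using that \<psi>(3) pc psm a by simp
      show "\<psi> (?p (gsum \<odot>\<^bsub>M\<^esub> x)) = 0" if "x \<in> P" for x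
        using pz[OF PD(4)[OF gsum_A that]] inQ[OF that] \<psi>0 by simp
    qed (rule x)
    moreover obtain Y where Y: "Y \<in> carrier X" "\<psi> Y \<noteq> 0" using \<psi>(4) by blast
    moreover obtain x where "x \<in> P" "Y = ?p x" using p_ex[OF Y(1)] by blast
    ultimately show False by blast
  qed
  then obtain x where x: "x \<in> P" "gsum \<odot>\<^bsub>M\<^esub> x \<notin> Q" by blast
  obtain k where k: "k \<in> K" "gsum \<odot>\<^bsub>M\<^esub> x = scal k \<odot>\<^bsub>M\<^esub> m0" using gsum_M[OF subsetD[OF PD(1) x(1)]] by blast
  have "k \<noteq> 0"
  proof
    assume "k = 0"
    then have "gsum \<odot>\<^bsub>M\<^esub> x = \<zero>\<^bsub>M\<^esub>" unfolding k(2) using M.zero_smult[OF m0_M] by (simp add: A_simps)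
    then show False using x QD(2) by simp
  qed
  have "scal (inverse k) \<odot>\<^bsub>M\<^esub> (gsum \<odot>\<^bsub>M\<^esub> x) \<in> P" by (intro PD(4) scal_A K_closed(6) k(1) gsum_A x(1))
  then have "m0 \<in> P" unfolding k(2) using scal_cancel[OF left_module_M m0_M k(1) \<open>k \<noteq> 0\<close>] by simp
  moreover have "m0 \<notin> Q" using x(2) unfolding k(2) using QD(4)[OF scal_A[OF k(1)]] by blast
  ultimately show ?thesis using P Q QP X simple by blast
qed

text \<open>
  The submodule generated by \<open>v0\<close> has a largest submodule annihilated by \<open>\<epsilon>\<close>. The quotient is
  simple, because \<open>\<epsilon>\<close> brings every element outside \<open>Q\<close>, after multiplication by some \<open>f\<close>, back to a
  nonzero multiple of the generator. The functional given by the positive left eigenvector of \<open>a\<close>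
  descends to the quotient, since it vanishes on \<open>Q\<close> by lemma \<open>eigenfunctional_vanishes\<close>, and it is positive at \<open>v0\<close>.
\<close>

theorem special_subquotient_exists: "\<exists>X. special_subquotient K S L a X"
proof -
  obtain xs where xs: "distinct xs" "set xs = L" using finite_distinct_list[OF finite_cell] by blast
  define B where "B = mat (length xs) (length xs) (\<lambda>(i, j). entry a (xs ! i) (xs ! j))"
  have B: "matrix_in_basis K S M a (map (cell_basis K S L) xs) B" unfolding B_def by (rule cell_matrix[OF xs a])
  obtain r y where r: "perron_frobenius_eigenvalue B r" and y: "\<And>x. x \<in> L \<Longrightarrow> 0 < y x"
    and yb: "\<And>x. x \<in> L \<Longrightarrow> (\<Sum>z\<in>L. y z * entry w z x) = r * y x"
    by (rule cell_perron_frobenius_left[OF xs a w B]) (assumption | (rule that; assumption))+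
  define crd where "crd m = (THE v. v \<in> basis_span K S L \<and> \<iota> v = m)" for m
  have crd: "crd (\<iota> v) = v" if "v \<in> basis_span K S L" for v
    unfolding crd_def using that iota_inj by (intro the_equality) blast+
  \<comment> \<open>the pairing with the positive left eigenvector, an eigenfunctional on the whole cell module\<close>
  define \<phi> where "\<phi> m = (\<Sum>x\<in>L. complex_of_real (y x) * crd m x)" for m
  have \<phi>_iota: "\<phi> (\<iota> v) = (\<Sum>x\<in>L. complex_of_real (y x) * v x)" if "v \<in> basis_span K S L" for v
    unfolding \<phi>_def crd[OF that] ..
  have \<phi>_add: "\<phi> (m \<oplus>\<^bsub>M\<^esub> n) = \<phi> m + \<phi> n" if mn: "m \<in> carrier M" "n \<in> carrier M" for m n
  proof -
    obtain u v where uv: "u \<in> basis_span K S L" "m = \<iota> u" "v \<in> basis_span K S L" "n = \<iota> v" using mn M_iota_ex by metis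
    have "(\<lambda>x. u x + v x) \<in> basis_span K S L" using uv K_closed(3) by (auto simp: span_L_iff)
    then show ?thesis unfolding uv iota_add[OF uv(1,3)] using uv by (simp add: \<phi>_iota distrib_left sum.distrib)
  qed
  have \<phi>_smult: "\<phi> (scal k \<odot>\<^bsub>M\<^esub> m) = k * \<phi> m" if k: "k \<in> K" and m: "m \<in> carrier M" for k m
  proof -
    obtain v where v: "v \<in> basis_span K S L" "m = \<iota> v" using m M_iota_ex by metis
    have "(\<lambda>x. k * v x) \<in> basis_span K S L" using v k K_closed(4) by (auto simp: span_L_iff)
    then show ?thesis unfolding v iota_scalar[OF k v(1)] using v by (simp add: \<phi>_iota sum_distrib_left mult_ac)
  qed
  have \<phi>_a: "\<phi> (a \<odot>\<^bsub>M\<^esub> m) = complex_of_real r * \<phi> m" if m: "m \<in> carrier M" for m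
  proof -
    obtain v where v: "v \<in> basis_span K S L" "m = \<iota> v" using m M_iota_ex by metis
    have "\<phi> (a \<odot>\<^bsub>M\<^esub> m) = (\<Sum>z\<in>L. complex_of_real (y z) * (\<Sum>x\<in>L. complex_of_real (entry w z x) * v x))"
      unfolding v(2) iota_act[OF a v(1)] \<phi>_iota[OF act_span[OF a v(1)]] by (simp add: act_def entry_a)
    also have "\<dots> = (\<Sum>x\<in>L. complex_of_real (\<Sum>z\<in>L. y z * entry w z x) * v x)"
      unfolding sum_distrib_left of_real_sum sum_distrib_right by (subst sum.swap) (simp add: mult_ac)
    also have "\<dots> = (\<Sum>x\<in>L. complex_of_real r * (complex_of_real (y x) * v x))"
      using yb by (intro sum.cong) (auto simp: mult_ac)
    finally show ?thesis unfolding v(2) \<phi>_iota[OF v(1)] by (simp add: sum_distrib_left)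
  qed
  have \<phi>_m0: "\<phi> m0 \<noteq> 0"
  proof -
    obtain x where x: "x \<in> X0" using X0_nonempty by blast
    have "\<phi> m0 = complex_of_real (\<Sum>x\<in>L. y x * (if x \<in> X0 then 1 else 0))"
      unfolding \<phi>_iota[OF v0_span] of_real_sum by (intro sum.cong) (auto simp: v0_def)
    moreover have "0 < (\<Sum>x\<in>L. y x * (if x \<in> X0 then 1 else 0))"
      using finite_cell y X0_D(1)[OF x] x by (intro sum_pos2[of _ x]) (auto intro: less_imp_le)
    ultimately show ?thesis by (metis of_real_eq_0_iff less_irrefl)
  qed

  define P where "P = (\<lambda>f. f \<odot>\<^bsub>M\<^esub> m0) ` carrier A"
  define Q where "Q = {x \<in> P. \<forall>f\<in>carrier A. gsum \<odot>\<^bsub>M\<^esub> (f \<odot>\<^bsub>M\<^esub> x) = \<zero>\<^bsub>M\<^esub>}"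
  have PM: "P \<subseteq> carrier M" unfolding P_def using M.smult_closed m0_M by blast
  have P_ex: "\<exists>f\<in>carrier A. x = f \<odot>\<^bsub>M\<^esub> m0" if "x \<in> P" for x using that unfolding P_def by blast
  have P_mem: "f \<odot>\<^bsub>M\<^esub> m0 \<in> P" if "f \<in> carrier A" for f using that unfolding P_def by blast
  have m0P: "m0 \<in> P" using P_mem[OF A.one_closed] M.smult_one[OF m0_M] by simp
  interpret reg: left_module A "regular_module A" by (rule left_module_regular)
  have P: "Module.submodule P A M"
    using module_hom_image_submodule[OF left_module_regular left_module_M
        M.regular_module_orbit_hom[OF m0_M] reg.carrier_submodule]
    by (simp add: P_def regular_module_def)
  note PD = M.submoduleD[OF P]
  have QP: "Q \<subseteq> P" unfolding Q_def by blast
  have Q: "Module.submodule Q A M"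
  proof (rule M.submoduleI)
    show "Q \<subseteq> carrier M" using QP PM by blast
    show "\<zero>\<^bsub>M\<^esub> \<in> Q" unfolding Q_def using PD(2) gsum_A by (simp add: M.smult_zero)
    show "x \<oplus>\<^bsub>M\<^esub> z \<in> Q" if xz: "x \<in> Q" "z \<in> Q" for x z
    proof -
      have c: "x \<in> carrier M" "z \<in> carrier M" "x \<in> P" "z \<in> P" using xz QP PM by blast+
      have "gsum \<odot>\<^bsub>M\<^esub> (f \<odot>\<^bsub>M\<^esub> (x \<oplus>\<^bsub>M\<^esub> z)) = \<zero>\<^bsub>M\<^esub>" if f: "f \<in> carrier A" for f
        using xz f c gsum_A unfolding Q_def by (simp add: M.smult_r_distr M.smult_closed)
      then show ?thesis unfolding Q_def using PD(3)[OF c(3,4)] by blast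
    qed
    show "c \<odot>\<^bsub>M\<^esub> x \<in> Q" if cx: "c \<in> carrier A" "x \<in> Q" for c x
    proof -
      have x: "x \<in> carrier M" "x \<in> P" using cx QP PM by blast+
      have "gsum \<odot>\<^bsub>M\<^esub> (f \<odot>\<^bsub>M\<^esub> (c \<odot>\<^bsub>M\<^esub> x)) = \<zero>\<^bsub>M\<^esub>" if f: "f \<in> carrier A" for f
        using cx f A.m_closed[OF f cx(1)] unfolding M.smult_assoc[OF f cx(1) x(1), symmetric] Q_def by blast
      then show ?thesis unfolding Q_def using PD(4)[OF cx(1) x(2)] by blast
    qed
  qed
  note QD = M.submoduleD[OF Q]
  have m0Q: "m0 \<notin> Q"
  proof
    assume "m0 \<in> Q"
    then have "gsum \<odot>\<^bsub>M\<^esub> (\<one>\<^bsub>A\<^esub> \<odot>\<^bsub>M\<^esub> m0) = \<zero>\<^bsub>M\<^esub>" unfolding Q_def using A.one_closed by blast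
    then have g0: "gsum \<odot>\<^bsub>M\<^esub> m0 = \<zero>\<^bsub>M\<^esub>" using M.smult_one[OF m0_M] by simp
    obtain k where k: "k \<in> K" "k \<noteq> 0" "gsum \<odot>\<^bsub>M\<^esub> m0 = scal k \<odot>\<^bsub>M\<^esub> m0" using gsum_m0 by blast
    then have "k * \<phi> m0 = \<phi> \<zero>\<^bsub>M\<^esub>" using \<phi>_smult[OF k(1) m0_M] g0 by simp
    also have "\<phi> \<zero>\<^bsub>M\<^esub> = 0" using \<phi>_add[OF M.M.zero_closed M.M.zero_closed] by simp
    finally show False using k(2) \<phi>_m0 by simp
  qed
  let ?X = "quotient_module (M\<lparr>carrier := P\<rparr>) Q"
  let ?p = "\<lambda>x. Q +>\<^bsub>M\<lparr>carrier := P\<rparr>\<^esub> x"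
  note pr = M.subquotient_projection[OF P Q QP]
  note X = pr(1) and pc = pr(2) and p_ex = pr(3) and padd = pr(4) and psm = pr(5) and pz = pr(6)
  interpret X: left_module A ?X by (rule X)

  have simple: "simple_module A ?X"
    unfolding simple_module_def
  proof (intro conjI allI impI X)
    show "carrier ?X \<noteq> {\<zero>\<^bsub>?X\<^esub>}" using pc[OF m0P] pz[OF m0P] m0Q by auto
    fix H assume H: "Module.submodule H A ?X"
    note HD = X.submoduleD[OF H]
    show "H = {\<zero>\<^bsub>?X\<^esub>} \<or> H = carrier ?X"
    proof (rule disjCI)
      assume "H \<noteq> carrier ?X"
      have "Y = \<zero>\<^bsub>?X\<^esub>" if Y: "Y \<in> H" for Y
      proof (rule ccontr)
        assume "Y \<noteq> \<zero>\<^bsub>?X\<^esub>"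
        obtain x where x: "x \<in> P" "Y = ?p x" using p_ex Y HD(1) by blast
        then have "x \<notin> Q" using pz \<open>Y \<noteq> \<zero>\<^bsub>?X\<^esub>\<close> by blast
        then obtain f where f: "f \<in> carrier A" "gsum \<odot>\<^bsub>M\<^esub> (f \<odot>\<^bsub>M\<^esub> x) \<noteq> \<zero>\<^bsub>M\<^esub>" using x unfolding Q_def by blast
        have fx: "f \<odot>\<^bsub>M\<^esub> x \<in> P" by (rule PD(4)[OF f(1) x(1)])
        obtain k where k: "k \<in> K" "gsum \<odot>\<^bsub>M\<^esub> (f \<odot>\<^bsub>M\<^esub> x) = scal k \<odot>\<^bsub>M\<^esub> m0"
          using gsum_M[OF subsetD[OF PM fx]] by blast
        have k0: "k \<noteq> 0"
        proof
          assume "k = 0"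
          then have "gsum \<odot>\<^bsub>M\<^esub> (f \<odot>\<^bsub>M\<^esub> x) = \<zero>\<^bsub>M\<^esub>" unfolding k(2) using M.zero_smult[OF m0_M] by (simp add: A_simps)
          with f(2) show False by simp
        qed
        have "?p (gsum \<odot>\<^bsub>M\<^esub> (f \<odot>\<^bsub>M\<^esub> x)) \<in> H"
          unfolding psm[OF gsum_A fx] psm[OF f(1) x(1)] using Y unfolding x(2)
          by (rule HD(4)[OF gsum_A HD(4)[OF f(1)]])
        then have "scal k \<odot>\<^bsub>?X\<^esub> ?p m0 \<in> H" unfolding k(2) psm[OF scal_A[OF k(1)] m0P] .
        then have "scal (inverse k) \<odot>\<^bsub>?X\<^esub> (scal k \<odot>\<^bsub>?X\<^esub> ?p m0) \<in> H"
          by (rule HD(4)[OF scal_A[OF K_closed(6)[OF k(1)]]])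
        then have m0H: "?p m0 \<in> H" using scal_cancel[OF X pc[OF m0P] k(1) k0] by simp
        have "carrier ?X \<subseteq> H"
        proof
          fix Z assume "Z \<in> carrier ?X"
          then obtain z where "z \<in> P" "Z = ?p z" using p_ex by blast
          then obtain g where "g \<in> carrier A" "Z = ?p (g \<odot>\<^bsub>M\<^esub> m0)" using P_ex by blast
          then show "Z \<in> H" using psm[OF _ m0P] HD(4)[OF _ m0H] by simp
        qed
        then show False using HD(1) \<open>H \<noteq> carrier ?X\<close> by blast
      qed
      then show "H = {\<zero>\<^bsub>?X\<^esub>}" using HD(2) by blast
    qed
  qed

  have \<phi>_Q: "\<phi> x = 0" if x: "x \<in> Q" for x
  proof (rule eigenfunctional_vanishes[OF B xs r Q])
    have QM: "z \<in> carrier M" if "z \<in> Q" for z using QD(1) that by blast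
    show "\<phi> (u \<oplus>\<^bsub>M\<^esub> v) = \<phi> u + \<phi> v" if "u \<in> Q" "v \<in> Q" for u v using \<phi>_add QM that by blast
    show "\<phi> (scal k \<odot>\<^bsub>M\<^esub> u) = k * \<phi> u" if "k \<in> K" "u \<in> Q" for k u using \<phi>_smult QM that by blast
    show "\<phi> (a \<odot>\<^bsub>M\<^esub> u) = complex_of_real r * \<phi> u" if "u \<in> Q" for u using \<phi>_a QM that by blast
    show "\<phi> (gsum \<odot>\<^bsub>M\<^esub> u) = 0" if u: "u \<in> Q" for u
    proof -
      have "gsum \<odot>\<^bsub>M\<^esub> (\<one>\<^bsub>A\<^esub> \<odot>\<^bsub>M\<^esub> u) = \<zero>\<^bsub>M\<^esub>" using u A.one_closed unfolding Q_def by blast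
      then have "gsum \<odot>\<^bsub>M\<^esub> u = \<zero>\<^bsub>M\<^esub>" using M.smult_one[OF QM[OF u]] by simp
      then show ?thesis using \<phi>_add[OF M.M.zero_closed M.M.zero_closed] by simp
    qed
  qed (rule x)
  \<comment> \<open>the functional on the quotient, defined through representatives\<close>
  define \<psi> where "\<psi> Y = \<phi> (SOME x. x \<in> P \<and> Y = ?p x)" for Y
  have \<psi>_p: "\<psi> (?p x) = \<phi> x" if x: "x \<in> P" for x
  proof -
    define z where "z = (SOME z. z \<in> P \<and> ?p x = ?p z)"
    have z: "z \<in> P" "?p x = ?p z" using someI[of "\<lambda>z. z \<in> P \<and> ?p x = ?p z" x] x unfolding z_def by auto
    obtain q where q: "q \<in> Q" "x = q \<oplus>\<^bsub>M\<^esub> z" using pr(7)[OF x z] by blast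
    have "\<phi> x = \<phi> z"
      unfolding q(2) using \<phi>_add[of q z] \<phi>_Q[OF q(1)] QD(1) PM q(1) z(1) by auto
    then show ?thesis unfolding \<psi>_def z_def by simp
  qed
  have "eigenfunctional ?X a (complex_of_real r) \<psi>"
    unfolding eigenfunctional_def
  proof (intro conjI ballI)
    fix Y assume "Y \<in> carrier ?X"
    then obtain x where x: "x \<in> P" "Y = ?p x" using p_ex by blast
    have xM: "x \<in> carrier M" using x(1) PM by blast
    show "\<psi> (a \<odot>\<^bsub>?X\<^esub> Y) = complex_of_real r * \<psi> Y"
      unfolding x(2) psm[OF a x(1), symmetric] \<psi>_p[OF x(1)] \<psi>_p[OF PD(4)[OF a x(1)]] by (rule \<phi>_a[OF xM])
    { fix k assume k: "k \<in> K"
      show "\<psi> (scal k \<odot>\<^bsub>?X\<^esub> Y) = k * \<psi> Y"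
        unfolding x(2) psm[OF scal_A[OF k] x(1), symmetric] \<psi>_p[OF x(1)] \<psi>_p[OF PD(4)[OF scal_A[OF k] x(1)]]
        by (rule \<phi>_smult[OF k xM]) }
    { fix Z assume "Z \<in> carrier ?X"
      then obtain z where z: "z \<in> P" "Z = ?p z" using p_ex by blast
      have zM: "z \<in> carrier M" using z(1) PM by blast
      show "\<psi> (Y \<oplus>\<^bsub>?X\<^esub> Z) = \<psi> Y + \<psi> Z"
        unfolding x(2) z(2) padd[OF x(1) z(1), symmetric] \<psi>_p[OF x(1)] \<psi>_p[OF z(1)] \<psi>_p[OF PD(3)[OF x(1) z(1)]]
        by (rule \<phi>_add[OF xM zM]) }
  next
    show "\<exists>Y\<in>carrier ?X. \<psi> Y \<noteq> 0" using pc[OF m0P] \<psi>_p[OF m0P] \<phi>_m0 by (intro bexI[of _ "?p m0"]) auto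
  qed
  moreover have "vectorspace.fin_dim KF (underlying_space S ?X)"
  proof (rule cyclic_fin_dim[OF X pc[OF m0P]])
    have "(\<lambda>f. f \<odot>\<^bsub>?X\<^esub> ?p m0) ` carrier A = (\<lambda>f. ?p (f \<odot>\<^bsub>M\<^esub> m0)) ` carrier A"
      by (rule image_cong[OF refl psm[OF _ m0P, symmetric]])
    also have "\<dots> = carrier ?X" using pc[OF P_mem] p_ex P_ex by blast
    finally show "(\<lambda>f. f \<odot>\<^bsub>?X\<^esub> ?p m0) ` carrier A = carrier ?X" .
  qed
  ultimately have acts: "acts_with_eigenvalue K S ?X a (complex_of_real r)"
    by (rule functional_imp_acts_with_eigenvalue[OF X a])
  have "subquotient A M ?X" unfolding subquotient_def using P Q QP by blast
  moreover have "cell_perron_frobenius K S L a r"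
    unfolding cell_perron_frobenius_def using xs B r by blast
  ultimately show ?thesis unfolding special_subquotient_def using simple acts by blast
qed

end

text \<open>
  Some \<open>s = u e v\<close> in the apex maps some \<open>x\<close> in the cell into the cell, so \<open>v x\<close> and
  \<open>e v x\<close> are in the cell as well. Conversely, the two-sided cell of every \<open>s\<close> that acts nontrivially lies below the apex.
\<close>

lemma is_apex_imp_apex_cell:
  fixes S (structure)
  assumes "Group.monoid S" "finite (carrier S)" "subfield K (class_ring :: complex ring)"
    and L: "L \<in> left_cells S" and apex: "is_apex K S L J" and eJ: "e \<in> J" "e \<otimes> e = e"
  shows "apex_cell S K L e"
proof -
  interpret left_cell S K L
    using assms by (intro left_cell.intro finite_monoid_algebra.intro finite_monoid_algebra_axioms.intro left_cell_axioms.intro)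
  define JJ where "JJ = {J \<in> two_sided_cells S. \<exists>s\<in>J. \<exists>x\<in>carrier M. delta s \<odot>\<^bsub>M\<^esub> x \<noteq> \<zero>\<^bsub>M\<^esub>}"
  have J: "J \<in> JJ" and max: "\<And>J'. J' \<in> JJ \<Longrightarrow> two_sided_cell_le S J' J"
    using apex unfolding is_apex_def Let_def JJ_def by auto
  have JS: "J \<in> two_sided_cells S" using J by (simp add: JJ_def)
  have cS: "x \<in> carrier S" if "x \<in> J'" "J' \<in> two_sided_cells S" for x J'
    using that equiv_two_sided_equiv by (metis two_sided_cells_def in_quotient_imp_subset subsetD)
  have cle: "two_sided_le S x y" if "x \<in> J'" "y \<in> J'" "J' \<in> two_sided_cells S" for x y J'
    using that equiv_two_sided_equiv in_quotient_imp_in_rel[of "carrier S" "two_sided_equiv S" J' x y]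
    by (auto simp: two_sided_cells_def two_sided_equiv_def)
  have e: "e \<in> carrier S" using cS eJ JS by blast
  show ?thesis
  proof (intro apex_cell.intro apex_cell_axioms.intro left_cell_axioms e eJ(2))
    obtain s where s: "s \<in> J" "\<exists>x\<in>carrier M. delta s \<odot>\<^bsub>M\<^esub> x \<noteq> \<zero>\<^bsub>M\<^esub>" using J unfolding JJ_def by blast
    have sS: "s \<in> carrier S" using cS s JS by blast
    obtain x where x: "x \<in> L" "s \<otimes> x \<in> L" using delta_acts_iff[OF sS] s by blast
    obtain u v where uv: "u \<in> carrier S" "v \<in> carrier S" "s = u \<otimes> e \<otimes> v"
      using cle[OF eJ(1) s(1) JS] unfolding two_sided_le_def by blast
    have xS: "x \<in> carrier S" using cell_carrier x by blast
    have vC: "v \<otimes> x \<in> C" by (rule C_mult[OF uv(2) cell_C[OF x(1)]])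
    have "u \<otimes> (e \<otimes> (v \<otimes> x)) \<in> L" using x(2) uv e xS by (simp add: m_assoc)
    then have ev: "e \<otimes> (v \<otimes> x) \<in> L" by (rule cell_backward[OF uv(1) C_mult[OF e vC]])
    then have "v \<otimes> x \<in> L" by (rule cell_backward[OF e vC])
    then show "\<exists>x\<in>L. e \<otimes> x \<in> L" using ev by blast
  next
    fix s x assume s: "s \<in> carrier S" and x: "x \<in> L" "s \<otimes> x \<in> L"
    define J' where "J' = two_sided_equiv S `` {s}"
    have J': "J' \<in> two_sided_cells S" unfolding J'_def two_sided_cells_def using s by (rule quotientI)
    have sJ': "s \<in> J'" unfolding J'_def using s two_sided_le_refl by (simp add: two_sided_equiv_def)
    have "J' \<in> JJ" unfolding JJ_def using J' sJ' delta_acts_iff[OF s] x by blast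
    then obtain x' y' where xy: "x' \<in> J'" "y' \<in> J" "two_sided_le S x' y'"
      using max unfolding two_sided_cell_le_def by blast
    have "two_sided_le S s e"
      using two_sided_le_trans[OF s two_sided_le_trans[OF s cle[OF sJ' xy(1) J'] xy(3)] cle[OF xy(2) eJ(1) JS]] .
    then show "\<exists>u\<in>carrier S. \<exists>v\<in>carrier S. e = u \<otimes> s \<otimes> v" unfolding two_sided_le_def .
  qed
qed

theorem proposition8:
  fixes S :: "('a, 'b) monoid_scheme"
    and K :: "complex set"
    and L J :: "'a set"
    and e :: 'a
    and a :: "'a \<Rightarrow> complex"
  assumes "monoid S" and "finite (carrier S)"
    and "subfield K (class_ring :: complex ring)"
    and "L \<in> left_cells S"
    and "is_apex K S L J"
    and "e \<in> J" and "e \<otimes>\<^bsub>S\<^esub> e = e"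
    and "a \<in> carrier (semigroup_algebra K S)"
    and "\<forall>s \<in> carrier S. \<exists>c > 0. a s = complex_of_real c"
  defines "\<Delta> \<equiv> standard_module K S e (trivial_module K (maximal_subgroup S e))"
  defines "L\<^sub>e \<equiv> module_top (semigroup_algebra K S) \<Delta>"
  shows "(\<exists>X. special_subquotient K S L a X) \<and>
         (\<forall>X. special_subquotient K S L a X \<longrightarrow>
            module_isomorphic (semigroup_algebra K S) L\<^sub>e X)"
proof -
  have "Re (a s) > 0 \<and> a s = complex_of_real (Re (a s))" if "s \<in> carrier S" for s
    using assms(9) that by (metis Re_complex_of_real)
  then interpret weighted_apex_cell S K L e a "\<lambda>s. Re (a s)"
    using assms(8)
    by (intro weighted_apex_cell.intro weighted_apex_cell_axioms.intro
        is_apex_imp_apex_cell[OF assms(1-7)]) blast+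
  show ?thesis
  proof (intro conjI allI impI)
    show "\<exists>X. special_subquotient K S L a X" by (rule special_subquotient_exists)
    fix X assume "special_subquotient K S L a X"
    then obtain P Q where "Module.submodule P A M" "Module.submodule Q A M" "Q \<subseteq> P"
      and X: "X = quotient_module (M\<lparr>carrier := P\<rparr>) Q" "simple_module A X" and "m0 \<in> P" "m0 \<notin> Q"
      using special_contains_m0 by blast
    then show "module_isomorphic (semigroup_algebra K S) L\<^sub>e X"
      unfolding L\<^sub>e_def \<Delta>_def X(1) by (intro standard_top_isomorphic) simp_all
  qed
qed

end
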